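(* Let $n\ge 3$ and let $\beta=\beta(n)$ be Baragar's exponent (defined in the context). Then $\beta$ is the unique parameter in $(1,\infty)$ for which there exists a probability measure $\nu_\beta$ on $\Delta$ such that $$\int_{\Delta}f(w)\,d\nu_\beta(w)=\sum_{\gamma\in T_\Gamma}\int_{\Delta}f(\gamma.w)\,|\mathrm{Jac}_w(\gamma)|^{\frac{\beta}{n-1}}\,d\nu_\beta(w)$$ for all $f\in C^0(\Delta)$.
   Context: For $1\le j\le n-1$ define the linear maps $\gamma_j:\mathbf{R}^n\to\mathbf{R}^n$, $\gamma_j(y_1,\dots,y_n)=(y_1,\dots,\widehat{y_j},\dots,y_n,\sum_{i\neq j}y_i)$ (hat denotes omission). Let $\mathcal{H}=\{y\in\mathbf{R}_{\ge0}^n: y_1\le\cdots\le y_n,\ \sum_{j=1}^{n-1}y_j=y_n\}$; each $\gamma_j$ maps $\mathcal{H}$ into $\mathcal{H}$. Let $\Delta=\mathcal{H}/\mathbf{R}_{+}$, where each point is uniquely represented as $w=(w_1,\dots,w_{n-1},1)$ with $w_1\le\cdots\le w_{n-1}$ and $\sum_{j=1}^{n-1}w_j=1$; $\Delta$ is viewed as a compact subset of $\mathbf{R}^{n-2}$ via the coordinates $(w_1,\dots,w_{n-2})$, and the $\gamma_j$ induce self-maps of $\Delta$. Let $T_\Gamma=\{\gamma_{n-1}^{A}\gamma_j: A\in\mathbf{Z}_{\ge0},\ 1\le j\le n-2\}$. $|\mathrm{Jac}_w(\gamma)|$ is the absolute value of the Jacobian determinant of the induced map $\gamma:\Delta\to\Delta$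 at $w$. Baragar's exponent: there is a number $\beta(n)$ such that whenever $a\ge1$ is an integer, $k=0$, and the set of integer solutions of $x_1^2+\cdots+x_n^2=ax_1\cdots x_n$ contains a nonzero point, the number $N(R)$ of integer solutions with $\max_i|x_i|\le R$ satisfies $(\log R)^{\beta(n)-\varepsilon}\ll N(R)\ll(\log R)^{\beta(n)+\varepsilon}$ for every $\varepsilon>0$ (a theorem of Baragar). *)

theory Defs
  imports
    "HOL-Probability.Probability"
    "HOL-Library.Landau_Symbols"
    "Jordan_Normal_Form.Determinant"
begin

text \<open>
  Points of \<open>\<real>\<^sup>m\<close> are functions on \<^typ>\<open>nat\<close>, with coordinates indexed by \<open>1, \<dots>, m\<close> and
  vanishing at all other indices.  The product topology on \<^typ>\<open>nat \<Rightarrow> real\<close> then induces the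
  usual topology of \<open>\<real>\<^sup>m\<close>.
\<close>

definition vectors :: "nat \<Rightarrow> (nat \<Rightarrow> 'a::zero) set" where
  "vectors m = {x. \<forall>i. i \<notin> {1..m} \<longrightarrow> x i = 0}"

definition hurwitz_solutions :: "nat \<Rightarrow> int \<Rightarrow> (nat \<Rightarrow> int) set" where
  "hurwitz_solutions n a =
     {x \<in> vectors n. (\<Sum>i=1..n. (x i)\<^sup>2) = a * (\<Prod>i=1..n. x i)}"

definition hurwitz_count :: "nat \<Rightarrow> int \<Rightarrow> real \<Rightarrow> nat" where
  "hurwitz_count n a R =
     card {x \<in> hurwitz_solutions n a. \<forall>i\<in>{1..n}. \<bar>real_of_int (x i)\<bar> \<le> R}"

text \<open>
  At most one \<open>b\<close> has this property: for \<open>a = n\<close> the point \<open>(1, \<dots>, 1)\<close> is a nonzero solution.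
\<close>

definition baragar_exponent :: "nat \<Rightarrow> real \<Rightarrow> bool" where
  "baragar_exponent n b \<longleftrightarrow>
     (\<forall>a\<ge>1. (\<exists>x\<in>hurwitz_solutions n a. x \<noteq> (\<lambda>_. 0)) \<longrightarrow>
       (\<forall>\<epsilon>>0.
          (\<lambda>R. ln R powr (b - \<epsilon>)) \<in> O[at_top](\<lambda>R. real (hurwitz_count n a R)) \<and>
          (\<lambda>R. real (hurwitz_count n a R)) \<in> O[at_top](\<lambda>R. ln R powr (b + \<epsilon>))))"

definition gamma_map :: "nat \<Rightarrow> nat \<Rightarrow> (nat \<Rightarrow> real) \<Rightarrow> (nat \<Rightarrow> real)" where
  "gamma_map n j y = (\<lambda>i.
     if 1 \<le> i \<and> i < j then y i
     else if j \<le> i \<and> i < n then y (i + 1)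
     else if i = n then (\<Sum>k\<in>{1..n} - {j}. y k)
     else 0)"

definition T_Gamma :: "nat \<Rightarrow> ((nat \<Rightarrow> real) \<Rightarrow> (nat \<Rightarrow> real)) set" where
  "T_Gamma n = {(gamma_map n (n - 1) ^^ A) \<circ> gamma_map n j | A j. 1 \<le> j \<and> j \<le> n - 2}"

definition cone_H :: "nat \<Rightarrow> (nat \<Rightarrow> real) set" where
  "cone_H n = {y \<in> vectors n.
     (\<forall>i\<in>{1..n}. 0 \<le> y i) \<and>
     (\<forall>i\<in>{1..n}. \<forall>j\<in>{1..n}. i \<le> j \<longrightarrow> y i \<le> y j) \<and>
     (\<Sum>j=1..n-1. y j) = y n}"

text \<open>
  The ray through a nonzero \<open>y\<close> in the cone contains a unique point \<open>(w\<^sub>1, \<dots>, w\<^sub>n\<^sub>-\<^sub>1, 1)\<close>, and is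
  identified with \<open>(w\<^sub>1, \<dots>, w\<^sub>n\<^sub>-\<^sub>2)\<close>; \<open>simplex_lift\<close> recovers the former from the latter.
\<close>

definition ray_coords :: "nat \<Rightarrow> (nat \<Rightarrow> real) \<Rightarrow> (nat \<Rightarrow> real)" where
  "ray_coords n y = (\<lambda>i. if i \<in> {1..n-2} then y i / y n else 0)"

definition Delta :: "nat \<Rightarrow> (nat \<Rightarrow> real) set" where
  "Delta n = ray_coords n ` (cone_H n - {\<lambda>_. 0})"

definition simplex_lift :: "nat \<Rightarrow> (nat \<Rightarrow> real) \<Rightarrow> (nat \<Rightarrow> real)" where
  "simplex_lift n w = (\<lambda>i.
     if i \<in> {1..n-2} then w i
     else if i = n - 1 then 1 - (\<Sum>k=1..n-2. w k)
     else if i = n then 1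
     else 0)"

definition induced_map ::
  "nat \<Rightarrow> ((nat \<Rightarrow> real) \<Rightarrow> (nat \<Rightarrow> real)) \<Rightarrow> (nat \<Rightarrow> real) \<Rightarrow> (nat \<Rightarrow> real)" where
  "induced_map n g w = ray_coords n (g (simplex_lift n w))"

text \<open>
  For a composite \<open>g\<close> of the maps \<open>gamma_map n j\<close>, the formula for \<open>induced_map n g\<close> is a rational
  map with nonvanishing denominator on a neighbourhood of \<open>Delta n\<close> in \<open>\<real>\<^sup>n\<^sup>-\<^sup>2\<close>, so the partial
  derivatives also exist at boundary points.  Rows and columns of \<^const>\<open>Matrix.mat\<close> are numbered
  from \<open>0\<close>, whence the shift by \<^const>\<open>Suc\<close>.
\<close>

definition jacobian_det ::
  "nat \<Rightarrow> ((nat \<Rightarrow> real) \<Rightarrow> (nat \<Rightarrow> real)) \<Rightarrow> (nat \<Rightarrow> real) \<Rightarrow> real" where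
  "jacobian_det n g w =
     Determinant.det (Matrix.mat (n - 2) (n - 2)
       (\<lambda>(i, k). deriv (\<lambda>t. induced_map n g (w(Suc k := t)) (Suc i)) (w (Suc k))))"

text \<open>
  For \<open>f = 1\<close> all terms of the sum are nonnegative, so the unconditional convergence built into
  \<^const>\<open>has_sum\<close> is no restriction.
\<close>

definition conformal_measure :: "nat \<Rightarrow> real \<Rightarrow> (nat \<Rightarrow> real) measure \<Rightarrow> bool" where
  "conformal_measure n b \<nu> \<longleftrightarrow>
     prob_space \<nu> \<and> sets \<nu> = sets (restrict_space borel (Delta n)) \<and>
     (\<forall>f :: (nat \<Rightarrow> real) \<Rightarrow> real. continuous_on (Delta n) f \<longrightarrow>
        ((\<lambda>g. \<integral>w. f (induced_map n g w) * \<bar>jacobian_det n g w\<bar> powr (b / (real n - 1)) \<partial>\<nu>)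
          has_sum (\<integral>w. f w \<partial>\<nu>)) (T_Gamma n))"

end

theory Submission imports Defs begin

text \<open>
  Writing \<open>N\<^sub>\<gamma>(w)\<close> for the last coordinate of \<open>\<gamma> w\<close>, the Jacobian of \<open>\<gamma>\<close> is \<open>N\<^sub>\<gamma>(w)\<^sup>-\<^sup>(\<^sup>n\<^sup>-\<^sup>1\<^sup>)\<close>, so
  that a conformal measure is an eigenmeasure of eigenvalue \<open>1\<close> of the transfer operator
  \<open>L f (w) = \<Sum> N\<^sub>\<gamma>(w)\<^sup>-\<^sup>\<beta> f (\<gamma> w)\<close>.  Unlike \<open>\<gamma>\<^sub>n\<^sub>-\<^sub>1\<close>, which has a parabolic fixed point, the maps in
  \<open>T\<^sub>\<Gamma>\<close> satisfy \<open>N\<^sub>\<gamma> \<ge> 3/2\<close> and have bounded distortion: along every word, the values of the cocycle \<open>N\<close> at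
  different points are comparable.  Hence a conformal measure for \<open>b\<close> forces the Poincare series
  \<open>\<Sum> N\<^sub>\<sigma>\<^sup>-\<^sup>s\<close> over all words \<open>\<sigma>\<close> in \<open>T\<^sub>\<Gamma>\<close> to diverge at \<open>s = b\<close> and to converge for \<open>s > b\<close>.  Conversely the
  series diverges at its critical exponent, which exceeds \<open>1\<close>, and Patterson's construction (a weak
  limit of orbit measures weighted by the series) yields a conformal measure there.

  To identify the critical exponent with \<open>\<beta>\<close> it suffices to count the solutions for \<open>a = n\<close>.  They all
  descend to \<open>(1, \<dots>, 1)\<close>, and suitably normalised logarithms of the coordinates turn the Vieta moves
  into the maps \<open>\<gamma>\<^sub>j\<close>, up to bounded factors.  Summing over the initial powers of \<open>\<gamma>\<^sub>n\<^sub>-\<^sub>1\<close> costs only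
  the convergent series \<open>\<Sum> A\<^sup>-\<^sup>s\<close>, as \<open>s > 1\<close>.
\<close>

section \<open>Weak compactness\<close>

text \<open>Existence is proved without any knowledge of \<open>\<beta>\<close>: some conformal
  \<open>b > 1\<close> exists, each such \<open>b\<close> equals Baragar's exponent, and only this
  yields \<open>1 < \<beta>\<close>. Patterson's method usually needs modified weights in case the
  series converges at the critical exponent. Here that cannot happen: a bounded \<open>G\<close>
  with \<open>G = 1 + L b G\<close> leaves slack 1, and \<open>L s\<close> varies continuously in
  \<open>s\<close> because the majorant \<open>\<Sum> u powr -s\<close> stays finite slightly below
  \<open>b > 1\<close>. So convergence is an open condition above 1. It does not reach down to 1
  because \<open>L\<close> at 21/20 maps the constant 1 to a function that is at least 1. The
  threshold 1 is that of \<open>\<Sum> A powr -s\<close>, since \<open>factor\<close> is linear in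
  the power \<open>A\<close> of the parabolic map. Distortion is obtained without contraction
  estimates, by comparing monotone linear maps on the two vectors \<open>hvec\<close> and
  \<open>bvec\<close>. Coding solutions by words is onto from the root but not injective there, as
  equal coordinates are interchangeable; it is injective from a strictly increasing solution. The
  two halves of the count therefore use different starting points.\<close>

text \<open>Clamping \<open>1/2 - cos (pi * t)\<close> gives continuity and period 2 at once; only
  the plateaus 0 on [0, 1/3] and 1 on [2/3, 1] matter later.\<close>

definition bump :: "real \<Rightarrow> real" where
  "bump t = max 0 (min 1 (1/2 - cos (pi * t)))"

text \<open>
  Schoenberg's space-filling curve, with the Hilbert cube as target: it carries Helly's selection
  theorem from the real line to measures on compact subsets of the cube.
\<close>

definition schoenberg :: "real \<Rightarrow> nat \<Rightarrow> real" where
  "schoenberg t i = (\<Sum>k. (1/2) ^ Suc k * bump (3 ^ prod_encode (i, k) * t))"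

lemma bump_bounds: "0 \<le> bump t" "bump t \<le> 1"
  by (auto simp: bump_def)

lemma bump_zero:
  assumes "0 \<le> t" "t \<le> 1/3" shows "bump t = 0"
proof -
  have "cos (pi/3) \<le> cos (pi * t)"
    using assms pi_gt_zero by (intro cos_monotone_0_pi_le) auto
  then show ?thesis by (simp add: bump_def cos_60)
qed

lemma bump_one:
  assumes "2/3 \<le> t" "t \<le> 1" shows "bump t = 1"
proof -
  have "cos (pi * t) \<le> cos (pi * (2/3))"
    using assms pi_gt_zero by (intro cos_monotone_0_pi_le) auto
  moreover have "cos (pi * (2/3)) = - 1/2"
    using cos_120 by (simp add: field_simps)
  ultimately show ?thesis by (simp add: bump_def)
qed

lemma bump_periodic: "bump (t + 2 * of_int m) = bump t"
proof -
  have "cos (pi * (t + 2 * of_int m)) = cos (pi * t + 2 * pi * of_int m)"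
    by (simp add: algebra_simps)
  also have "\<dots> = cos (pi * t)"
    by (simp only: cos_add sin_int_2pin cos_int_2pin mult_1_right mult_zero_right diff_zero)
  finally show ?thesis by (simp add: bump_def)
qed

lemma continuous_schoenberg: "continuous_on UNIV schoenberg"
proof (rule continuous_on_coordinatewise_then_product)
  fix i
  have "uniform_limit UNIV (\<lambda>n t. \<Sum>k<n. (1/2) ^ Suc k * bump (3 ^ prod_encode (i, k) * t))
      (\<lambda>t. \<Sum>k. (1/2) ^ Suc k * bump (3 ^ prod_encode (i, k) * t)) sequentially"
  proof (rule Weierstrass_m_test)
    show "norm ((1/2) ^ Suc k * bump (3 ^ prod_encode (i, k) * t)) \<le> (1/2) ^ Suc k" for k t
      using bump_bounds[of "3 ^ prod_encode (i, k) * t"] by (auto simp: abs_mult mult_le_cancel_left1)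
    show "summable (\<lambda>k. (1/2::real) ^ Suc k)"
      by (subst summable_Suc_iff) (simp add: summable_geometric)
  qed
  moreover have "\<forall>\<^sub>F n in sequentially. continuous_on UNIV
      (\<lambda>t. \<Sum>k<n. (1/2) ^ Suc k * bump (3 ^ prod_encode (i, k) * t))"
    unfolding bump_def by (intro always_eventually allI continuous_intros)
  ultimately show "continuous_on UNIV (\<lambda>t. schoenberg t i)"
    unfolding schoenberg_def by (intro uniform_limit_theorem) auto
qed

text \<open>Iteration of the doubling map: \<open>r k\<close> is the remainder after
  \<open>k\<close> digits, scaled by \<open>2 ^ k\<close>. It stays in [0, 1], also for
  \<open>y = 1\<close>, whose digits are all 1.\<close>

lemma binary_digits:
  fixes y :: real
  assumes "0 \<le> y" "y \<le> 1"
  shows "\<exists>a :: nat \<Rightarrow> nat. (\<forall>k. a k \<le> 1) \<and> (\<lambda>k. (1/2) ^ Suc k * real (a k)) sums y"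
proof -
  define r where "r = rec_nat y (\<lambda>_ x. if x \<ge> 1/2 then 2 * x - 1 else 2 * x)"
  have r0: "r 0 = y" and rS: "\<And>k. r (Suc k) = (if r k \<ge> 1/2 then 2 * r k - 1 else 2 * r k)"
    by (simp_all add: r_def)
  have rb: "0 \<le> r k \<and> r k \<le> 1" for k
    by (induction k) (use assms in \<open>auto simp: r0 rS\<close>)
  define a :: "nat \<Rightarrow> nat" where "a k = (if r k \<ge> 1/2 then 1 else 0)" for k
  have part: "(\<Sum>k<n. (1/2) ^ Suc k * real (a k)) = y - (1/2) ^ n * r n" for n
    by (induction n) (auto simp: r0 rS a_def field_simps)
  have "(\<lambda>n. (1/2) ^ n * r n) \<longlonglongrightarrow> 0"
  proof (rule tendsto_sandwich[of "\<lambda>_. 0" _ _ "\<lambda>n. (1/2) ^ n"])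
    show "\<forall>\<^sub>F n in sequentially. 0 \<le> (1/2) ^ n * r n" using rb by simp
    show "\<forall>\<^sub>F n in sequentially. (1/2) ^ n * r n \<le> (1/2) ^ n"
      using rb by (simp add: mult_le_cancel_left1)
    show "(\<lambda>n. (1/2::real) ^ n) \<longlonglongrightarrow> 0" by (simp add: LIMSEQ_power_zero)
  qed simp
  then have "(\<lambda>n. y - (1/2) ^ n * r n) \<longlonglongrightarrow> y - 0" by (intro tendsto_intros)
  then have "(\<lambda>k. (1/2) ^ Suc k * real (a k)) sums y"
    unfolding sums_def part by simp
  moreover have "\<forall>k. a k \<le> 1" by (simp add: a_def)
  ultimately show ?thesis by blast
qed

text \<open>With ternary digits 0 and 2, \<open>3 ^ m\<close> times the number is an even integer,
  plus two thirds of \<open>a m\<close>, plus a tail in [0, 1/3]. Periodicity removes the first, and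
  the rest lies on the plateau of value \<open>a m\<close>.\<close>

lemma bump_ternary:
  assumes "\<And>k. a k \<le> (1::nat)"
  shows "bump (3 ^ m * (\<Sum>k. 2 * real (a k) * (1/3) ^ Suc k)) = real (a m)"
proof -
  define f where "f k = 2 * real (a k) * (1/3) ^ Suc k" for k
  have f_bd: "0 \<le> f k" "f k \<le> 2 * (1/3) ^ Suc k" for k
    using assms[of k] by (auto simp: f_def mult_le_cancel_right1)
  have g: "summable (\<lambda>k. 2 * (1/3::real) ^ Suc k)"
    by (intro summable_mult summable_Suc_iff[THEN iffD2]) (simp add: summable_geometric)
  have sf: "summable f"
    by (rule summable_comparison_test[OF _ g]) (use f_bd in auto)
  define t where "t = (\<Sum>k. f (k + Suc m))"
  have st: "summable (\<lambda>k. f (k + Suc m))" using sf by (rule summable_ignore_initial_segment)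
  have t0: "0 \<le> t" unfolding t_def by (intro suminf_nonneg st f_bd)
  have "(\<lambda>k. (1/3::real) ^ k) sums (1 / (1 - 1/3))" by (rule geometric_sums) simp
  then have "(\<lambda>k. (2 * (1/3) ^ Suc (Suc m)) * (1/3::real) ^ k) sums ((2 * (1/3) ^ Suc (Suc m)) * (1 / (1 - 1/3)))"
    by (rule sums_mult)
  then have gs: "(\<lambda>k. 2 * (1/3::real) ^ Suc (k + Suc m)) sums (1/3) ^ Suc m"
    by (simp add: power_add field_simps)
  have "t \<le> (\<Sum>k. 2 * (1/3::real) ^ Suc (k + Suc m))"
    unfolding t_def by (rule suminf_le[OF f_bd(2) st sums_summable[OF gs]])
  then have t1: "t \<le> (1/3) ^ Suc m" using gs by (simp add: sums_iff)
  have "3 ^ m * (\<Sum>k<m. f k) = (\<Sum>k<m. 2 * real (a k * 3 ^ (m - Suc k)))"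
    unfolding sum_distrib_left
  proof (intro sum.cong refl)
    fix k assume "k \<in> {..<m}"
    then have "(3::real) ^ m = 3 ^ (m - Suc k) * 3 ^ Suc k"
      by (subst power_add[symmetric]) simp
    then show "3 ^ m * f k = 2 * real (a k * 3 ^ (m - Suc k))"
      by (simp add: f_def field_simps)
  qed
  also have "\<dots> = 2 * of_int (int (\<Sum>k<m. a k * 3 ^ (m - Suc k)))"
    by (simp add: sum_distrib_left)
  finally have E: "3 ^ m * (\<Sum>k<m. f k) = 2 * of_int (int (\<Sum>k<m. a k * 3 ^ (m - Suc k)))" .
  have "suminf f = t + (\<Sum>k<Suc m. f k)"
    unfolding t_def by (rule suminf_split_initial_segment[OF sf])
  then have "3 ^ m * suminf f = (2 * real (a m) / 3 + 3 ^ m * t) + 3 ^ m * (\<Sum>k<m. f k)"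
    by (simp add: f_def field_simps)
  then have eq: "bump (3 ^ m * suminf f) = bump (2 * real (a m) / 3 + 3 ^ m * t)"
    unfolding E by (simp only: bump_periodic)
  have "3 ^ m * t \<le> 3 ^ m * (1/3) ^ Suc m" using t1 by (intro mult_left_mono) auto
  also have "\<dots> = 1/3" by (simp add: field_simps)
  finally have u1: "3 ^ m * t \<le> 1/3" .
  have u0: "0 \<le> 3 ^ m * t" using t0 by simp
  have "bump (2 * real (a m) / 3 + 3 ^ m * t) = real (a m)"
  proof (cases "a m = 0")
    case True
    then show ?thesis using bump_zero[OF u0 u1] by simp
  next
    case False
    then have "a m = 1" using assms[of m] by simp
    then show ?thesis using bump_one[of "2/3 + 3 ^ m * t"] u0 u1 by simp
  qed
  then show ?thesis using eq by (simp add: f_def[abs_def])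
qed

text \<open>The binary digits of all coordinates are interleaved by \<open>prod_encode\<close> into
  a single Cantor number \<open>t\<close>, from which \<open>bump\<close> reads them back.\<close>

lemma schoenberg_surj:
  assumes "\<And>i. 0 \<le> x i \<and> x i \<le> 1"
  shows "\<exists>t\<in>{0..1}. schoenberg t = x"
proof -
  have "\<exists>a :: nat \<Rightarrow> nat \<Rightarrow> nat. \<forall>i. (\<forall>k. a i k \<le> 1) \<and> (\<lambda>k. (1/2) ^ Suc k * real (a i k)) sums x i"
    using assms by (intro choice allI binary_digits) auto
  then obtain a :: "nat \<Rightarrow> nat \<Rightarrow> nat" where
    a: "\<And>i k. a i k \<le> 1" "\<And>i. (\<lambda>k. (1/2) ^ Suc k * real (a i k)) sums x i"
    by blast
  define d where "d m = (case prod_decode m of (i, k) \<Rightarrow> a i k)" for m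
  have d: "d m \<le> 1" for m using a(1) by (simp add: d_def split: prod.split)
  define t where "t = (\<Sum>k. 2 * real (d k) * (1/3) ^ Suc k)"
  have "schoenberg t i = x i" for i
    unfolding schoenberg_def t_def bump_ternary[OF d]
    using a(2)[of i] by (simp add: d_def sums_iff)
  moreover have "t \<in> {0..1}"
  proof -
    have "(\<lambda>k. (1/3::real) ^ k) sums (1 / (1 - 1/3))" by (rule geometric_sums) simp
    then have "(\<lambda>k. (2/3) * (1/3::real) ^ k) sums ((2/3) * (1 / (1 - 1/3)))"
      by (rule sums_mult)
    then have gs: "(\<lambda>k. 2 * (1/3::real) ^ Suc k) sums 1" by simp
    have b: "0 \<le> 2 * real (d k) * (1/3) ^ Suc k" "2 * real (d k) * (1/3) ^ Suc k \<le> 2 * (1/3) ^ Suc k" for k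
      using d[of k] by (auto simp: mult_le_cancel_right1)
    have sm: "summable (\<lambda>k. 2 * real (d k) * (1/3) ^ Suc k)"
      by (rule summable_comparison_test[of _ "\<lambda>k. 2 * (1/3::real) ^ Suc k"])
        (use b gs in \<open>auto simp: sums_iff\<close>)
    have "0 \<le> t" unfolding t_def by (intro suminf_nonneg sm b)
    moreover have "t \<le> (\<Sum>k. 2 * (1/3::real) ^ Suc k)"
      unfolding t_def using gs by (intro suminf_le sm b) (auto simp: sums_iff)
    ultimately show ?thesis using gs by (simp add: sums_iff)
  qed
  ultimately show ?thesis by (intro bexI[of _ t]) auto
qed

text \<open>The measures are lifted to [0, 1] by a section of the curve, where Helly applies, and
  the limit is pushed forward again. The section is an arbitrary choice, which is harmless as a pmf
  measures every set.\<close>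

lemma weakly_convergent_subsequence:
  fixes X :: "(nat \<Rightarrow> real) set" and p :: "nat \<Rightarrow> (nat \<Rightarrow> real) pmf"
  assumes X: "compact X" "\<And>x i. x \<in> X \<Longrightarrow> 0 \<le> x i \<and> x i \<le> 1"
    and p: "\<And>m. set_pmf (p m) \<subseteq> X"
  shows "\<exists>r \<nu>. strict_mono r \<and> prob_space \<nu> \<and> sets \<nu> = sets (restrict_space borel X) \<and>
     (\<forall>f :: (nat \<Rightarrow> real) \<Rightarrow> real. continuous_on X f \<longrightarrow>
       (\<lambda>m. measure_pmf.expectation (p (r m)) f) \<longlonglongrightarrow> (\<integral>x. f x \<partial>\<nu>))"
proof -
  define sec where "sec x = (SOME t. t \<in> {0..1} \<and> schoenberg t = x)" for x
  have sec: "sec x \<in> {0..1}" "schoenberg (sec x) = x" if "x \<in> X" for x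
  proof -
    have "\<exists>t. t \<in> {0..1} \<and> schoenberg t = x" using schoenberg_surj[of x] X(2)[OF that] by auto
    then have "sec x \<in> {0..1} \<and> schoenberg (sec x) = x" unfolding sec_def by (rule someI_ex)
    then show "sec x \<in> {0..1}" "schoenberg (sec x) = x" by auto
  qed
  define \<mu> where "\<mu> m = distr (measure_pmf (p m)) borel sec" for m
  have rd: "real_distribution (\<mu> m)" for m
    unfolding \<mu>_def real_distribution_def real_distribution_axioms_def
    by (auto intro!: prob_space.prob_space_distr measure_pmf.prob_space_axioms)
  have "tight \<mu>"
    unfolding tight_def
  proof (intro conjI allI impI)
    fix e :: real assume "e > 0"
    \<comment> \<open>The interval is open on the left, hence -1 rather than 0.\<close>
    have "measure (\<mu> m) {-1<..1} = 1" for m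
    proof -
      have "measure (\<mu> m) {-1<..1} = measure (measure_pmf (p m)) (sec -` {-1<..1})"
        unfolding \<mu>_def by (subst measure_distr) auto
      also have "\<dots> = 1"
        using p[of m] sec by (subst measure_pmf.prob_eq_1) (auto simp: AE_measure_pmf_iff, fastforce)
      finally show ?thesis .
    qed
    then show "\<exists>a b. a < b \<and> (\<forall>n. 1 - e < measure (\<mu> n) {a<..b})"
      using \<open>e > 0\<close> by (intro exI[of _ "-1"] exI[of _ 1]) auto
  qed (use rd in auto)
  then obtain r M where r: "strict_mono (r :: nat \<Rightarrow> nat)" and M: "real_distribution M"
    and w: "weak_conv_m (\<mu> \<circ> id \<circ> r) M"
    using tight_imp_convergent_subsubsequence[of \<mu> id] by (auto simp: strict_mono_def)
  interpret M: real_distribution M by fact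
  have conv: "(\<lambda>m. measure_pmf.expectation (p (r m)) f) \<longlonglongrightarrow> integral\<^sup>L M (\<lambda>t. f (schoenberg t))"
    if f: "continuous_on UNIV f" "\<And>x. norm (f x) \<le> B" for f :: "(nat \<Rightarrow> real) \<Rightarrow> real" and B
  proof -
    have ct: "continuous_on UNIV (\<lambda>t. f (schoenberg t))"
      by (rule continuous_on_compose2[OF f(1) continuous_schoenberg]) auto
    have "(\<lambda>m. integral\<^sup>L (\<mu> (r m)) (\<lambda>t. f (schoenberg t))) \<longlonglongrightarrow> integral\<^sup>L M (\<lambda>t. f (schoenberg t))"
      using weak_conv_imp_integral_bdd_continuous_conv[of "\<lambda>m. \<mu> (r m)" M "\<lambda>t. f (schoenberg t)" B]
        rd M w ct f(2) by (auto simp: continuous_on_eq_continuous_at comp_def)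
    moreover have "integral\<^sup>L (\<mu> (r m)) (\<lambda>t. f (schoenberg t)) = measure_pmf.expectation (p (r m)) f" for m
    proof -
      have "integral\<^sup>L (\<mu> (r m)) (\<lambda>t. f (schoenberg t)) = measure_pmf.expectation (p (r m)) (\<lambda>x. f (schoenberg (sec x)))"
        unfolding \<mu>_def using ct by (subst integral_distr) (auto intro: borel_measurable_continuous_onI)
      also have "\<dots> = measure_pmf.expectation (p (r m)) f"
        using p[of "r m"] sec by (intro integral_cong_AE) (auto simp: AE_measure_pmf_iff subset_eq)
      finally show ?thesis .
    qed
    ultimately show ?thesis by simp
  qed
  obtain x0 where x0: "x0 \<in> X" using p[of 0] set_pmf_not_empty[of "p 0"] by blast
  have "AE t in M. schoenberg t \<in> X"
  proof -
    \<comment> \<open>A bounded continuous test function vanishing exactly on the closed set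
      \<open>X\<close>: its integrals are 0 along the sequence, hence in the limit.\<close>
    define g where "g x = min 1 (infdist x X)" for x
    have g: "continuous_on UNIV g" "norm (g x) \<le> 1" "0 \<le> g x" for x
      unfolding g_def by (auto intro!: continuous_intros simp: infdist_nonneg)
    have "measure_pmf.expectation (p (r m)) g = 0" for m
      using p[of "r m"] by (intro integral_eq_zero_AE) (auto simp: AE_measure_pmf_iff g_def infdist_zero)
    then have 0: "integral\<^sup>L M (\<lambda>t. g (schoenberg t)) = 0"
      using conv[OF g(1,2)] by (simp add: LIMSEQ_const_iff)
    have ct: "continuous_on UNIV (\<lambda>t. g (schoenberg t))"
      by (rule continuous_on_compose2[OF g(1) continuous_schoenberg]) auto
    have "(\<lambda>t. g (schoenberg t)) \<in> borel_measurable M"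
      using borel_measurable_continuous_onI[OF ct] by (simp cong: measurable_cong_sets)
    then have int: "integrable M (\<lambda>t. g (schoenberg t))"
      by (rule M.integrable_const_bound[of _ 1, rotated]) (use g(2) in auto)
    have "AE t in M. g (schoenberg t) = 0"
      using integral_nonneg_eq_0_iff_AE[OF int] 0 g(3) by auto
    then show ?thesis
    proof eventually_elim
      case (elim t)
      then have "infdist (schoenberg t) X = 0" by (auto simp: g_def min_def split: if_splits)
      then show ?case
        using in_closed_iff_infdist_zero[of X "schoenberg t"] X(1) x0 compact_imp_closed by auto
    qed
  qed
  note AEX = this
  \<comment> \<open>The curve leaves \<open>X\<close> only on a null set; the default
    \<open>x0\<close> there makes the push-forward a measure on \<open>X\<close> itself.\<close>
  define h where "h t = (if schoenberg t \<in> X then schoenberg t else x0)" for t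
  have sm: "schoenberg \<in> borel_measurable borel"
    by (intro borel_measurable_continuous_onI continuous_schoenberg)
  have Xb: "X \<in> sets borel" using X(1) by (intro borel_closed compact_imp_closed)
  have hm: "h \<in> measurable M (restrict_space borel X)"
  proof (rule measurable_restrict_space2)
    show "h \<in> space M \<rightarrow> X" by (auto simp: h_def x0)
    have "h \<in> borel_measurable borel"
      unfolding h_def using sm Xb by measurable
    then show "h \<in> borel_measurable M" by (simp cong: measurable_cong_sets)
  qed
  define \<nu> where "\<nu> = distr M (restrict_space borel X) h"
  have 1: "prob_space \<nu>" unfolding \<nu>_def by (intro M.prob_space_distr hm)
  have 2: "sets \<nu> = sets (restrict_space borel X)" by (simp add: \<nu>_def)
  have 3: "(\<lambda>m. measure_pmf.expectation (p (r m)) f) \<longlonglongrightarrow> (\<integral>x. f x \<partial>\<nu>)"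
    if f: "continuous_on X f" for f :: "(nat \<Rightarrow> real) \<Rightarrow> real"
  proof -
    have "bounded (f ` X)" using f X(1) by (intro compact_imp_bounded compact_continuous_image)
    then obtain B where B: "\<And>x. x \<in> X \<Longrightarrow> norm (f x) \<le> B" by (auto simp: bounded_iff)
    then have "0 \<le> B" using x0 norm_ge_zero order_trans by blast
    \<comment> \<open>Convergence is known only for bounded continuous functions on the whole space,
      so \<open>f\<close> is extended with the same bound.\<close>
    obtain F where F: "continuous_on UNIV F" "\<And>x. x \<in> X \<Longrightarrow> F x = f x" "\<And>x. norm (F x) \<le> B"
      using Tietze[OF f, of UNIV B] X(1) B \<open>0 \<le> B\<close> compact_imp_closed by (auto simp: )
    have "(\<lambda>m. measure_pmf.expectation (p (r m)) F) \<longlonglongrightarrow> integral\<^sup>L M (\<lambda>t. F (schoenberg t))"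
      by (rule conv[OF F(1,3)])
    moreover have "measure_pmf.expectation (p (r m)) F = measure_pmf.expectation (p (r m)) f" for m
      using p[of "r m"] F(2) by (intro integral_cong_AE) (auto simp: AE_measure_pmf_iff subset_eq)
    moreover have "integral\<^sup>L M (\<lambda>t. F (schoenberg t)) = (\<integral>x. f x \<partial>\<nu>)"
    proof -
      have fm: "f \<in> borel_measurable (restrict_space borel X)"
        using f by (rule borel_measurable_continuous_on_restrict)
      have Fm: "(\<lambda>t. F (schoenberg t)) \<in> borel_measurable borel"
        by (rule borel_measurable_continuous_onI, rule continuous_on_compose2[OF F(1) continuous_schoenberg]) auto
      have "(\<integral>x. f x \<partial>\<nu>) = integral\<^sup>L M (\<lambda>t. f (h t))"
        unfolding \<nu>_def by (rule integral_distr[OF hm fm])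
      also have "\<dots> = integral\<^sup>L M (\<lambda>t. F (schoenberg t))"
      proof (rule integral_cong_AE)
        show "(\<lambda>t. f (h t)) \<in> borel_measurable M" using hm fm by (rule measurable_compose)
        show "(\<lambda>t. F (schoenberg t)) \<in> borel_measurable M" using Fm by (simp cong: measurable_cong_sets)
        show "AE t in M. f (h t) = F (schoenberg t)"
          using AEX by eventually_elim (simp add: h_def F(2))
      qed
      finally show ?thesis by simp
    qed
    ultimately show ?thesis by simp
  qed
  show ?thesis using r 1 2 3 by blast
qed

section \<open>Transfer operators of weighted iterated function systems\<close>

lemma pmf_of_weights:
  fixes w :: "'a \<Rightarrow> real"
  assumes w: "(w has_sum 1) A" "\<And>x. x \<in> A \<Longrightarrow> 0 \<le> w x"
  shows "\<exists>p. set_pmf p \<subseteq> A \<and>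
    (\<forall>f :: 'a \<Rightarrow> real. (\<lambda>x. norm (w x * f x)) summable_on A \<longrightarrow>
      measure_pmf.expectation p f = (\<Sum>\<^sub>\<infinity>x\<in>A. w x * f x))"
proof -
  define v where "v x = (if x \<in> A then w x else 0)" for x
  have v0: "0 \<le> v x" for x using w(2) by (simp add: v_def)
  have v1: "(v has_sum 1) UNIV"
    using w(1) by (rule has_sum_cong_neutral[THEN iffD1, rotated 3]) (auto simp: v_def)
  then have vs: "(\<lambda>x. norm (v x)) summable_on UNIV"
    using v0 by (auto simp: has_sum_iff)
  have "(\<integral>\<^sup>+x. ennreal (v x) \<partial>count_space UNIV) = ennreal (infsetsum v UNIV)"
    by (intro nn_integral_conv_infsetsum v0 abs_summable_equivalent[THEN iffD1, OF vs])
  also have "infsetsum v UNIV = 1"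
    using infsetsum_infsum[OF abs_summable_equivalent[THEN iffD1, OF vs]] v1 by (simp add: has_sum_iff)
  finally have v2: "(\<integral>\<^sup>+x. ennreal (v x) \<partial>count_space UNIV) = 1" by simp
  define p where "p = embed_pmf v"
  have pp: "pmf p x = v x" for x unfolding p_def by (rule pmf_embed_pmf[OF v0 v2])
  have "set_pmf p \<subseteq> A" by (auto simp: set_pmf_eq pp v_def)
  moreover have "measure_pmf.expectation p f = (\<Sum>\<^sub>\<infinity>x\<in>A. w x * f x)"
    if f: "(\<lambda>x. norm (w x * f x)) summable_on A" for f :: "'a \<Rightarrow> real"
  proof -
    have "(\<lambda>x. norm (v x * f x)) summable_on UNIV"
      using f by (rule summable_on_cong_neutral[THEN iffD1, rotated 3]) (auto simp: v_def)
    then have "infsetsum (\<lambda>x. v x * f x) UNIV = (\<Sum>\<^sub>\<infinity>x. v x * f x)"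
      by (intro infsetsum_infsum abs_summable_equivalent[THEN iffD1])
    also have "\<dots> = (\<Sum>\<^sub>\<infinity>x\<in>A. w x * f x)"
      by (intro infsum_cong_neutral) (auto simp: v_def)
    finally show ?thesis by (simp add: pmf_expectation_eq_infsetsum pp)
  qed
  ultimately show ?thesis by blast
qed

lemma integrable_continuous_on_compact:
  fixes f :: "'a::metric_space \<Rightarrow> real"
  assumes "finite_measure \<nu>" "sets \<nu> = sets (restrict_space borel X)" "compact X" "continuous_on X f"
  shows "integrable \<nu> f"
proof -
  interpret finite_measure \<nu> by fact
  have sp: "space \<nu> = X" using sets_eq_imp_space_eq[OF assms(2)] by (simp add: space_restrict_space)
  have "bounded (f ` X)" using assms by (intro compact_imp_bounded compact_continuous_image)
  then obtain B where B: "\<And>x. x \<in> X \<Longrightarrow> norm (f x) \<le> B" by (auto simp: bounded_iff)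
  have "f \<in> borel_measurable \<nu>"
    using borel_measurable_continuous_on_restrict[OF assms(4)] assms(2) by (simp cong: measurable_cong_sets)
  then show ?thesis by (intro integrable_const_bound[of _ B] AE_I2) (simp_all add: sp B[unfolded real_norm_def])
qed

text \<open>Uniform convergence along the filter of finite subsets needs no enumeration of
  \<open>I\<close>, and yields continuity and termwise integration from the same estimate.\<close>

lemma integral_m_test:
  fixes t :: "'i \<Rightarrow> 'a::metric_space \<Rightarrow> real"
  assumes X: "compact X"
    and cont: "\<And>p. p \<in> I \<Longrightarrow> continuous_on X (t p)"
    and bound: "\<And>p x. p \<in> I \<Longrightarrow> x \<in> X \<Longrightarrow> \<bar>t p x\<bar> \<le> M p"
    and M: "M summable_on I"
  shows "continuous_on X (\<lambda>x. \<Sum>\<^sub>\<infinity>p\<in>I. t p x)"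
    and "prob_space \<nu> \<Longrightarrow> sets \<nu> = sets (restrict_space borel X) \<Longrightarrow>
      ((\<lambda>p. \<integral>x. t p x \<partial>\<nu>) has_sum (\<integral>x. (\<Sum>\<^sub>\<infinity>p\<in>I. t p x) \<partial>\<nu>)) I"
proof -
  have ul: "uniform_limit X (\<lambda>F x. \<Sum>p\<in>F. t p x) (\<lambda>x. \<Sum>\<^sub>\<infinity>p\<in>I. t p x) (finite_subsets_at_top I)"
    by (rule Weierstrass_m_test_general[OF _ M]) (use bound in auto)
  have ev: "\<forall>\<^sub>F F in finite_subsets_at_top I. finite F \<and> F \<subseteq> I"
    by (rule eventually_finite_subsets_at_top_weakI) auto
  show c: "continuous_on X (\<lambda>x. \<Sum>\<^sub>\<infinity>p\<in>I. t p x)"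
  proof (rule uniform_limit_theorem[OF _ ul])
    show "\<forall>\<^sub>F F in finite_subsets_at_top I. continuous_on X (\<lambda>x. \<Sum>p\<in>F. t p x)"
      using ev by eventually_elim (auto intro!: continuous_intros cont)
  qed (rule finite_subsets_at_top_neq_bot)
  assume \<nu>: "prob_space \<nu>" "sets \<nu> = sets (restrict_space borel X)"
  interpret prob_space \<nu> by fact
  have sp: "space \<nu> = X" using sets_eq_imp_space_eq[OF \<nu>(2)] by (simp add: space_restrict_space)
  note int = integrable_continuous_on_compact[OF finite_measure_axioms \<nu>(2) X]
  show "((\<lambda>p. \<integral>x. t p x \<partial>\<nu>) has_sum (\<integral>x. (\<Sum>\<^sub>\<infinity>p\<in>I. t p x) \<partial>\<nu>)) I"
    unfolding has_sum_def
  proof (rule tendstoI)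
    fix e :: real assume "e > 0"
    then have "\<forall>\<^sub>F F in finite_subsets_at_top I. \<forall>x\<in>X. dist (\<Sum>p\<in>F. t p x) (\<Sum>\<^sub>\<infinity>p\<in>I. t p x) < e / 2"
      using uniform_limitD[OF ul, of "e/2"] by simp
    with ev show "\<forall>\<^sub>F F in finite_subsets_at_top I.
        dist (\<Sum>p\<in>F. \<integral>x. t p x \<partial>\<nu>) (\<integral>x. (\<Sum>\<^sub>\<infinity>p\<in>I. t p x) \<partial>\<nu>) < e"
    proof eventually_elim
      case (elim F)
      have cF: "continuous_on X (\<lambda>x. \<Sum>p\<in>F. t p x)"
        using elim by (auto intro!: continuous_intros cont)
      have "(\<Sum>p\<in>F. \<integral>x. t p x \<partial>\<nu>) = (\<integral>x. (\<Sum>p\<in>F. t p x) \<partial>\<nu>)"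
        using elim by (subst Bochner_Integration.integral_sum) (auto intro!: int cont)
      then have "(\<Sum>p\<in>F. \<integral>x. t p x \<partial>\<nu>) - (\<integral>x. (\<Sum>\<^sub>\<infinity>p\<in>I. t p x) \<partial>\<nu>)
          = (\<integral>x. (\<Sum>p\<in>F. t p x) - (\<Sum>\<^sub>\<infinity>p\<in>I. t p x) \<partial>\<nu>)"
        by (simp add: Bochner_Integration.integral_diff int cF c)
      also have "\<bar>\<dots>\<bar>
          \<le> (\<integral>x. \<bar>(\<Sum>p\<in>F. t p x) - (\<Sum>\<^sub>\<infinity>p\<in>I. t p x)\<bar> \<partial>\<nu>)"
        by (rule integral_abs_bound)
      also have "\<dots> \<le> (\<integral>x. e / 2 \<partial>\<nu>)"
        using elim by (intro integral_mono int continuous_intros cF c)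
          (auto simp: sp dist_real_def less_imp_le)
      also have "\<dots> < e" using \<open>e > 0\<close> by (simp add: prob_space)
      finally show ?case by (simp add: dist_real_def)
    qed
  qed
qed

text \<open>Passing from \<open>b\<close> to \<open>s\<close> costs a relative error of at most
  \<open>(b - s) * ln x\<close>, and \<open>ln x \<le> x powr \<delta> / \<delta>\<close> trades the
  logarithm for \<open>\<delta>\<close> in the exponent.\<close>

lemma powr_minus_diff_bounds:
  fixes x s b \<delta> :: real
  assumes "1 \<le> x" "s \<le> b" "0 < \<delta>"
  shows "x powr -b \<le> x powr -s"
    and "x powr -s \<le> x powr -b + (b - s) / \<delta> * x powr -(s - \<delta>)"
proof -
  show "x powr -b \<le> x powr -s" using assms by (intro powr_mono) auto
  have "x powr -s * (1 - x powr -(b - s)) \<le> x powr -s * ((b - s) / \<delta> * x powr \<delta>)"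
  proof (intro mult_left_mono)
    have "1 + (-(b - s) * ln x) \<le> exp (-(b - s) * ln x)" by (rule exp_ge_add_one_self)
    then have "1 - x powr -(b - s) \<le> (b - s) * ln x"
      using assms by (simp add: powr_def algebra_simps)
    also have "\<dots> \<le> (b - s) * (x powr \<delta> / \<delta>)"
      using assms ln_powr_bound[of x \<delta>] by (intro mult_left_mono) auto
    finally show "1 - x powr -(b - s) \<le> (b - s) / \<delta> * x powr \<delta>" by simp
  qed simp
  moreover have "x powr -s * x powr -(b - s) = x powr -b" "x powr -s * x powr \<delta> = x powr -(s - \<delta>)"
    by (simp_all flip: powr_add)
  ultimately show "x powr -s \<le> x powr -b + (b - s) / \<delta> * x powr -(s - \<delta>)"
    by (simp add: algebra_simps)
qed

section \<open>Words, orbits and cocycles\<close>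

text \<open>The head of a word acts first. Hence \<open>Cons\<close> changes the starting point, as
  in the operator \<open>L\<close> acting on functions, while a letter appended at the end prolongs
  the orbit, as for the orbit measures.\<close>

primrec orbit :: "('i \<Rightarrow> 'a \<Rightarrow> 'a) \<Rightarrow> 'i list \<Rightarrow> 'a \<Rightarrow> 'a" where
  "orbit \<phi> [] x = x"
| "orbit \<phi> (p # \<sigma>) x = orbit \<phi> \<sigma> (\<phi> p x)"

primrec cocycle :: "('i \<Rightarrow> 'a \<Rightarrow> 'a) \<Rightarrow> ('i \<Rightarrow> 'a \<Rightarrow> real) \<Rightarrow> 'i list \<Rightarrow> 'a \<Rightarrow> real" where
  "cocycle \<phi> N [] x = 1"
| "cocycle \<phi> N (p # \<sigma>) x = N p x * cocycle \<phi> N \<sigma> (\<phi> p x)"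

lemma orbit_snoc: "orbit \<phi> (\<sigma> @ [p]) x = \<phi> p (orbit \<phi> \<sigma> x)"
  by (induction \<sigma> arbitrary: x) auto

lemma cocycle_snoc: "cocycle \<phi> N (\<sigma> @ [p]) x = cocycle \<phi> N \<sigma> x * N p (orbit \<phi> \<sigma> x)"
  by (induction \<sigma> arbitrary: x) auto

lemma lists_Cons_decomp: "lists I = insert [] ((\<lambda>(p, \<sigma>). p # \<sigma>) ` (I \<times> lists I))"
proof (intro equalityI subsetI)
  fix \<sigma> assume "\<sigma> \<in> lists I"
  then show "\<sigma> \<in> insert [] ((\<lambda>(p, \<sigma>). p # \<sigma>) ` (I \<times> lists I))"
    by (cases \<sigma>) auto
qed auto

lemma lists_snoc_decomp: "lists I = insert [] ((\<lambda>(\<sigma>, p). \<sigma> @ [p]) ` (lists I \<times> I))"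
proof (intro equalityI subsetI)
  fix \<sigma> assume "\<sigma> \<in> lists I"
  then show "\<sigma> \<in> insert [] ((\<lambda>(\<sigma>, p). \<sigma> @ [p]) ` (lists I \<times> I))"
    by (cases \<sigma> rule: rev_cases) auto
qed auto

lemma sum_nonempty_lists:
  assumes "finite F" "[] \<notin> F"
  shows "sum g F = (\<Sum>p\<in>hd ` F. \<Sum>\<sigma> | p # \<sigma> \<in> F. g (p # \<sigma>))"
proof -
  have fin: "finite {\<sigma>. p # \<sigma> \<in> F}" for p
    by (rule finite_subset[of _ "tl ` F"]) (use assms in \<open>force+\<close>)
  have F: "F = (\<lambda>(p, \<sigma>). p # \<sigma>) ` (SIGMA p:hd ` F. {\<sigma>. p # \<sigma> \<in> F})" (is "_ = ?g ` ?S")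
  proof (intro equalityI subsetI)
    fix \<sigma> assume "\<sigma> \<in> F"
    moreover from this assms have "\<sigma> \<noteq> []" by auto
    ultimately show "\<sigma> \<in> ?g ` ?S" by (intro image_eqI[of _ _ "(hd \<sigma>, tl \<sigma>)"]) auto
  qed auto
  have "sum g F = sum (g \<circ> ?g) ?S"
    by (subst F, rule sum.reindex) (auto simp: inj_on_def)
  also have "\<dots> = (\<Sum>p\<in>hd ` F. \<Sum>\<sigma> | p # \<sigma> \<in> F. g (p # \<sigma>))"
    using assms fin by (subst sum.Sigma) (auto intro!: sum.cong)
  finally show ?thesis .
qed

text \<open>The series of \<open>u\<close>, a lower bound for \<open>N\<close> independent of the
  point, is the majorant for all sums over \<open>I\<close>; it converges for every
  \<open>s > 1\<close>, whence the standing condition on exponents. Bounded distortion of the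
  cocycle takes the place of contraction.\<close>

locale conformal_ifs =
  fixes X :: "(nat \<Rightarrow> real) set" and I :: "'i set"
    and \<phi> :: "'i \<Rightarrow> (nat \<Rightarrow> real) \<Rightarrow> (nat \<Rightarrow> real)" and N :: "'i \<Rightarrow> (nat \<Rightarrow> real) \<Rightarrow> real"
    and u :: "'i \<Rightarrow> real" and q C :: real and x0 :: "nat \<Rightarrow> real"
  assumes compact_X: "compact X" and x0: "x0 \<in> X"
    and phi_cont: "p \<in> I \<Longrightarrow> continuous_on X (\<phi> p)"
    and phi_in: "p \<in> I \<Longrightarrow> x \<in> X \<Longrightarrow> \<phi> p x \<in> X"
    and N_cont: "p \<in> I \<Longrightarrow> continuous_on X (N p)"
    and N_ge: "p \<in> I \<Longrightarrow> x \<in> X \<Longrightarrow> u p \<le> N p x"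
    and q: "1 < q" and u_ge: "p \<in> I \<Longrightarrow> q \<le> u p"
    and u_summable: "1 < s \<Longrightarrow> (\<lambda>p. u p powr -s) summable_on I"
    and distortion: "\<sigma> \<in> lists I \<Longrightarrow> x \<in> X \<Longrightarrow> y \<in> X \<Longrightarrow> cocycle \<phi> N \<sigma> x \<le> C * cocycle \<phi> N \<sigma> y"
begin

definition L :: "real \<Rightarrow> ((nat \<Rightarrow> real) \<Rightarrow> real) \<Rightarrow> (nat \<Rightarrow> real) \<Rightarrow> real" where
  "L s f x = (\<Sum>\<^sub>\<infinity>p\<in>I. N p x powr -s * f (\<phi> p x))"

definition weight :: "real \<Rightarrow> 'i list \<Rightarrow> (nat \<Rightarrow> real) \<Rightarrow> real" where
  "weight s \<sigma> x = cocycle \<phi> N \<sigma> x powr -s"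

definition poincare_converges :: "real \<Rightarrow> bool" where
  "poincare_converges s \<longleftrightarrow> (\<lambda>\<sigma>. weight s \<sigma> x0) summable_on lists I"

definition poincare :: "real \<Rightarrow> (nat \<Rightarrow> real) \<Rightarrow> real" where
  "poincare s x = (\<Sum>\<^sub>\<infinity>\<sigma>\<in>lists I. weight s \<sigma> x)"

definition conformal :: "real \<Rightarrow> (nat \<Rightarrow> real) measure \<Rightarrow> bool" where
  "conformal b \<nu> \<longleftrightarrow> prob_space \<nu> \<and> sets \<nu> = sets (restrict_space borel X) \<and>
     (\<forall>f :: (nat \<Rightarrow> real) \<Rightarrow> real. continuous_on X f \<longrightarrow>
       ((\<lambda>p. \<integral>x. N p x powr -b * f (\<phi> p x) \<partial>\<nu>) has_sum (\<integral>x. f x \<partial>\<nu>)) I)"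

lemma N_gt1: "p \<in> I \<Longrightarrow> x \<in> X \<Longrightarrow> 1 < N p x"
  using N_ge[of p x] u_ge[of p] q by linarith

lemma N_powr_le:
  assumes "p \<in> I" "x \<in> X" "0 \<le> s"
  shows "N p x powr -s \<le> u p powr -s"
  using assms N_ge[of p x] u_ge[of p] q by (intro powr_mono2') auto

lemma orbit_in: "\<sigma> \<in> lists I \<Longrightarrow> x \<in> X \<Longrightarrow> orbit \<phi> \<sigma> x \<in> X"
  by (induction \<sigma> arbitrary: x) (auto simp: phi_in)

lemma cocycle_ge: "\<sigma> \<in> lists I \<Longrightarrow> x \<in> X \<Longrightarrow> q ^ length \<sigma> \<le> cocycle \<phi> N \<sigma> x"
proof (induction \<sigma> arbitrary: x)
  case (Cons p \<sigma>)
  then have "q * q ^ length \<sigma> \<le> N p x * cocycle \<phi> N \<sigma> (\<phi> p x)"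
    using q N_ge[of p x] u_ge[of p] by (intro mult_mono) (auto simp: phi_in)
  then show ?case by simp
qed simp

lemma cocycle_ge1:
  assumes "\<sigma> \<in> lists I" "x \<in> X"
  shows "1 \<le> cocycle \<phi> N \<sigma> x"
  using cocycle_ge[OF assms] one_le_power[of q "length \<sigma>"] q by linarith

lemma weight_nonneg [simp]: "0 \<le> weight s \<sigma> x"
  by (simp add: weight_def)

lemma weight_Nil [simp]: "weight s [] x = 1"
  by (simp add: weight_def)

lemma weight_Cons:
  assumes "p \<in> I" "\<sigma> \<in> lists I" "x \<in> X"
  shows "weight s (p # \<sigma>) x = N p x powr -s * weight s \<sigma> (\<phi> p x)"
  using N_gt1[OF assms(1,3)] cocycle_ge1[OF assms(2) phi_in[OF assms(1,3)]]
  by (simp add: weight_def powr_mult)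

lemma weight_snoc:
  assumes "p \<in> I" "\<sigma> \<in> lists I" "x \<in> X"
  shows "weight s (\<sigma> @ [p]) x = weight s \<sigma> x * N p (orbit \<phi> \<sigma> x) powr -s"
  using N_gt1[OF assms(1) orbit_in[OF assms(2,3)]] cocycle_ge1[OF assms(2,3)]
  by (simp add: weight_def cocycle_snoc powr_mult)

lemma weight_continuous: "\<sigma> \<in> lists I \<Longrightarrow> continuous_on X (weight s \<sigma>)"
proof (induction \<sigma>)
  case (Cons p \<sigma>)
  then have p: "p \<in> I" "\<sigma> \<in> lists I" by auto
  have "continuous_on X (\<lambda>x. N p x powr -s * weight s \<sigma> (\<phi> p x))"
    using p Cons.IH N_gt1[OF p(1)]
    by (intro continuous_intros N_cont continuous_on_compose2[OF Cons.IH phi_cont])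
      (auto simp: phi_in, fastforce)
  then show ?case
    by (rule continuous_on_eq) (use p weight_Cons in auto)
qed (simp add: weight_def)

lemma weight_antimono:
  assumes "\<sigma> \<in> lists I" "x \<in> X" "s \<le> t"
  shows "weight t \<sigma> x \<le> weight s \<sigma> x"
  unfolding weight_def using cocycle_ge1[OF assms(1,2)] assms(3) by (intro powr_mono) auto

lemma C_ge1: "1 \<le> C"
  using distortion[of "[]" x0 x0] x0 by simp

lemma weight_distortion:
  assumes "\<sigma> \<in> lists I" "x \<in> X" "y \<in> X" "0 \<le> s"
  shows "weight s \<sigma> x \<le> C powr s * weight s \<sigma> y"
proof -
  have "(C * cocycle \<phi> N \<sigma> x) powr -s \<le> cocycle \<phi> N \<sigma> y powr -s"
    using assms cocycle_ge1[OF assms(1,3)] by (intro powr_mono2' distortion) auto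
  then have "C powr -s * weight s \<sigma> x \<le> weight s \<sigma> y"
    using C_ge1 cocycle_ge1[OF assms(1,2)] by (simp add: weight_def powr_mult)
  then have "C powr s * (C powr -s * weight s \<sigma> x) \<le> C powr s * weight s \<sigma> y"
    by (intro mult_left_mono) auto
  moreover have "C powr s * C powr -s = 1" using C_ge1 by (simp flip: powr_add)
  ultimately show ?thesis by (simp flip: mult.assoc)
qed

lemma L_term_bound:
  assumes "p \<in> I" "x \<in> X" "0 \<le> s" "\<And>y. y \<in> X \<Longrightarrow> \<bar>f y\<bar> \<le> B"
  shows "\<bar>N p x powr -s * f (\<phi> p x)\<bar> \<le> u p powr -s * B"
  using assms N_powr_le[OF assms(1-3)] assms(4)[OF phi_in[OF assms(1,2)]]
  by (auto simp: abs_mult intro!: mult_mono)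

lemma L_summable:
  assumes "x \<in> X" "1 < s" "\<And>y. y \<in> X \<Longrightarrow> \<bar>f y\<bar> \<le> B"
  shows "(\<lambda>p. N p x powr -s * f (\<phi> p x)) summable_on I"
proof (rule abs_summable_summable)
  show "(\<lambda>p. norm (N p x powr -s * f (\<phi> p x))) summable_on I"
    by (rule summable_on_comparison_test[OF summable_on_cmult_left[OF u_summable[OF assms(2)], of B]])
      (use L_term_bound[where f = f and B = B, OF _ assms(1) _ assms(3)] assms(2) in auto)
qed

lemma L_mono:
  assumes "x \<in> X" "1 < s" "\<And>y. y \<in> X \<Longrightarrow> \<bar>f y\<bar> \<le> B" "\<And>y. y \<in> X \<Longrightarrow> \<bar>g y\<bar> \<le> B'"
    and "\<And>y. y \<in> X \<Longrightarrow> f y \<le> g y"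
  shows "L s f x \<le> L s g x"
  unfolding L_def
  by (rule infsum_mono[OF L_summable[OF assms(1-3)] L_summable[OF assms(1,2,4)]])
    (use assms phi_in in \<open>auto intro!: mult_left_mono\<close>)

lemma L_cmult: "L s (\<lambda>y. c * f y) x = c * L s f x"
  unfolding L_def by (subst infsum_cmult_right'[symmetric]) (simp add: mult_ac)

lemma L_continuous_and_integral:
  assumes f: "continuous_on X f" and s: "1 < s"
  shows "continuous_on X (L s f)"
    and "prob_space \<nu> \<Longrightarrow> sets \<nu> = sets (restrict_space borel X) \<Longrightarrow>
      ((\<lambda>p. \<integral>x. N p x powr -s * f (\<phi> p x) \<partial>\<nu>) has_sum (\<integral>x. L s f x \<partial>\<nu>)) I"
proof -
  have "bounded (f ` X)" using f by (intro compact_imp_bounded compact_continuous_image compact_X)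
  then obtain B where B: "\<And>x. x \<in> X \<Longrightarrow> \<bar>f x\<bar> \<le> B" by (auto simp: bounded_iff)
  have c: "continuous_on X (\<lambda>x. N p x powr -s * f (\<phi> p x))" if "p \<in> I" for p
    using that N_gt1[OF that]
    by (intro continuous_intros N_cont continuous_on_compose2[OF f phi_cont]) (auto simp: phi_in, fastforce)
  have b: "\<bar>N p x powr -s * f (\<phi> p x)\<bar> \<le> u p powr -s * B" if "p \<in> I" "x \<in> X" for p x
    using that s B by (intro L_term_bound) auto
  have m: "(\<lambda>p. u p powr -s * B) summable_on I" by (intro summable_on_cmult_left u_summable s)
  show "continuous_on X (L s f)"
    unfolding L_def[abs_def] using integral_m_test(1)[OF compact_X c b m] by simp
  show "prob_space \<nu> \<Longrightarrow> sets \<nu> = sets (restrict_space borel X) \<Longrightarrow>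
      ((\<lambda>p. \<integral>x. N p x powr -s * f (\<phi> p x) \<partial>\<nu>) has_sum (\<integral>x. L s f x \<partial>\<nu>)) I"
    unfolding L_def[abs_def] using integral_m_test(2)[OF compact_X c b m] by simp
qed

section \<open>Convergence of the Poincare series\<close>

text \<open>Words are split by their first letter, and \<open>1 + L s G \<le> G\<close> absorbs one
  letter per step of an induction on the maximal length. The bound \<open>B\<close> makes the series
  \<open>L s G\<close> converge.\<close>

lemma finite_weight_sum_le_supersolution:
  assumes s: "1 < s" and G: "\<And>x. x \<in> X \<Longrightarrow> 0 \<le> G x" "\<And>x. x \<in> X \<Longrightarrow> G x \<le> B"
    and super: "\<And>x. x \<in> X \<Longrightarrow> 1 + L s G x \<le> G x"
    and F: "finite F" "F \<subseteq> lists I" and x: "x \<in> X"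
  shows "(\<Sum>\<sigma>\<in>F. weight s \<sigma> x) \<le> G x"
proof -
  have Gb: "\<bar>G y\<bar> \<le> B" if "y \<in> X" for y using G[OF that] by simp
  have "\<forall>F x. finite F \<and> F \<subseteq> lists I \<and> (\<forall>\<sigma>\<in>F. length \<sigma> < k) \<and> x \<in> X \<longrightarrow> (\<Sum>\<sigma>\<in>F. weight s \<sigma> x) \<le> G x" for k
  proof (induction k)
    case 0
    then show ?case using G(1) by (metis ex_in_conv not_less0 sum.empty)
  next
    case (Suc k)
    show ?case
    proof (intro allI impI, elim conjE)
      fix F x assume F: "finite F" "F \<subseteq> lists I" "\<forall>\<sigma>\<in>F. length \<sigma> < Suc k" and x: "x \<in> X"
      let ?F = "F - {[]}"
      have hd: "hd ` ?F \<subseteq> I"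
      proof
        fix p assume "p \<in> hd ` ?F"
        then obtain \<sigma> where "\<sigma> \<in> F" "\<sigma> \<noteq> []" "p = hd \<sigma>" by auto
        then show "p \<in> I" using F(2) by (cases \<sigma>) auto
      qed
      have "(\<Sum>\<sigma>\<in>F. weight s \<sigma> x) \<le> (\<Sum>\<sigma>\<in>insert [] ?F. weight s \<sigma> x)"
        using F(1) by (intro sum_mono2) auto
      also have "\<dots> = 1 + (\<Sum>\<sigma>\<in>?F. weight s \<sigma> x)"
        using F(1) by (subst sum.insert) auto
      also have "(\<Sum>\<sigma>\<in>?F. weight s \<sigma> x) = (\<Sum>p\<in>hd ` ?F. \<Sum>\<sigma> | p # \<sigma> \<in> ?F. weight s (p # \<sigma>) x)"
        using F(1) by (intro sum_nonempty_lists) auto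
      also have "\<dots> \<le> (\<Sum>p\<in>hd ` ?F. N p x powr -s * G (\<phi> p x))"
      proof (rule sum_mono)
        fix p assume "p \<in> hd ` ?F"
        then have p: "p \<in> I" using hd by auto
        have "finite {\<sigma>. p # \<sigma> \<in> ?F}"
          by (rule finite_subset[of _ "tl ` F"]) (use F(1) in \<open>force+\<close>)
        moreover have "{\<sigma>. p # \<sigma> \<in> ?F} \<subseteq> lists I" using F(2) by fastforce
        moreover have "\<forall>\<sigma>\<in>{\<sigma>. p # \<sigma> \<in> ?F}. length \<sigma> < k" using F(3) by fastforce
        ultimately have "(\<Sum>\<sigma> | p # \<sigma> \<in> ?F. weight s \<sigma> (\<phi> p x)) \<le> G (\<phi> p x)"
          using Suc.IH phi_in[OF p x] by blast
        then have "N p x powr -s * (\<Sum>\<sigma> | p # \<sigma> \<in> ?F. weight s \<sigma> (\<phi> p x)) \<le> N p x powr -s * G (\<phi> p x)"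
          by (intro mult_left_mono) auto
        moreover have "(\<Sum>\<sigma> | p # \<sigma> \<in> ?F. weight s (p # \<sigma>) x) =
            (\<Sum>\<sigma> | p # \<sigma> \<in> ?F. N p x powr -s * weight s \<sigma> (\<phi> p x))"
          using F(2) p x by (intro sum.cong refl weight_Cons) auto
        ultimately show "(\<Sum>\<sigma> | p # \<sigma> \<in> ?F. weight s (p # \<sigma>) x) \<le> N p x powr -s * G (\<phi> p x)"
          by (simp add: sum_distrib_left)
      qed
      also have "\<dots> \<le> L s G x"
        unfolding L_def using F(1) hd G(1) phi_in x
        by (intro finite_sum_le_infsum L_summable[OF x s Gb]) auto
      finally show "(\<Sum>\<sigma>\<in>F. weight s \<sigma> x) \<le> G x" using super[OF x] by simp
    qed
  qed
  note this[of "Suc (Max (length ` F))"]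
  moreover have "\<forall>\<sigma>\<in>F. length \<sigma> < Suc (Max (length ` F))" using F(1) by (auto simp: less_Suc_eq_le)
  ultimately show ?thesis using F x by blast
qed

lemma converges_if_bounded:
  assumes "\<And>F. finite F \<Longrightarrow> F \<subseteq> lists I \<Longrightarrow> (\<Sum>\<sigma>\<in>F. weight s \<sigma> x0) \<le> B"
  shows "poincare_converges s"
  unfolding poincare_converges_def
  by (rule nonneg_bdd_above_summable_on) (use assms in \<open>auto intro!: bdd_aboveI2[where M = B]\<close>)

lemma poincare_converges_mono:
  assumes "poincare_converges s" "s \<le> t"
  shows "poincare_converges t"
proof (rule converges_if_bounded)
  fix F assume F: "finite F" "F \<subseteq> lists I"
  have "(\<Sum>\<sigma>\<in>F. weight t \<sigma> x0) \<le> (\<Sum>\<sigma>\<in>F. weight s \<sigma> x0)"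
    using F x0 assms(2) by (intro sum_mono weight_antimono) auto
  also have "\<dots> \<le> (\<Sum>\<^sub>\<infinity>\<sigma>\<in>lists I. weight s \<sigma> x0)"
    using assms(1) F by (intro finite_sum_le_infsum) (auto simp: poincare_converges_def)
  finally show "(\<Sum>\<sigma>\<in>F. weight t \<sigma> x0) \<le> (\<Sum>\<^sub>\<infinity>\<sigma>\<in>lists I. weight s \<sigma> x0)" .
qed

context
  fixes s assumes s: "1 < s" and conv: "poincare_converges s"
begin

lemma weight_bound_summable: "(\<lambda>\<sigma>. C powr s * weight s \<sigma> x0) summable_on lists I"
  using conv unfolding poincare_converges_def by (rule summable_on_cmult_right)

lemma weight_summable: "x \<in> X \<Longrightarrow> (\<lambda>\<sigma>. weight s \<sigma> x) summable_on lists I"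
  using s x0 by (intro summable_on_comparison_test[OF weight_bound_summable]) (auto intro!: weight_distortion)

lemma poincare_continuous: "continuous_on X (poincare s)"
proof -
  have "continuous_on X (\<lambda>x. \<Sum>\<^sub>\<infinity>\<sigma>\<in>lists I. weight s \<sigma> x)"
    using s x0 by (intro integral_m_test(1)[OF compact_X _ _ weight_bound_summable])
      (auto intro!: weight_continuous weight_distortion)
  then show ?thesis unfolding poincare_def[abs_def] .
qed

lemma poincare_bounded: "\<exists>B. \<forall>x\<in>X. \<bar>poincare s x\<bar> \<le> B"
proof -
  have "bounded (poincare s ` X)"
    by (intro compact_imp_bounded compact_continuous_image compact_X poincare_continuous)
  then show ?thesis by (auto simp: bounded_iff)
qed

lemma poincare_ge1: "x \<in> X \<Longrightarrow> 1 \<le> poincare s x"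
  unfolding poincare_def
  using finite_sum_le_infsum[OF weight_summable, of x "{[]}"] by auto

text \<open>A nonempty word is a first letter followed by an arbitrary word started at the image
  point; Fubini then turns their total weight into \<open>L\<close>.\<close>

lemma poincare_eq:
  assumes x: "x \<in> X"
  shows "poincare s x = 1 + L s (poincare s) x"
proof -
  let ?c = "\<lambda>(p, \<sigma>). p # \<sigma>"
  have inj: "inj_on ?c (I \<times> lists I)" by (auto simp: inj_on_def)
  have sm: "(\<lambda>\<sigma>. weight s \<sigma> x) summable_on ?c ` (I \<times> lists I)"
    using weight_summable[OF x] by (rule summable_on_subset) auto
  have sm2: "(\<lambda>(p, \<sigma>). weight s (p # \<sigma>) x) summable_on (I \<times> lists I)"
    using sm unfolding summable_on_reindex[OF inj] by (simp add: comp_def case_prod_beta')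
  have "poincare s x = weight s [] x + (\<Sum>\<^sub>\<infinity>\<sigma>\<in>?c ` (I \<times> lists I). weight s \<sigma> x)"
    unfolding poincare_def by (subst lists_Cons_decomp, rule infsum_insert[OF sm]) auto
  also have "(\<Sum>\<^sub>\<infinity>\<sigma>\<in>?c ` (I \<times> lists I). weight s \<sigma> x) = (\<Sum>\<^sub>\<infinity>(p, \<sigma>)\<in>I \<times> lists I. weight s (p # \<sigma>) x)"
    unfolding infsum_reindex[OF inj] by (intro infsum_cong) auto
  also have "\<dots> = (\<Sum>\<^sub>\<infinity>p\<in>I. \<Sum>\<^sub>\<infinity>\<sigma>\<in>lists I. weight s (p # \<sigma>) x)"
    using infsum_Sigma'_banach[OF sm2] by simp
  also have "\<dots> = L s (poincare s) x"
    unfolding L_def poincare_def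
    by (intro infsum_cong) (auto simp: x weight_Cons infsum_cmult_right' cong: infsum_cong)
  finally show ?thesis by simp
qed

end

text \<open>
  The Poincare series \<open>G\<close> at \<open>b\<close> satisfies \<open>L b G = G - 1\<close>, which leaves room for \<open>2 G\<close> to remain a
  supersolution at slightly smaller exponents.
\<close>

lemma poincare_converges_open:
  assumes b: "1 < b" and conv: "poincare_converges b"
  shows "\<exists>s. 1 < s \<and> s < b \<and> poincare_converges s"
proof -
  obtain B where B: "\<And>x. x \<in> X \<Longrightarrow> \<bar>poincare b x\<bar> \<le> B"
    using poincare_bounded[OF b conv] by blast
  have B1: "1 \<le> B" using B[OF x0] poincare_ge1[OF b conv x0] by simp
  \<comment> \<open>\<open>b - 2 * \<delta>\<close> is still above 1, so the majorant
    \<open>U\<close> at this exponent is finite.\<close>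
  define \<delta> where "\<delta> = (b - 1) / 4"
  have \<delta>: "0 < \<delta>" "1 < b - 2 * \<delta>" using b by (auto simp: \<delta>_def field_simps)
  define U where "U = (\<Sum>\<^sub>\<infinity>p\<in>I. u p powr -(b - 2 * \<delta>))"
  have U0: "0 \<le> U" unfolding U_def by (intro infsum_nonneg) auto
  \<comment> \<open>This makes the change of \<open>L\<close> at most 1/2, so that
    \<open>L s G \<le> G - 1/2\<close> and hence \<open>1 + L s (2 G) \<le> 2 G\<close>.\<close>
  define \<eta> where "\<eta> = min \<delta> (\<delta> / (2 * B * (U + 1)))"
  have \<eta>: "0 < \<eta>" "\<eta> \<le> \<delta>" using \<delta> B1 U0 by (auto simp: \<eta>_def)
  have "\<eta> \<le> \<delta> / (2 * B * (U + 1))" by (simp add: \<eta>_def)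
  moreover have "0 < 2 * B * (U + 1)" using B1 U0 by simp
  ultimately have "\<eta> * (2 * B * (U + 1)) \<le> \<delta>" by (subst (asm) pos_le_divide_eq)
  moreover have "\<eta> * B * U \<le> \<eta> * B * (U + 1)" using \<eta> B1 by (intro mult_left_mono) auto
  ultimately have "\<eta> * B * U \<le> \<delta> / 2" by argo
  then have \<eta>': "\<eta> / \<delta> * B * U \<le> 1 / 2" using \<delta> by (simp add: divide_simps mult_ac)
  define s where "s = b - \<eta>"
  have s: "1 < s" "s < b" using \<eta> \<delta> by (auto simp: s_def)
  have sU: "(\<lambda>p. u p powr -(b - 2 * \<delta>)) summable_on I" by (intro u_summable \<delta>)
  have L_le: "L s (poincare b) x \<le> L b (poincare b) x + 1 / 2" if x: "x \<in> X" for x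
  proof -
    have "N p x powr -s * poincare b (\<phi> p x) \<le>
        N p x powr -b * poincare b (\<phi> p x) + \<eta> / \<delta> * B * u p powr -(b - 2 * \<delta>)" if p: "p \<in> I" for p
    proof -
      have px: "0 \<le> poincare b (\<phi> p x)" "poincare b (\<phi> p x) \<le> B"
        using poincare_ge1[OF b conv phi_in[OF p x]] B[OF phi_in[OF p x]] by auto
      have "N p x powr -(s - \<delta>) \<le> N p x powr -(b - 2 * \<delta>)"
        using N_gt1[OF p x] \<eta> by (intro powr_mono) (auto simp: s_def)
      also have "\<dots> \<le> u p powr -(b - 2 * \<delta>)" using p x \<delta> by (intro N_powr_le) auto
      finally have 1: "N p x powr -(s - \<delta>) \<le> u p powr -(b - 2 * \<delta>)" .
      have "N p x powr -s \<le> N p x powr -b + (b - s) / \<delta> * N p x powr -(s - \<delta>)"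
        using N_gt1[OF p x] s \<delta> by (intro powr_minus_diff_bounds) auto
      also have "\<dots> \<le> N p x powr -b + \<eta> / \<delta> * u p powr -(b - 2 * \<delta>)"
        using \<eta> \<delta> by (intro add_left_mono mult_mono 1) (auto simp: s_def)
      finally have "N p x powr -s * poincare b (\<phi> p x) \<le>
          (N p x powr -b + \<eta> / \<delta> * u p powr -(b - 2 * \<delta>)) * poincare b (\<phi> p x)"
        using px by (intro mult_right_mono)
      also have "\<dots> \<le> N p x powr -b * poincare b (\<phi> p x) + (\<eta> / \<delta> * u p powr -(b - 2 * \<delta>)) * B"
        unfolding distrib_right using px \<eta> \<delta> by (intro add_left_mono mult_left_mono) auto
      finally show ?thesis by (simp add: mult_ac)
    qed
    then have "L s (poincare b) x \<le>
        (\<Sum>\<^sub>\<infinity>p\<in>I. N p x powr -b * poincare b (\<phi> p x) + \<eta> / \<delta> * B * u p powr -(b - 2 * \<delta>))"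
      unfolding L_def using x b s B sU
      by (intro infsum_mono summable_on_add summable_on_cmult_right L_summable[of _ _ "poincare b" B]) auto
    also have "\<dots> = L b (poincare b) x + \<eta> / \<delta> * B * U"
      unfolding L_def U_def using x b B sU
      by (subst infsum_add)
        (simp_all add: summable_on_cmult_right L_summable[of _ _ "poincare b" B] infsum_cmult_right' del: times_divide_eq_left)
    finally show ?thesis using \<eta>' by linarith
  qed
  have "poincare_converges s"
  proof (rule converges_if_bounded)
    fix F assume F: "finite F" "F \<subseteq> lists I"
    show "(\<Sum>\<sigma>\<in>F. weight s \<sigma> x0) \<le> 2 * poincare b x0"
    proof (rule finite_weight_sum_le_supersolution[OF s(1) _ _ _ F x0])
      fix x assume x: "x \<in> X"
      show "0 \<le> 2 * poincare b x" using poincare_ge1[OF b conv x] by simp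
      show "2 * poincare b x \<le> 2 * B" using B[OF x] by simp
      show "1 + L s (\<lambda>x. 2 * poincare b x) x \<le> 2 * poincare b x"
        using L_le[OF x] poincare_eq[OF b conv x] unfolding L_cmult by simp
    qed
  qed
  then show ?thesis using s by blast
qed

text \<open>As \<open>u\<close> is at least \<open>q > 1\<close>, raising the exponent by
  \<open>t\<close> gains the uniform factor \<open>q powr -t\<close>; for large \<open>t\<close> the
  constant 2 becomes a supersolution.\<close>

lemma poincare_converges_large: "\<exists>s>1. poincare_converges s"
proof -
  define U where "U = (\<Sum>\<^sub>\<infinity>p\<in>I. u p powr -2)"
  have U0: "0 \<le> U" unfolding U_def by (intro infsum_nonneg) auto
  have "(\<lambda>n. (1 / q) ^ n * U) \<longlonglongrightarrow> 0 * U"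
    using q by (intro tendsto_intros LIMSEQ_realpow_zero) auto
  then have "\<forall>\<^sub>F n in sequentially. (1 / q) ^ n * U < 1/2"
    by (rule order_tendstoD) simp
  then have "\<forall>\<^sub>F n in sequentially. 0 < n \<and> (1 / q) ^ n * U < 1/2"
    using eventually_gt_at_top[of "0::nat"] by eventually_elim auto
  then obtain n where n: "0 < n" "(1 / q) ^ n * U < 1/2"
    using eventually_happens'[OF sequentially_bot] by blast
  define t where "t = real n"
  have t: "0 < t" "q powr -t * U < 1/2"
    using n q by (simp_all add: t_def powr_minus powr_realpow power_one_over inverse_eq_divide)
  define s where "s = t + 2"
  have s: "1 < s" using t by (simp add: s_def)
  have L_le: "L s (\<lambda>_. 2) x \<le> 1" if x: "x \<in> X" for x
  proof -
    have "N p x powr -s * 2 \<le> (q powr -t * 2) * u p powr -2" if p: "p \<in> I" for p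
    proof -
      have "N p x powr -s \<le> u p powr -s" using p x s by (intro N_powr_le) auto
      also have "\<dots> = u p powr -t * u p powr -2" by (simp add: s_def flip: powr_add)
      also have "\<dots> \<le> q powr -t * u p powr -2"
        using t q u_ge[OF p] by (intro mult_right_mono powr_mono2') auto
      finally show ?thesis by simp
    qed
    then have "L s (\<lambda>_. 2) x \<le> (\<Sum>\<^sub>\<infinity>p\<in>I. (q powr -t * 2) * u p powr -2)"
      unfolding L_def using x s by (intro infsum_mono summable_on_cmult_right u_summable L_summable[of _ _ "\<lambda>_. 2" 2]) auto
    also have "\<dots> = q powr -t * 2 * U" by (simp add: infsum_cmult_right' U_def)
    finally show ?thesis using t by simp
  qed
  have "poincare_converges s"
  proof (rule converges_if_bounded)
    fix F assume F: "finite F" "F \<subseteq> lists I"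
    show "(\<Sum>\<sigma>\<in>F. weight s \<sigma> x0) \<le> 2"
      by (rule finite_weight_sum_le_supersolution[OF s(1) _ _ _ F x0, of "\<lambda>_. 2" 2])
        (use L_le in auto)
  qed
  then show ?thesis using s by blast
qed

text \<open>Each use of \<open>poincare_eq\<close> together with \<open>lower\<close> would raise a
  constant lower bound for the series by 1, against its boundedness on the compact
  \<open>X\<close>.\<close>

lemma poincare_diverges:
  assumes s: "1 < s" and lower: "\<And>x. x \<in> X \<Longrightarrow> 1 \<le> L s (\<lambda>_. 1) x"
  shows "\<not> poincare_converges s"
proof
  assume conv: "poincare_converges s"
  obtain B where B: "\<And>x. x \<in> X \<Longrightarrow> \<bar>poincare s x\<bar> \<le> B"
    using poincare_bounded[OF s conv] by blast
  have "\<forall>x\<in>X. real k \<le> poincare s x" for k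
  proof (induction k)
    case 0
    then show ?case using poincare_ge1[OF s conv] by (auto intro: order_trans[of 0 1])
  next
    case (Suc k)
    show ?case
    proof
      fix x assume x: "x \<in> X"
      have "real k * 1 \<le> real k * L s (\<lambda>_. 1) x" using lower[OF x] by (intro mult_left_mono) auto
      also have "\<dots> = L s (\<lambda>_. real k * 1) x" by (subst L_cmult) simp
      also have "\<dots> \<le> L s (poincare s) x"
        using Suc.IH B by (intro L_mono[OF x s, of _ "real k" _ B]) auto
      finally show "real (Suc k) \<le> poincare s x" using poincare_eq[OF s conv x] by simp
    qed
  qed
  then have "real k \<le> B" for k using B[OF x0] x0 by (meson abs_le_D1 order_trans)
  then show False using reals_Archimedean2[of B] by (meson not_le)
qed


end

section \<open>Patterson measures and existence\<close>

context conformal_ifs begin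

text \<open>The normalised sum of point masses at the endpoints
  \<open>orbit \<phi> \<sigma> x0\<close>. It is specified by its integrals; words with a common
  endpoint are merged by \<open>map_pmf\<close> in the existence proof.\<close>

definition patterson :: "real \<Rightarrow> (nat \<Rightarrow> real) pmf" where
  "patterson s = (SOME p. set_pmf p \<subseteq> X \<and> (\<forall>f :: (nat \<Rightarrow> real) \<Rightarrow> real. bounded (f ` X) \<longrightarrow>
     measure_pmf.expectation p f = (\<Sum>\<^sub>\<infinity>\<sigma>\<in>lists I. weight s \<sigma> x0 * f (orbit \<phi> \<sigma> x0)) / poincare s x0))"

lemma weight_orbit_abs_summable:
  fixes f :: "(nat \<Rightarrow> real) \<Rightarrow> real"
  assumes s: "1 < s" and conv: "poincare_converges s" and f: "bounded (f ` X)"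
  shows "(\<lambda>\<sigma>. norm (weight s \<sigma> x0 * f (orbit \<phi> \<sigma> x0))) summable_on lists I"
proof -
  obtain B where B: "\<And>x. x \<in> X \<Longrightarrow> \<bar>f x\<bar> \<le> B" using f by (auto simp: bounded_iff)
  show ?thesis
    by (rule summable_on_comparison_test[OF summable_on_cmult_left[OF weight_summable[OF s conv x0], of B]])
      (use B orbit_in x0 in \<open>auto simp: abs_mult intro!: mult_left_mono\<close>)
qed

lemma patterson:
  assumes s: "1 < s" and conv: "poincare_converges s"
  shows "set_pmf (patterson s) \<subseteq> X"
    and "bounded (f ` X) \<Longrightarrow> measure_pmf.expectation (patterson s) f =
      (\<Sum>\<^sub>\<infinity>\<sigma>\<in>lists I. weight s \<sigma> x0 * f (orbit \<phi> \<sigma> x0)) / poincare s x0"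
proof -
  have P: "1 \<le> poincare s x0" by (rule poincare_ge1[OF s conv x0])
  have "((\<lambda>\<sigma>. weight s \<sigma> x0) has_sum poincare s x0) (lists I)"
    unfolding poincare_def by (rule has_sum_infsum[OF weight_summable[OF s conv x0]])
  from has_sum_divide_const[OF this, of "poincare s x0"]
  have 1: "((\<lambda>\<sigma>. weight s \<sigma> x0 / poincare s x0) has_sum 1) (lists I)" using P by simp
  obtain p where p: "set_pmf p \<subseteq> lists I"
    "\<And>f :: 'i list \<Rightarrow> real. (\<lambda>\<sigma>. norm (weight s \<sigma> x0 / poincare s x0 * f \<sigma>)) summable_on lists I \<Longrightarrow>
      measure_pmf.expectation p f = (\<Sum>\<^sub>\<infinity>\<sigma>\<in>lists I. weight s \<sigma> x0 / poincare s x0 * f \<sigma>)"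
    using pmf_of_weights[OF 1] P by auto
  have "\<exists>p. set_pmf p \<subseteq> X \<and> (\<forall>f :: (nat \<Rightarrow> real) \<Rightarrow> real. bounded (f ` X) \<longrightarrow>
     measure_pmf.expectation p f = (\<Sum>\<^sub>\<infinity>\<sigma>\<in>lists I. weight s \<sigma> x0 * f (orbit \<phi> \<sigma> x0)) / poincare s x0)"
  proof (intro exI[of _ "map_pmf (\<lambda>\<sigma>. orbit \<phi> \<sigma> x0) p"] conjI allI impI)
    show "set_pmf (map_pmf (\<lambda>\<sigma>. orbit \<phi> \<sigma> x0) p) \<subseteq> X"
      using p(1) x0 orbit_in by (auto simp: subset_iff)
    fix f :: "(nat \<Rightarrow> real) \<Rightarrow> real" assume f: "bounded (f ` X)"
    have "(\<lambda>\<sigma>. norm (weight s \<sigma> x0 * f (orbit \<phi> \<sigma> x0)) * (1 / poincare s x0)) summable_on lists I"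
      by (rule summable_on_cmult_left[OF weight_orbit_abs_summable[OF s conv f]])
    then have "(\<lambda>\<sigma>. norm (weight s \<sigma> x0 / poincare s x0 * f (orbit \<phi> \<sigma> x0))) summable_on lists I"
      using P by (simp add: abs_mult)
    from p(2)[OF this]
    have "measure_pmf.expectation p (\<lambda>\<sigma>. f (orbit \<phi> \<sigma> x0)) =
        (\<Sum>\<^sub>\<infinity>\<sigma>\<in>lists I. weight s \<sigma> x0 * f (orbit \<phi> \<sigma> x0) * (1 / poincare s x0))"
      by simp
    then show "measure_pmf.expectation (map_pmf (\<lambda>\<sigma>. orbit \<phi> \<sigma> x0) p) f =
        (\<Sum>\<^sub>\<infinity>\<sigma>\<in>lists I. weight s \<sigma> x0 * f (orbit \<phi> \<sigma> x0)) / poincare s x0"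
      unfolding infsum_cmult_left' by simp
  qed
  from someI_ex[OF this] show "set_pmf (patterson s) \<subseteq> X"
    and "bounded (f ` X) \<Longrightarrow> measure_pmf.expectation (patterson s) f =
      (\<Sum>\<^sub>\<infinity>\<sigma>\<in>lists I. weight s \<sigma> x0 * f (orbit \<phi> \<sigma> x0)) / poincare s x0"
    unfolding patterson_def by auto
qed

text \<open>Integrating \<open>L s f\<close> appends one letter to each word. This produces every
  word except \<open>[]\<close>, whose term is \<open>f x0\<close>.\<close>

lemma patterson_L:
  assumes s: "1 < s" and conv: "poincare_converges s" and f: "continuous_on X f"
  shows "measure_pmf.expectation (patterson s) (L s f) =
    measure_pmf.expectation (patterson s) f - f x0 / poincare s x0"
proof -
  have bf: "bounded (f ` X)" using f by (intro compact_imp_bounded compact_continuous_image compact_X)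
  have bL: "bounded (L s f ` X)"
    using L_continuous_and_integral(1)[OF f s] by (intro compact_imp_bounded compact_continuous_image compact_X)
  let ?c = "\<lambda>(\<sigma>, p). \<sigma> @ [p]"
  let ?g = "\<lambda>\<sigma>. weight s \<sigma> x0 * f (orbit \<phi> \<sigma> x0)"
  have inj: "inj_on ?c (lists I \<times> I)" by (auto simp: inj_on_def)
  have gs: "?g summable_on lists I"
    by (rule abs_summable_summable[OF weight_orbit_abs_summable[OF s conv bf]])
  then have sm: "?g summable_on ?c ` (lists I \<times> I)"
    by (rule summable_on_subset) auto
  have sm2: "(\<lambda>(\<sigma>, p). ?g (\<sigma> @ [p])) summable_on (lists I \<times> I)"
    using sm unfolding summable_on_reindex[OF inj] by (simp add: comp_def case_prod_beta')
  have "(\<Sum>\<^sub>\<infinity>\<sigma>\<in>lists I. ?g \<sigma>) = ?g [] + (\<Sum>\<^sub>\<infinity>\<sigma>\<in>?c ` (lists I \<times> I). ?g \<sigma>)"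
    by (subst lists_snoc_decomp, rule infsum_insert[OF sm]) auto
  also have "(\<Sum>\<^sub>\<infinity>\<sigma>\<in>?c ` (lists I \<times> I). ?g \<sigma>) = (\<Sum>\<^sub>\<infinity>(\<sigma>, p)\<in>lists I \<times> I. ?g (\<sigma> @ [p]))"
    unfolding infsum_reindex[OF inj] by (intro infsum_cong) auto
  also have "\<dots> = (\<Sum>\<^sub>\<infinity>\<sigma>\<in>lists I. \<Sum>\<^sub>\<infinity>p\<in>I. ?g (\<sigma> @ [p]))"
    using infsum_Sigma'_banach[OF sm2] by simp
  also have "\<dots> = (\<Sum>\<^sub>\<infinity>\<sigma>\<in>lists I. weight s \<sigma> x0 * L s f (orbit \<phi> \<sigma> x0))"
  proof (rule infsum_cong)
    fix \<sigma> assume \<sigma>: "\<sigma> \<in> lists I"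
    have "(\<Sum>\<^sub>\<infinity>p\<in>I. ?g (\<sigma> @ [p])) = (\<Sum>\<^sub>\<infinity>p\<in>I. weight s \<sigma> x0 *
        (N p (orbit \<phi> \<sigma> x0) powr -s * f (\<phi> p (orbit \<phi> \<sigma> x0))))"
      by (intro infsum_cong) (use \<sigma> x0 in \<open>simp add: weight_snoc orbit_snoc\<close>)
    then show "(\<Sum>\<^sub>\<infinity>p\<in>I. ?g (\<sigma> @ [p])) = weight s \<sigma> x0 * L s f (orbit \<phi> \<sigma> x0)"
      unfolding L_def infsum_cmult_right' .
  qed
  finally have "(\<Sum>\<^sub>\<infinity>\<sigma>\<in>lists I. weight s \<sigma> x0 * L s f (orbit \<phi> \<sigma> x0)) = (\<Sum>\<^sub>\<infinity>\<sigma>\<in>lists I. ?g \<sigma>) - f x0"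
    by simp
  then show ?thesis
    unfolding patterson(2)[OF s conv bf] patterson(2)[OF s conv bL] by (simp add: diff_divide_distrib)
qed

text \<open>A finite part of the divergent series at \<open>b\<close> already exceeds any given
  bound, and finite sums are continuous in the exponent.\<close>

lemma poincare_tendsto_infinity:
  assumes b: "1 < b" and div: "\<not> poincare_converges b" and conv: "\<And>m. b \<le> s m" "\<And>m. poincare_converges (s m)"
    and s: "s \<longlonglongrightarrow> b"
  shows "filterlim (\<lambda>m. poincare (s m) x0) at_top sequentially"
  unfolding filterlim_at_top
proof
  fix Z :: real
  obtain F where F: "finite F" "F \<subseteq> lists I" "(\<Sum>\<sigma>\<in>F. weight b \<sigma> x0) > Z"
    using div converges_if_bounded[of b Z] by (meson not_le)
  have "(\<lambda>m. \<Sum>\<sigma>\<in>F. weight (s m) \<sigma> x0) \<longlonglongrightarrow> (\<Sum>\<sigma>\<in>F. weight b \<sigma> x0)"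
    unfolding weight_def using F(2) s cocycle_ge1[OF _ x0]
    by (intro tendsto_intros) (auto simp: subset_iff, fastforce)
  then have "\<forall>\<^sub>F m in sequentially. Z < (\<Sum>\<sigma>\<in>F. weight (s m) \<sigma> x0)"
    using F(3) by (rule order_tendstoD)
  then show "\<forall>\<^sub>F m in sequentially. Z \<le> poincare (s m) x0"
  proof eventually_elim
    case (elim m)
    have "(\<Sum>\<sigma>\<in>F. weight (s m) \<sigma> x0) \<le> poincare (s m) x0"
      unfolding poincare_def using F b conv(1)[of m]
      by (intro finite_sum_le_infsum weight_summable conv x0) auto
    with elim show ?case by simp
  qed
qed

text \<open>Along exponents \<open>s m\<close> decreasing to \<open>b\<close> two errors vanish: the
  empty-word term, divided by the diverging series, and the replacement of \<open>L (s m)\<close> by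
  \<open>L b\<close>, which is uniform on \<open>X\<close> by
  \<open>powr_minus_diff_bounds\<close>.\<close>

lemma conformal_at_critical:
  assumes b: "1 < b" and div: "\<not> poincare_converges b" and conv: "\<And>s. b < s \<Longrightarrow> poincare_converges s"
    and cube: "\<And>x i. x \<in> X \<Longrightarrow> 0 \<le> x i \<and> x i \<le> 1"
  shows "\<exists>\<nu>. conformal b \<nu>"
proof -
  define s where "s m = b + 1 / (real m + 1)" for m
  have s: "b < s m" for m by (simp add: s_def add_pos_nonneg)
  have s1: "1 < s m" for m using s[of m] b by simp
  have "(\<lambda>m. b + 1 / (real m + 1)) \<longlonglongrightarrow> b + 0"
    using LIMSEQ_inverse_real_of_nat by (intro tendsto_intros) (simp add: inverse_eq_divide add.commute)
  then have slim: "s \<longlonglongrightarrow> b" by (simp add: s_def[abs_def])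
  note pat = patterson[OF s1 conv[OF s]]
  have "\<exists>r \<nu>. strict_mono r \<and> prob_space \<nu> \<and> sets \<nu> = sets (restrict_space borel X) \<and>
     (\<forall>f :: (nat \<Rightarrow> real) \<Rightarrow> real. continuous_on X f \<longrightarrow>
       (\<lambda>m. measure_pmf.expectation (patterson (s (r m))) f) \<longlonglongrightarrow> (\<integral>x. f x \<partial>\<nu>))"
    by (rule weakly_convergent_subsequence[OF compact_X]) (use cube pat(1) in blast)+
  then obtain r \<nu> where r: "strict_mono r" and \<nu>: "prob_space \<nu>" "sets \<nu> = sets (restrict_space borel X)"
    and lim: "\<And>f :: (nat \<Rightarrow> real) \<Rightarrow> real. continuous_on X f \<Longrightarrow>
      (\<lambda>m. measure_pmf.expectation (patterson (s (r m))) f) \<longlonglongrightarrow> (\<integral>x. f x \<partial>\<nu>)"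
    by blast
  have srlim: "(\<lambda>m. s (r m)) \<longlonglongrightarrow> b"
    using LIMSEQ_subseq_LIMSEQ[OF slim r] by (simp add: comp_def)
  have Pinf: "filterlim (\<lambda>m. poincare (s (r m)) x0) at_top sequentially"
    using s srlim conv by (intro poincare_tendsto_infinity[OF b div]) (auto intro: less_imp_le)
  define \<delta> where "\<delta> = (b - 1) / 2"
  have \<delta>: "0 < \<delta>" "1 < b - \<delta>" using b by (auto simp: \<delta>_def field_simps)
  define U where "U = (\<Sum>\<^sub>\<infinity>p\<in>I. u p powr -(b - \<delta>))"
  have inv: "(\<integral>x. L b f x \<partial>\<nu>) = (\<integral>x. f x \<partial>\<nu>)" if f: "continuous_on X f" for f
  proof -
    have bf: "bounded (f ` X)" using f by (intro compact_imp_bounded compact_continuous_image compact_X)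
    then obtain B where B: "\<And>x. x \<in> X \<Longrightarrow> \<bar>f x\<bar> \<le> B" by (auto simp: bounded_iff)
    have B0: "0 \<le> B" using B[OF x0] by simp
    have Lb: "continuous_on X (L b f)" by (rule L_continuous_and_integral(1)[OF f b])
    have diff: "\<bar>L b f x - L (s m) f x\<bar> \<le> (s m - b) / \<delta> * B * U" if x: "x \<in> X" for x m
    proof -
      have ab: "(\<lambda>p. N p x powr -b * f (\<phi> p x)) summable_on I"
        by (rule L_summable[OF x b B])
      have as: "(\<lambda>p. N p x powr -s m * f (\<phi> p x)) summable_on I"
        by (rule L_summable[OF x s1 B])
      have sU: "(\<lambda>p. (s m - b) / \<delta> * B * u p powr -(b - \<delta>)) summable_on I"
        by (intro summable_on_cmult_right u_summable \<delta>)
      have t: "\<bar>N p x powr -b * f (\<phi> p x) - N p x powr -s m * f (\<phi> p x)\<bar> \<le> (s m - b) / \<delta> * B * u p powr -(b - \<delta>)"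
        if p: "p \<in> I" for p
      proof -
        have "0 \<le> N p x powr -b - N p x powr -s m"
          and "N p x powr -b - N p x powr -s m \<le> (s m - b) / \<delta> * N p x powr -(b - \<delta>)"
          using powr_minus_diff_bounds[of "N p x" b "s m" \<delta>] N_gt1[OF p x] s[of m] \<delta> by auto
        moreover have "\<dots> \<le> (s m - b) / \<delta> * u p powr -(b - \<delta>)"
          using s[of m] \<delta> p x by (intro mult_left_mono N_powr_le) auto
        ultimately have "\<bar>N p x powr -b - N p x powr -s m\<bar> * \<bar>f (\<phi> p x)\<bar> \<le> ((s m - b) / \<delta> * u p powr -(b - \<delta>)) * B"
          using B[OF phi_in[OF p x]] B0 s[of m] \<delta> by (intro mult_mono) auto
        then show ?thesis unfolding left_diff_distrib[symmetric] abs_mult by (simp only: mult_ac)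
      qed
      have "L b f x \<le> (\<Sum>\<^sub>\<infinity>p\<in>I. N p x powr -s m * f (\<phi> p x) + (s m - b) / \<delta> * B * u p powr -(b - \<delta>))"
        unfolding L_def
      proof (rule infsum_mono[OF ab summable_on_add[OF as sU]])
        show "N p x powr -b * f (\<phi> p x) \<le> N p x powr -s m * f (\<phi> p x) + (s m - b) / \<delta> * B * u p powr -(b - \<delta>)"
          if "p \<in> I" for p using t[OF that] by linarith
      qed
      also have "\<dots> = L (s m) f x + (s m - b) / \<delta> * B * U"
        unfolding L_def U_def infsum_add[OF as sU] infsum_cmult_right' by (rule refl)
      finally have 1: "L b f x \<le> L (s m) f x + (s m - b) / \<delta> * B * U" .
      have "L (s m) f x \<le> (\<Sum>\<^sub>\<infinity>p\<in>I. N p x powr -b * f (\<phi> p x) + (s m - b) / \<delta> * B * u p powr -(b - \<delta>))"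
        unfolding L_def
      proof (rule infsum_mono[OF as summable_on_add[OF ab sU]])
        show "N p x powr -s m * f (\<phi> p x) \<le> N p x powr -b * f (\<phi> p x) + (s m - b) / \<delta> * B * u p powr -(b - \<delta>)"
          if "p \<in> I" for p using t[OF that] by linarith
      qed
      also have "\<dots> = L b f x + (s m - b) / \<delta> * B * U"
        unfolding L_def U_def infsum_add[OF ab sU] infsum_cmult_right' by (rule refl)
      finally show ?thesis using 1 by linarith
    qed
    let ?E = "\<lambda>m. measure_pmf.expectation (patterson (s (r m)))"
    have est: "\<bar>?E m (L b f) - ?E m f\<bar> \<le> (s (r m) - b) / \<delta> * B * U + B / poincare (s (r m)) x0" for m
    proof -
      let ?p = "patterson (s (r m))"
      have AEX: "AE x in ?p. x \<in> X" using pat(1)[of "r m"] by (auto simp: AE_measure_pmf_iff)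
      have int: "integrable ?p g" if "continuous_on X g" for g :: "(nat \<Rightarrow> real) \<Rightarrow> real"
      proof -
        have "bounded (g ` X)" using that by (intro compact_imp_bounded compact_continuous_image compact_X)
        then obtain B' where "\<And>x. x \<in> X \<Longrightarrow> \<bar>g x\<bar> \<le> B'" by (auto simp: bounded_iff)
        then show ?thesis
          using AEX by (intro measure_pmf.integrable_const_bound[of _ B']) (auto elim: eventually_mono)
      qed
      have Ls: "continuous_on X (L (s (r m)) f)" by (rule L_continuous_and_integral(1)[OF f s1])
      have "\<bar>?E m (L b f) - ?E m (L (s (r m)) f)\<bar> = \<bar>?E m (\<lambda>x. L b f x - L (s (r m)) f x)\<bar>"
        by (simp add: int Lb Ls)
      also have "\<dots> \<le> ?E m (\<lambda>x. \<bar>L b f x - L (s (r m)) f x\<bar>)" by (rule integral_abs_bound)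
      also have "\<dots> \<le> ?E m (\<lambda>x. (s (r m) - b) / \<delta> * B * U)"
        using AEX diff by (intro integral_mono_AE int continuous_intros Lb Ls) (auto elim: eventually_mono)
      finally have 1: "\<bar>?E m (L b f) - ?E m (L (s (r m)) f)\<bar> \<le> (s (r m) - b) / \<delta> * B * U" by simp
      have "\<bar>f x0 / poincare (s (r m)) x0\<bar> \<le> B / poincare (s (r m)) x0"
        using B[OF x0] poincare_ge1[OF s1 conv[OF s] x0, of "r m"] by (simp add: abs_divide divide_right_mono)
      then show ?thesis
        using 1 patterson_L[OF s1 conv[OF s] f, of "r m"] by linarith
    qed
    have "(\<lambda>m. (s (r m) - b) / \<delta> * B * U) \<longlonglongrightarrow> (b - b) / \<delta> * B * U"
      by (intro tendsto_mult tendsto_divide tendsto_diff tendsto_const srlim) (use \<delta> in simp)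
    moreover have "(\<lambda>m. B / poincare (s (r m)) x0) \<longlonglongrightarrow> 0"
      by (rule real_tendsto_divide_at_top[OF tendsto_const Pinf])
    ultimately have "(\<lambda>m. (s (r m) - b) / \<delta> * B * U + B / poincare (s (r m)) x0) \<longlonglongrightarrow> (b - b) / \<delta> * B * U + 0"
      by (rule tendsto_add)
    then have lim0: "(\<lambda>m. (s (r m) - b) / \<delta> * B * U + B / poincare (s (r m)) x0) \<longlonglongrightarrow> 0"
      by simp
    have "(\<lambda>m. ?E m (L b f) - ?E m f) \<longlonglongrightarrow> 0"
      by (rule Lim_null_comparison[OF _ lim0]) (use est in simp)
    moreover have "(\<lambda>m. ?E m (L b f) - ?E m f) \<longlonglongrightarrow> (\<integral>x. L b f x \<partial>\<nu>) - (\<integral>x. f x \<partial>\<nu>)"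
      by (intro tendsto_diff lim f Lb)
    ultimately have "(\<integral>x. L b f x \<partial>\<nu>) - (\<integral>x. f x \<partial>\<nu>) = 0"
      using LIMSEQ_unique by blast
    then show ?thesis by simp
  qed
  have "conformal b \<nu>"
    unfolding conformal_def
  proof (intro conjI allI impI \<nu>)
    fix f :: "(nat \<Rightarrow> real) \<Rightarrow> real" assume f: "continuous_on X f"
    show "((\<lambda>p. \<integral>x. N p x powr -b * f (\<phi> p x) \<partial>\<nu>) has_sum (\<integral>x. f x \<partial>\<nu>)) I"
      using L_continuous_and_integral(2)[OF f b \<nu>] inv[OF f] by simp
  qed
  then show ?thesis by blast
qed

text \<open>\<open>b\<close> is the infimum of the convergent exponents: at least \<open>s0\<close>
  by \<open>poincare_diverges\<close>, and itself divergent because convergence is an open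
  condition.\<close>

theorem exists_conformal:
  assumes s0: "1 < s0" and lower: "\<And>x. x \<in> X \<Longrightarrow> 1 \<le> L s0 (\<lambda>_. 1) x"
    and cube: "\<And>x i. x \<in> X \<Longrightarrow> 0 \<le> x i \<and> x i \<le> 1"
  shows "\<exists>b>1. \<exists>\<nu>. conformal b \<nu>"
proof -
  define S where "S = {s. 1 < s \<and> poincare_converges s}"
  obtain s1 where s1: "s1 \<in> S" using poincare_converges_large by (auto simp: S_def)
  have lb: "s0 \<le> s" if "s \<in> S" for s
    using that poincare_diverges[OF s0 lower] poincare_converges_mono[of s s0]
    by (cases "s0 \<le> s") (auto simp: S_def)
  then have bdd: "bdd_below S" by (auto simp: bdd_below_def)
  define b where "b = Inf S"
  have b: "1 < b" using cInf_greatest[of S s0] lb s1 s0 by (fastforce simp: b_def)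
  have div: "\<not> poincare_converges b"
  proof
    assume "poincare_converges b"
    then obtain s where s: "1 < s" "s < b" "poincare_converges s" using poincare_converges_open[OF b] by blast
    then have "b \<le> s" unfolding b_def by (intro cInf_lower bdd) (auto simp: S_def)
    with s show False by simp
  qed
  have conv: "poincare_converges s" if "b < s" for s
  proof -
    have "\<exists>t\<in>S. t < s"
      by (rule cInf_lessD) (use s1 that in \<open>auto simp: b_def\<close>)
    then obtain t where "t \<in> S" "t < s" by blast
    then show ?thesis using poincare_converges_mono[of t s] by (auto simp: S_def)
  qed
  have "\<exists>\<nu>. conformal b \<nu>"
    by (rule conformal_at_critical[OF b div]) (use conv cube in blast)+
  then show ?thesis using b by blast
qed

section \<open>What a conformal measure says about the series\<close>

text \<open>Integrating \<open>poincare_eq\<close> against a measure invariant under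
  \<open>L b\<close> would give a finite number equal to itself plus 1.\<close>

lemma conformal_diverges:
  assumes b: "1 < b" and \<nu>: "conformal b \<nu>"
  shows "\<not> poincare_converges b"
proof
  assume conv: "poincare_converges b"
  have ps: "prob_space \<nu>" and sets: "sets \<nu> = sets (restrict_space borel X)" using \<nu> by (auto simp: conformal_def)
  interpret prob_space \<nu> by fact
  have sp: "space \<nu> = X" using sets_eq_imp_space_eq[OF sets] by (simp add: space_restrict_space)
  note cont = poincare_continuous[OF b conv]
  note int = integrable_continuous_on_compact[OF finite_measure_axioms sets compact_X]
  have "(\<integral>x. poincare b x \<partial>\<nu>) = (\<integral>x. L b (poincare b) x \<partial>\<nu>)"
    using \<nu> cont L_continuous_and_integral(2)[OF cont b ps sets]
    unfolding conformal_def by (meson has_sum_unique)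
  moreover have "(\<integral>x. poincare b x \<partial>\<nu>) = (\<integral>x. 1 + L b (poincare b) x \<partial>\<nu>)"
    by (rule Bochner_Integration.integral_cong) (auto simp: sp intro: poincare_eq[OF b conv])
  moreover have "\<dots> = 1 + (\<integral>x. L b (poincare b) x \<partial>\<nu>)"
    using int[OF L_continuous_and_integral(1)[OF cont b]] by (simp add: prob_space)
  ultimately show False by simp
qed

text \<open>Applying invariance \<open>k\<close> times to the constant 1 gives all words of length
  \<open>k\<close> together the integral 1.\<close>

lemma conformal_length_sum:
  assumes b: "1 < b" and \<nu>: "conformal b \<nu>"
    and F: "finite F" "F \<subseteq> {\<sigma> \<in> lists I. length \<sigma> = k}"
  shows "(\<integral>x. (\<Sum>\<sigma>\<in>F. weight b \<sigma> x) \<partial>\<nu>) \<le> 1"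
  using F
proof (induction k arbitrary: F)
  case 0
  then have "F \<subseteq> {[]}" by auto
  then have "F = {} \<or> F = {[]}" by auto
  then show ?case using \<nu> by (auto simp: conformal_def prob_space.prob_space)
next
  case (Suc k)
  have ps: "prob_space \<nu>" and sets: "sets \<nu> = sets (restrict_space borel X)" using \<nu> by (auto simp: conformal_def)
  interpret prob_space \<nu> by fact
  have sp: "space \<nu> = X" using sets_eq_imp_space_eq[OF sets] by (simp add: space_restrict_space)
  note int = integrable_continuous_on_compact[OF finite_measure_axioms sets compact_X]
  \<comment> \<open>All tails are taken together: they contain the fibre over each first letter, and
    enlarging a sum of nonnegative weights is harmless.\<close>
  define f where "f x = (\<Sum>\<sigma>\<in>tl ` F. weight b \<sigma> x)" for x
  have tlF: "tl ` F \<subseteq> {\<sigma> \<in> lists I. length \<sigma> = k}"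
  proof
    fix \<sigma> assume "\<sigma> \<in> tl ` F"
    then obtain \<rho> where "\<rho> \<in> F" "\<sigma> = tl \<rho>" by auto
    with Suc.prems(2) show "\<sigma> \<in> {\<sigma> \<in> lists I. length \<sigma> = k}" by (cases \<rho>) auto
  qed
  have hdF: "hd ` F \<subseteq> I"
  proof
    fix p assume "p \<in> hd ` F"
    then obtain \<rho> where "\<rho> \<in> F" "p = hd \<rho>" by auto
    with Suc.prems(2) show "p \<in> I" by (cases \<rho>) auto
  qed
  have fc: "continuous_on X f"
    unfolding f_def using tlF by (intro continuous_intros weight_continuous) auto
  have f0: "0 \<le> f x" for x unfolding f_def by (intro sum_nonneg) auto
  have tc: "continuous_on X (\<lambda>x. N p x powr -b * f (\<phi> p x))" if "p \<in> I" for p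
    using that N_gt1[OF that]
    by (intro continuous_intros N_cont continuous_on_compose2[OF fc phi_cont]) (auto simp: phi_in, fastforce)
  have "(\<Sum>\<sigma>\<in>F. weight b \<sigma> x) \<le> (\<Sum>p\<in>hd ` F. N p x powr -b * f (\<phi> p x))" if x: "x \<in> X" for x
  proof -
    have "(\<Sum>\<sigma>\<in>F. weight b \<sigma> x) = (\<Sum>p\<in>hd ` F. \<Sum>\<sigma> | p # \<sigma> \<in> F. weight b (p # \<sigma>) x)"
      using Suc.prems by (intro sum_nonempty_lists) auto
    also have "\<dots> \<le> (\<Sum>p\<in>hd ` F. N p x powr -b * f (\<phi> p x))"
    proof (rule sum_mono)
      fix p assume "p \<in> hd ` F"
      then have p: "p \<in> I" using hdF by auto
      have "(\<Sum>\<sigma> | p # \<sigma> \<in> F. weight b (p # \<sigma>) x) = (\<Sum>\<sigma> | p # \<sigma> \<in> F. N p x powr -b * weight b \<sigma> (\<phi> p x))"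
        using Suc.prems p x by (intro sum.cong refl weight_Cons) auto
      also have "\<dots> = N p x powr -b * (\<Sum>\<sigma> | p # \<sigma> \<in> F. weight b \<sigma> (\<phi> p x))"
        by (simp add: sum_distrib_left)
      also have "\<dots> \<le> N p x powr -b * f (\<phi> p x)"
        unfolding f_def using Suc.prems(1)
        by (intro mult_left_mono sum_mono2) (auto intro: image_eqI[of _ tl "p # _"])
      finally show "(\<Sum>\<sigma> | p # \<sigma> \<in> F. weight b (p # \<sigma>) x) \<le> N p x powr -b * f (\<phi> p x)" .
    qed
    finally show ?thesis .
  qed
  then have "(\<integral>x. (\<Sum>\<sigma>\<in>F. weight b \<sigma> x) \<partial>\<nu>) \<le> (\<integral>x. (\<Sum>p\<in>hd ` F. N p x powr -b * f (\<phi> p x)) \<partial>\<nu>)"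
    using Suc.prems hdF
    by (intro integral_mono int continuous_on_sum weight_continuous tc) (auto simp: sp)
  also have "\<dots> = (\<Sum>p\<in>hd ` F. \<integral>x. N p x powr -b * f (\<phi> p x) \<partial>\<nu>)"
    using hdF tc by (intro Bochner_Integration.integral_sum int) auto
  also have "\<dots> \<le> (\<integral>x. f x \<partial>\<nu>)"
    using \<nu> fc hdF Suc.prems(1) f0
    by (intro finite_sum_le_has_sum[where A = I])
      (auto simp: conformal_def)
  also have "\<dots> \<le> 1"
    unfolding f_def using Suc.prems(1) tlF by (intro Suc.IH) auto
  finally show ?case .
qed

text \<open>Distortion moves the bound for words of length \<open>k\<close> from the
  \<open>\<nu>\<close>-average to \<open>x0\<close>; the surplus \<open>s - b\<close> then gains a
  factor \<open>\<theta> < 1\<close> per letter, and the lengths sum geometrically.\<close>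

theorem conformal_converges:
  assumes b: "1 < b" and \<nu>: "conformal b \<nu>" and s: "b < s"
  shows "poincare_converges s"
proof -
  interpret prob_space \<nu> using \<nu> by (simp add: conformal_def)
  have sets: "sets \<nu> = sets (restrict_space borel X)" using \<nu> by (auto simp: conformal_def)
  have sp: "space \<nu> = X" using sets_eq_imp_space_eq[OF sets] by (simp add: space_restrict_space)
  note int = integrable_continuous_on_compact[OF finite_measure_axioms sets compact_X]
  define \<theta> where "\<theta> = q powr -(s - b)"
  have \<theta>: "0 < \<theta>" "\<theta> < 1" using q s by (auto simp: \<theta>_def powr_less_one)
  have len: "(\<Sum>\<sigma>\<in>F. weight s \<sigma> x0) \<le> C powr b * \<theta> ^ k"
    if F: "finite F" "F \<subseteq> {\<sigma> \<in> lists I. length \<sigma> = k}" for F k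
  proof -
    have "(\<Sum>\<sigma>\<in>F. weight b \<sigma> x0) = (\<integral>x. (\<Sum>\<sigma>\<in>F. weight b \<sigma> x0) \<partial>\<nu>)"
      by (simp add: prob_space)
    also have "\<dots> \<le> (\<integral>x. C powr b * (\<Sum>\<sigma>\<in>F. weight b \<sigma> x) \<partial>\<nu>)"
      unfolding sum_distrib_left using F b x0
      by (intro integral_mono int continuous_intros weight_continuous sum_mono weight_distortion) (auto simp: sp)
    also have "\<dots> = C powr b * (\<integral>x. (\<Sum>\<sigma>\<in>F. weight b \<sigma> x) \<partial>\<nu>)" by simp
    also have "\<dots> \<le> C powr b * 1"
      by (intro mult_left_mono conformal_length_sum[OF b \<nu> F]) simp
    finally have 1: "(\<Sum>\<sigma>\<in>F. weight b \<sigma> x0) \<le> C powr b" by simp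
    have "weight s \<sigma> x0 \<le> weight b \<sigma> x0 * \<theta> ^ k" if "\<sigma> \<in> F" for \<sigma>
    proof -
      have \<sigma>: "\<sigma> \<in> lists I" "length \<sigma> = k" using that F by auto
      have "weight s \<sigma> x0 = weight b \<sigma> x0 * cocycle \<phi> N \<sigma> x0 powr -(s - b)"
        by (simp add: weight_def flip: powr_add)
      also have "\<dots> \<le> weight b \<sigma> x0 * (q ^ k) powr -(s - b)"
        using cocycle_ge[OF \<sigma>(1) x0] \<sigma>(2) s q by (intro mult_left_mono powr_mono2') auto
      also have "(q ^ k) powr -(s - b) = \<theta> ^ k"
        using q by (simp add: \<theta>_def powr_powr mult.commute flip: powr_realpow)
      finally show ?thesis .
    qed
    then have "(\<Sum>\<sigma>\<in>F. weight s \<sigma> x0) \<le> (\<Sum>\<sigma>\<in>F. weight b \<sigma> x0 * \<theta> ^ k)" by (rule sum_mono)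
    also have "\<dots> \<le> C powr b * \<theta> ^ k"
      unfolding sum_distrib_right[symmetric] using 1 \<theta> by (intro mult_right_mono) auto
    finally show ?thesis .
  qed
  show ?thesis
  proof (rule converges_if_bounded)
    fix F assume F: "finite F" "F \<subseteq> lists I"
    have "(\<Sum>\<sigma>\<in>F. weight s \<sigma> x0) = (\<Sum>k\<in>length ` F. \<Sum>\<sigma> | \<sigma> \<in> F \<and> length \<sigma> = k. weight s \<sigma> x0)"
      using F(1) by (intro sum.group[symmetric]) auto
    also have "\<dots> \<le> (\<Sum>k\<in>length ` F. C powr b * \<theta> ^ k)"
      using F by (intro sum_mono len) auto
    also have "\<dots> \<le> (\<Sum>k. C powr b * \<theta> ^ k)"
      using F(1) \<theta> by (intro sum_le_suminf summable_mult summable_geometric) auto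
    finally show "(\<Sum>\<sigma>\<in>F. weight s \<sigma> x0) \<le> (\<Sum>k. C powr b * \<theta> ^ k)" .
  qed
qed

end

section \<open>The maps on the cone\<close>

text \<open>The increasing enumeration of the indices other than \<open>j\<close>; it describes the
  omission of a coordinate both in \<open>gamma_map\<close> and in \<open>vieta\<close>.\<close>

definition skip :: "nat \<Rightarrow> nat \<Rightarrow> nat" where
  "skip j i = (if i < j then i else Suc i)"

lemma bij_betw_skip:
  assumes "1 \<le> j" "j \<le> Suc m"
  shows "bij_betw (skip j) {1..m} ({1..Suc m} - {j})"
proof (rule bij_betwI[where g = "\<lambda>i. if i < j then i else i - 1"])
  show "skip j \<in> {1..m} \<rightarrow> {1..Suc m} - {j}" by (auto simp: skip_def)
  show "(\<lambda>i. if i < j then i else i - 1) \<in> {1..Suc m} - {j} \<rightarrow> {1..m}"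
    using assms by (auto split: if_splits)
qed (use assms in \<open>auto simp: skip_def\<close>)

lemma sum_skip:
  assumes "1 \<le> j" "j \<le> Suc m"
  shows "(\<Sum>i=1..m. f (skip j i)) = sum f ({1..Suc m} - {j})"
  by (rule sum.reindex_bij_betw[OF bij_betw_skip[OF assms]])

lemma prod_skip:
  assumes "1 \<le> j" "j \<le> Suc m"
  shows "(\<Prod>i=1..m. f (skip j i)) = prod f ({1..Suc m} - {j})"
  by (rule prod.reindex_bij_betw[OF bij_betw_skip[OF assms]])

lemma gamma_map_linear:
  "gamma_map n j (\<lambda>i. a * x i + b * y i) = (\<lambda>i. a * gamma_map n j x i + b * gamma_map n j y i)"
  by (auto simp: gamma_map_def fun_eq_iff sum.distrib sum_distrib_left)

lemma gamma_map_mono: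
  assumes "\<And>i. i \<in> {1..n} \<Longrightarrow> x i \<le> y i" "1 \<le> j" "i \<in> {1..n}"
  shows "gamma_map n j x i \<le> gamma_map n j y i"
  using assms by (auto simp: gamma_map_def intro!: sum_mono)

lemma gamma_map_cone_H:
  assumes y: "y \<in> cone_H n" and j: "1 \<le> j" "j \<le> n - 1"
  shows "gamma_map n j y \<in> cone_H n"
proof -
  have n: "n \<ge> 2" using j by simp
  have mono: "y i \<le> y k" if "1 \<le> i" "i \<le> k" "k \<le> n" for i k
    using y that by (auto simp: cone_H_def)
  have pos: "0 \<le> y i" if "1 \<le> i" "i \<le> n" for i
    using y that by (auto simp: cone_H_def)
  have g: "gamma_map n j y i = y (skip j i)" if "1 \<le> i" "i < n" for i
    using that by (auto simp: gamma_map_def skip_def)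
  have gn: "gamma_map n j y n = (\<Sum>k\<in>{1..n} - {j}. y k)"
    using j n by (auto simp: gamma_map_def)
  have "y n \<le> (\<Sum>k\<in>{1..n} - {j}. y k)"
    using j n pos by (intro member_le_sum) auto
  then have last: "y k \<le> gamma_map n j y n" if "1 \<le> k" "k \<le> n" for k
    using mono[of k n] that gn by simp
  have "(\<Sum>i=1..n-1. gamma_map n j y i) = (\<Sum>i=1..n-1. y (skip j i))"
    by (intro sum.cong refl g) (use n in auto)
  also have "\<dots> = (\<Sum>k\<in>{1..n} - {j}. y k)"
    using sum_skip[of j "n - 1" y] j n by simp
  finally have sum: "(\<Sum>i=1..n-1. gamma_map n j y i) = gamma_map n j y n" using gn by simp
  have "gamma_map n j y i = 0" if "i \<notin> {1..n}" for i
    using that j by (auto simp: gamma_map_def)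
  moreover have "0 \<le> gamma_map n j y i" if "i \<in> {1..n}" for i
    using that pos by (auto simp: gamma_map_def intro!: sum_nonneg)
  moreover have "gamma_map n j y i \<le> gamma_map n j y k" if "i \<in> {1..n}" "k \<in> {1..n}" "i \<le> k" for i k
  proof (cases "k = n")
    case True
    then show ?thesis
      using that g[of i] last[of "skip j i"] by (cases "i = n") (auto simp: skip_def)
  next
    case False
    then show ?thesis
      using that g[of i] g[of k] by (auto simp: skip_def intro!: mono)
  qed
  ultimately show ?thesis using sum by (simp add: cone_H_def vectors_def)
qed

section \<open>Letters of \<open>T_Gamma\<close> as linear maps\<close>

definition tau :: "nat \<Rightarrow> nat \<times> nat \<Rightarrow> (nat \<Rightarrow> real) \<Rightarrow> (nat \<Rightarrow> real)" where
  "tau n p = (gamma_map n (n - 1) ^^ fst p) \<circ> gamma_map n (snd p)"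

definition tau_index :: "nat \<Rightarrow> (nat \<times> nat) set" where
  "tau_index n = UNIV \<times> {1..n-2}"

lemma T_Gamma_eq: "T_Gamma n = tau n ` tau_index n"
  unfolding T_Gamma_def tau_def tau_index_def by force

text \<open>The vector \<open>(1, ..., 1, n - 1)\<close>, an upper bound for all points of the cone
  with last coordinate 1; each letter translates it along \<open>bvec\<close>.\<close>

definition hvec :: "nat \<Rightarrow> nat \<Rightarrow> real" where
  "hvec n i = (if 1 \<le> i \<and> i < n then 1 else if i = n then real n - 1 else 0)"

text \<open>Spans the ray fixed by \<open>gamma_map n (n - 1)\<close>, that is, the parabolic point;
  its coordinates in \<open>Delta n\<close> are all 0.\<close>

definition bvec :: "nat \<Rightarrow> nat \<Rightarrow> real" where
  "bvec n i = (if i = n - 1 \<or> i = n then 1 else 0)"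

text \<open>A vector outside the cone. Every letter sends it to \<open>bvec\<close>, so that its
  orbit along a word is the orbit of \<open>bvec\<close> along the word without its first
  letter.\<close>

definition evec :: "nat \<Rightarrow> nat \<Rightarrow> real" where
  "evec n i = (if i = n then 1 else 0)"

lemma tau_indexE:
  assumes "p \<in> tau_index n"
  obtains A j where "p = (A, j)" "j \<in> {1..n-2}"
  using assms by (auto simp: tau_index_def)

context
  fixes n :: nat
  assumes n: "n \<ge> 3"
begin

lemma index_simps [simp]:
  "\<not> n - Suc 0 \<le> n - 2" "\<not> n \<le> n - 2" "n \<noteq> n - Suc 0" "n - Suc 0 \<noteq> n" "\<not> n \<le> n - Suc 0"
  "\<not> n - 1 \<le> n - 2" "n \<noteq> n - 1" "n - 1 \<noteq> n" "Suc 0 \<le> n - Suc 0" "Suc 0 \<le> n" "n - Suc 0 \<le> n"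
  "\<not> n < n - Suc 0" "\<not> n < n - 1" "Suc (n - 2) = n - 1" "Suc (n - Suc (Suc 0)) = n - Suc 0"
  using n by auto

lemma gamma_map_last:
  assumes "w \<in> vectors n"
  shows "gamma_map n (n - 1) w = (\<lambda>i. if i = n then w n + (\<Sum>k=1..n-2. w k) else if i = n - 1 then w n else w i)"
proof
  fix i
  have w0: "w k = 0" if "k \<notin> {1..n}" for k using assms that by (auto simp: vectors_def)
  have "{1..n} - {n - 1} = insert n {1..n-2}" using n by auto
  then have sum: "(\<Sum>k\<in>{1..n} - {n - 1}. w k) = w n + (\<Sum>k=1..n-2. w k)" by simp
  consider "i = n" | "i = n - 1" | "1 \<le> i" "i < n - 1" | "i \<notin> {1..n}" using n by fastforce
  then show "gamma_map n (n - 1) w i =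
      (if i = n then w n + (\<Sum>k=1..n-2. w k) else if i = n - 1 then w n else w i)"
  proof cases
    case 1
    then show ?thesis unfolding gamma_map_def sum by simp
  next
    case 2
    have "Suc (n - Suc 0) = n" "n - Suc 0 < n" using n by auto
    with 2 show ?thesis unfolding gamma_map_def by simp
  next
    case 3
    then have "i \<noteq> n" "i \<noteq> n - 1" by auto
    with 3 show ?thesis unfolding gamma_map_def by simp
  next
    case 4
    then have "\<not> (1 \<le> i \<and> i < n - 1)" "\<not> (n - 1 \<le> i \<and> i < n)" "i \<noteq> n" "i \<noteq> n - 1" using n by auto
    then show ?thesis unfolding gamma_map_def by (simp only: if_False w0[OF 4])
  qed
qed

text \<open>The coordinates up to \<open>n - 2\<close> are fixed, so their sum is added once per
  step: the linear growth of a parabolic map. At \<open>A = 0\<close> coordinate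
  \<open>n - 1\<close> is not yet overwritten, hence the case distinction.\<close>

lemma funpow_gamma_map:
  assumes "z \<in> vectors n"
  shows "(gamma_map n (n - 1) ^^ A) z = (\<lambda>i. if i = n then z n + A * (\<Sum>k=1..n-2. z k)
     else if i = n - 1 \<and> A > 0 then z n + (real A - 1) * (\<Sum>k=1..n-2. z k) else z i)"
proof (induction A)
  case 0
  then show ?case by (auto simp: fun_eq_iff)
next
  case (Suc A)
  let ?S = "\<Sum>k=1..n-2. z k"
  define w where "w = (gamma_map n (n - 1) ^^ A) z"
  have w: "w i = (if i = n then z n + A * ?S else if i = n - 1 \<and> A > 0 then z n + (real A - 1) * ?S else z i)" for i
    by (simp only: w_def Suc.IH)
  have "w i = 0" if "i \<notin> {1..n}" for i
  proof -
    have "i \<noteq> n" "i \<noteq> n - 1" using that n by auto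
    moreover have "z i = 0" using that assms by (auto simp: vectors_def)
    ultimately show ?thesis by (simp only: w if_False simp_thms)
  qed
  then have wv: "w \<in> vectors n" by (simp add: vectors_def)
  have "(\<Sum>k=1..n-2. w k) = ?S"
    by (intro sum.cong refl) (use n in \<open>auto simp: w\<close>)
  moreover have "(gamma_map n (n - 1) ^^ Suc A) z = gamma_map n (n - 1) w"
    by (simp add: w_def)
  ultimately show ?case
    unfolding gamma_map_last[OF wv] by (auto simp: fun_eq_iff w algebra_simps)
qed

text \<open>After \<open>gamma_map n j\<close> the coordinates \<open>n - 1\<close> and
  \<open>n\<close> are \<open>y n\<close> and \<open>y n + S\<close>, already consecutive terms of
  the arithmetic progression; so \<open>A = 0\<close> is no longer exceptional.\<close>

lemma tau_formula:
  assumes j: "j \<in> {1..n-2}"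
  shows "tau n (A, j) y i =
    (let S = (\<Sum>k\<in>{1..n-1} - {j}. y k) in
     if i \<in> {1..n-2} then y (skip j i)
     else if i = n - 1 then y n + A * S
     else if i = n then y n + (real A + 1) * S
     else 0)"
proof -
  let ?z = "gamma_map n j y" and ?S = "\<Sum>k\<in>{1..n-1} - {j}. y k"
  have jl: "j \<le> n - Suc 0" "j \<le> n" using j by auto
  have z: "?z k = y (skip j k)" if "1 \<le> k" "k < n" for k
    using that by (auto simp: gamma_map_def skip_def)
  have "(\<Sum>k=1..n-2. ?z k) = (\<Sum>k=1..n-2. y (skip j k))"
    by (intro sum.cong refl z) (use n in auto)
  also have "\<dots> = ?S"
    using sum_skip[OF _ _, of j "n - 2" y] jl j by simp
  finally have S: "(\<Sum>k=1..n-2. ?z k) = ?S" .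
  have "{1..n} - {j} = insert n ({1..n-1} - {j})" using n j by auto
  moreover have "n \<notin> {1..n-1} - {j}" using n by auto
  ultimately have "(\<Sum>k\<in>{1..n} - {j}. y k) = y n + ?S" by (simp only:) (subst sum.insert, simp_all)
  moreover have "?z n = (\<Sum>k\<in>{1..n} - {j}. y k)"
    unfolding gamma_map_def using jl by simp
  ultimately have zn: "?z n = y n + ?S" by (rule trans[rotated])
  have "1 \<le> n - 1" "n - 1 < n" "\<not> n - 1 < j" "Suc (n - 1) = n" using n j by auto
  then have zn1: "?z (n - 1) = y n" by (simp only: z skip_def if_False)
  have z0: "?z k = 0" if "k \<notin> {1..n}" for k
  proof -
    have "\<not> (1 \<le> k \<and> k < j)" "\<not> (j \<le> k \<and> k < n)" "k \<noteq> n" using that jl j by auto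
    then show ?thesis unfolding gamma_map_def by (simp only: if_False)
  qed
  then have zv: "?z \<in> vectors n" by (simp add: vectors_def)
  have eq: "tau n (A, j) y i = (if i = n then ?z n + A * ?S
     else if i = n - 1 \<and> A > 0 then ?z n + (real A - 1) * ?S else ?z i)"
    unfolding tau_def comp_def fst_conv snd_conv funpow_gamma_map[OF zv] S by (rule refl)
  consider "i = n" | "i = n - 1" | "i \<in> {1..n-2}" | "i \<notin> {1..n}"
    using n by fastforce
  then show ?thesis
  proof cases
    case 1
    then show ?thesis unfolding eq zn Let_def by (simp add: algebra_simps)
  next
    case 2
    then show ?thesis unfolding eq zn Let_def using zn1 by (auto simp: algebra_simps of_nat_diff)
  next
    case 3
    then have "i \<noteq> n" "i \<noteq> n - 1" "1 \<le> i" "i < n" by auto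
    then show ?thesis unfolding eq Let_def using 3 z[of i] by simp
  next
    case 4
    then have "i \<noteq> n" "i \<noteq> n - 1" "i \<notin> {1..n-2}" by auto
    then show ?thesis unfolding eq Let_def by (simp only: z0[OF 4] if_False simp_thms)
  qed
qed

lemma tau_linear:
  "tau n p (\<lambda>i. a * x i + b * y i) = (\<lambda>i. a * tau n p x i + b * tau n p y i)"
proof -
  have "(gamma_map n j ^^ A) (\<lambda>i. a * x i + b * y i) =
      (\<lambda>i. a * (gamma_map n j ^^ A) x i + b * (gamma_map n j ^^ A) y i)" for j A x y
    by (induction A) (simp_all add: gamma_map_linear)
  then show ?thesis by (simp add: tau_def gamma_map_linear)
qed

lemma tau_mono:
  assumes "p \<in> tau_index n" "\<And>i. i \<in> {1..n} \<Longrightarrow> x i \<le> y i" "i \<in> {1..n}"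
  shows "tau n p x i \<le> tau n p y i"
proof -
  obtain A j where p: "p = (A, j)" "1 \<le> j" using assms(1) by (auto elim: tau_indexE)
  have "(gamma_map n (n - 1) ^^ B) (gamma_map n j x) i \<le> (gamma_map n (n - 1) ^^ B) (gamma_map n j y) i"
    if "i \<in> {1..n}" for B i
    using that
  proof (induction B arbitrary: i)
    case 0
    then show ?case using assms(2) p by (auto intro: gamma_map_mono)
  next
    case (Suc B)
    then show ?case using n by (auto intro: gamma_map_mono)
  qed
  then show ?thesis using assms(3) p by (simp add: tau_def)
qed

lemma tau_cone_H:
  assumes "p \<in> tau_index n" "y \<in> cone_H n"
  shows "tau n p y \<in> cone_H n"
proof -
  obtain A j where p: "p = (A, j)" "1 \<le> j" "j \<le> n - 2" using assms(1) by (auto elim: tau_indexE)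
  have "(gamma_map n (n - 1) ^^ B) (gamma_map n j y) \<in> cone_H n" for B
    by (induction B) (use assms n p in \<open>auto intro!: gamma_map_cone_H\<close>)
  then show ?thesis by (simp add: tau_def p)
qed

text \<open>Unit vectors separate the maps: for an index up to \<open>n - 2\<close>, the last
  coordinate of the image vanishes only if that index is the omitted \<open>j\<close>; at index
  \<open>n - 1\<close> it is \<open>A + 1\<close>.\<close>

lemma inj_on_tau: "inj_on (tau n) (tau_index n)"
proof (rule inj_onI)
  fix p p' assume p: "p \<in> tau_index n" "p' \<in> tau_index n" and eq: "tau n p = tau n p'"
  obtain A j A' j' where pp: "p = (A, j)" "p' = (A', j')" by (metis surj_pair)
  have j: "j \<in> {1..n-2}" "j' \<in> {1..n-2}" using p pp by (auto simp: tau_index_def)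
  define e :: "nat \<Rightarrow> nat \<Rightarrow> real" where "e k = (\<lambda>i. if i = k then 1 else 0)" for k
  have sum_e: "(\<Sum>i\<in>{1..n-1} - {l}. e k i) = (if k \<in> {1..n-1} - {l} then 1 else 0)" for k l
    by (simp add: e_def sum.delta')
  have E: "e k n + (real A + 1) * (\<Sum>i\<in>{1..n-1} - {j}. e k i) = e k n + (real A' + 1) * (\<Sum>i\<in>{1..n-1} - {j'}. e k i)" for k
    using fun_cong[OF fun_cong[OF eq, of "e k"], of n]
    unfolding pp tau_formula[OF j(1)] tau_formula[OF j(2)] by (simp add: Let_def)
  have "j = j'" using E[of j] j n unfolding sum_e by (auto split: if_splits)
  moreover have "A = A'" using E[of "n - 1"] j n unfolding sum_e by (auto split: if_splits)
  ultimately show "p = p'" by (simp add: pp)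
qed

lemma orbit_tau_linear:
  "orbit (tau n) \<sigma> (\<lambda>i. a * x i + b * y i) = (\<lambda>i. a * orbit (tau n) \<sigma> x i + b * orbit (tau n) \<sigma> y i)"
  by (induction \<sigma> arbitrary: x y) (simp_all add: tau_linear)

lemma orbit_tau_scale: "orbit (tau n) \<sigma> (\<lambda>i. a * x i) = (\<lambda>i. a * orbit (tau n) \<sigma> x i)"
  using orbit_tau_linear[of \<sigma> a x 0 x] by simp

lemma orbit_tau_add: "orbit (tau n) \<sigma> (\<lambda>i. x i + y i) = (\<lambda>i. orbit (tau n) \<sigma> x i + orbit (tau n) \<sigma> y i)"
  using orbit_tau_linear[of \<sigma> 1 x 1 y] by simp

lemma orbit_tau_mono:
  assumes "\<sigma> \<in> lists (tau_index n)" "\<And>i. i \<in> {1..n} \<Longrightarrow> x i \<le> y i" "i \<in> {1..n}"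
  shows "orbit (tau n) \<sigma> x i \<le> orbit (tau n) \<sigma> y i"
  using assms(1,2)
proof (induction \<sigma> arbitrary: x y)
  case Nil
  then show ?case using assms by simp
next
  case (Cons p \<sigma>)
  then show ?case using tau_mono by auto
qed

section \<open>Bounded distortion\<close>

definition "csize \<sigma> = orbit (tau n) \<sigma> (bvec n) n"
definition "hsize \<sigma> = orbit (tau n) \<sigma> (hvec n) n"

lemma sum_bvec: "j \<in> {1..n-2} \<Longrightarrow> (\<Sum>k\<in>{1..n-1} - {j}. bvec n k) = 1"
proof -
  assume j: "j \<in> {1..n-2}"
  have "(\<Sum>k\<in>{1..n-1} - {j}. bvec n k) = (\<Sum>k\<in>{1..n-1} - {j}. if k = n - 1 then 1 else 0)"
    by (intro sum.cong) (auto simp: bvec_def)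
  moreover have "n - 1 \<in> {1..n-1} - {j}" using j n by auto
  ultimately show ?thesis by (simp add: sum.delta')
qed

lemma sum_hvec: "j \<in> {1..n-2} \<Longrightarrow> (\<Sum>k\<in>{1..n-1} - {j}. hvec n k) = real n - 2"
proof -
  assume j: "j \<in> {1..n-2}"
  have "(\<Sum>k\<in>{1..n-1} - {j}. hvec n k) = (\<Sum>k\<in>{1..n-1} - {j}. 1)"
    by (intro sum.cong) (auto simp: hvec_def)
  moreover have "card ({1..n-1} - {j}) = n - 2" using j n by (subst card_Diff_singleton) auto
  ultimately show ?thesis using n by (simp add: of_nat_diff)
qed

lemma sum_evec: "(\<Sum>k\<in>{1..n-1} - {j}. evec n k) = 0"
  using n by (intro sum.neutral) (auto simp: evec_def)

text \<open>Only the last two coordinates change, both by the same amount, so \<open>hsize\<close>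
  telescopes along a word into values of \<open>csize\<close> on its suffixes.\<close>

lemma tau_hvec:
  assumes "j \<in> {1..n-2}"
  shows "tau n (A, j) (hvec n) = (\<lambda>i. hvec n i + (real A + 1) * (real n - 2) * bvec n i)"
  unfolding fun_eq_iff tau_formula[OF assms] sum_hvec[OF assms] Let_def
  using n assms by (auto simp: hvec_def bvec_def skip_def algebra_simps)

text \<open>The first bound absorbs the factor \<open>A + 1\<close> of \<open>hsize_Cons\<close>;
  the second, combined with \<open>tau_evec\<close>, is the source of the Fibonacci
  inequality.\<close>

lemma tau_bvec_ge:
  assumes "j \<in> {1..n-2}" "i \<in> {1..n}"
  shows "(real A + 1) * bvec n i \<le> tau n (A, j) (bvec n) i"
    and "bvec n i + evec n i \<le> tau n (A, j) (bvec n) i"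
  unfolding tau_formula[OF assms(1)] sum_bvec[OF assms(1)] Let_def
  using n assms by (auto simp: evec_def bvec_def skip_def algebra_simps)

lemma tau_evec:
  assumes "j \<in> {1..n-2}"
  shows "tau n (A, j) (evec n) = bvec n"
  unfolding fun_eq_iff tau_formula[OF assms] sum_evec Let_def
  using n assms by (auto simp: evec_def bvec_def skip_def)

lemma hsize_Cons:
  assumes "j \<in> {1..n-2}"
  shows "hsize ((A, j) # \<sigma>) = hsize \<sigma> + (real A + 1) * (real n - 2) * csize \<sigma>"
  using orbit_tau_linear[of \<sigma> 1 "hvec n" "(real A + 1) * (real n - 2)" "bvec n"]
  by (simp add: hsize_def csize_def tau_hvec[OF assms] fun_eq_iff)

lemma csize_Cons_ge:
  assumes "j \<in> {1..n-2}" "\<sigma> \<in> lists (tau_index n)"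
  shows "(real A + 1) * csize \<sigma> \<le> csize ((A, j) # \<sigma>)"
proof -
  have "orbit (tau n) \<sigma> (\<lambda>i. (real A + 1) * bvec n i) n \<le> orbit (tau n) \<sigma> (tau n (A, j) (bvec n)) n"
    using n by (intro orbit_tau_mono[OF assms(2)] tau_bvec_ge assms) auto
  then show ?thesis unfolding orbit_tau_scale by (simp add: csize_def)
qed

text \<open>
  \<open>hvec\<close> dominates and \<open>bvec\<close> is dominated, up to factors, by all points of the cone of last coordinate \<open>1\<close>,
  so bounded distortion amounts to comparing \<open>hsize\<close> with \<open>csize\<close>.  Each letter increases \<open>hsize\<close> by at most
  a multiple of \<open>csize\<close>, and the sum of these increments is of the order of the last one because
  \<open>csize\<close> grows at least like the Fibonacci numbers.
\<close>

lemma csize_fibonacci: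
  assumes "p \<in> tau_index n" "p' \<in> tau_index n" "\<sigma> \<in> lists (tau_index n)"
  shows "csize (p' # \<sigma>) + csize \<sigma> \<le> csize (p # p' # \<sigma>)"
proof -
  have "p \<in> tau_index n" using assms(1) by simp
  then obtain A j where p: "p = (A, j)" "j \<in> {1..n-2}" by (rule tau_indexE)
  have "p' \<in> tau_index n" using assms(2) by simp
  then obtain A' j' where p': "p' = (A', j')" "j' \<in> {1..n-2}" by (rule tau_indexE)
  have "orbit (tau n) (p' # \<sigma>) (\<lambda>i. bvec n i + evec n i) n \<le> orbit (tau n) (p' # \<sigma>) (tau n p (bvec n)) n"
    using n p assms tau_bvec_ge(2) by (intro orbit_tau_mono) auto
  moreover have "orbit (tau n) (p' # \<sigma>) (evec n) = orbit (tau n) \<sigma> (bvec n)"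
    using p' tau_evec by simp
  ultimately show ?thesis unfolding orbit_tau_add by (simp add: csize_def)
qed

lemma csize_ge1: "\<sigma> \<in> lists (tau_index n) \<Longrightarrow> 1 \<le> csize \<sigma>"
proof (induction \<sigma>)
  case Nil
  then show ?case by (simp add: csize_def bvec_def)
next
  case (Cons p \<sigma>)
  have "p \<in> tau_index n" using Cons.prems by simp
  then obtain A j where p: "p = (A, j)" "j \<in> {1..n-2}" by (rule tau_indexE)
  have "1 * 1 \<le> (real A + 1) * csize \<sigma>" using Cons by (intro mult_mono) auto
  then show ?case using csize_Cons_ge[OF p(2), of \<sigma> A] Cons.prems p by simp
qed

lemma csize_mono:
  assumes "p \<in> tau_index n" "\<sigma> \<in> lists (tau_index n)"
  shows "csize \<sigma> \<le> csize (p # \<sigma>)"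
proof -
  have "p \<in> tau_index n" using assms(1) by simp
  then obtain A j where p: "p = (A, j)" "j \<in> {1..n-2}" by (rule tau_indexE)
  have "1 * csize \<sigma> \<le> (real A + 1) * csize \<sigma>" using csize_ge1[OF assms(2)] by (intro mult_right_mono) auto
  then show ?thesis using csize_Cons_ge[OF p(2) assms(2), of A] p by simp
qed

fun csum :: "(nat \<times> nat) list \<Rightarrow> real" where
  "csum [] = 1"
| "csum (p # \<sigma>) = csize (p # \<sigma>) + csum \<sigma>"

text \<open>Partial sums of Fibonacci numbers stay below the term two places further; likewise the
  values on all suffixes of \<open>\<sigma>\<close> are dominated once two letters are put in
  front.\<close>

lemma csum_le_csize2:
  "\<lbrakk>p \<in> tau_index n; p' \<in> tau_index n; \<sigma> \<in> lists (tau_index n)\<rbrakk> \<Longrightarrow> csum \<sigma> \<le> csize (p # p' # \<sigma>)"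
proof (induction \<sigma> arbitrary: p p')
  case Nil
  then show ?case using csize_ge1[of "[p, p']"] by simp
next
  case (Cons p'' \<sigma>)
  then have "csum \<sigma> \<le> csize (p' # p'' # \<sigma>)" by simp
  moreover have "csize (p' # p'' # \<sigma>) + csize (p'' # \<sigma>) \<le> csize (p # p' # p'' # \<sigma>)"
    using Cons.prems by (intro csize_fibonacci) auto
  ultimately show ?case by simp
qed

text \<open>The first term, the second term and the sum of all later ones are each at most
  \<open>csize \<sigma>\<close>, whence 3.\<close>

lemma csum_le: "\<sigma> \<in> lists (tau_index n) \<Longrightarrow> csum \<sigma> \<le> 3 * csize \<sigma>"
proof (induction \<sigma> rule: csum.induct)
  case 1
  then show ?case by (simp add: csize_def bvec_def)
next
  case (2 p \<sigma>)
  show ?case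
  proof (cases \<sigma>)
    case Nil
    then show ?thesis using csize_ge1[of "[p]"] 2 by simp
  next
    case (Cons p' \<rho>)
    then show ?thesis
      using csum_le_csize2[of p p' \<rho>] csize_mono[of p "p' # \<rho>"] 2 by simp
  qed
qed

lemma hsize_le:
  assumes \<sigma>: "\<sigma> \<in> lists (tau_index n)"
  shows "hsize \<sigma> \<le> 3 * (real n - 1) * csize \<sigma>"
proof -
  have "hsize \<sigma> \<le> (real n - 1) * csum \<sigma>"
    using \<sigma>
  proof (induction \<sigma> rule: list.induct)
    case Nil
    then show ?case using n by (simp add: hsize_def hvec_def)
  next
    case (Cons p \<sigma>)
    have "p \<in> tau_index n" using Cons.prems by simp
    then obtain A j where p: "p = (A, j)" "j \<in> {1..n-2}" by (rule tau_indexE)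
    \<comment> \<open>The unbounded factor \<open>A + 1\<close> is absorbed by \<open>csize\<close>
      of the longer word, so the constant does not depend on the letters.\<close>
    have "(real n - 2) * ((real A + 1) * csize \<sigma>) \<le> (real n - 1) * csize (p # \<sigma>)"
      using csize_Cons_ge[OF p(2), of \<sigma> A] Cons.prems p csize_ge1[of \<sigma>] n by (intro mult_mono) auto
    then show ?case using Cons hsize_Cons[OF p(2), of A \<sigma>] p by (simp add: algebra_simps)
  qed
  also have "\<dots> \<le> (real n - 1) * (3 * csize \<sigma>)"
    using n by (intro mult_left_mono csum_le \<sigma>) auto
  finally show ?thesis by (simp only: mult_ac)
qed

section \<open>Rays, coordinates on \<open>Delta\<close>, and the induced system\<close>

lemma simplex_lift_n [simp]: "simplex_lift n w n = 1"
  using n by (simp add: simplex_lift_def)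

lemma cone_H_last_pos:
  assumes "y \<in> cone_H n" "y \<noteq> (\<lambda>_. 0)"
  shows "0 < y n"
proof (rule ccontr)
  assume "\<not> 0 < y n"
  then have "y i = 0" for i
  proof (cases "i \<in> {1..n}")
    case True
    then have "y i \<le> y n" "0 \<le> y i" using assms(1) n by (auto simp: cone_H_def)
    then show ?thesis using \<open>\<not> 0 < y n\<close> by simp
  next
    case False
    then show ?thesis using assms(1) by (auto simp: cone_H_def vectors_def)
  qed
  then show False using assms(2) by auto
qed

lemma simplex_lift_ray:
  assumes "y \<in> cone_H n" "0 < y n"
  shows "simplex_lift n (ray_coords n y) = (\<lambda>i. (1 / y n) * y i)"
proof
  fix i
  have "{1..n-1} = insert (n - 1) {1..n-2}" using n by auto
  moreover have "n - 1 \<notin> {1..n-2}" using n by auto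
  ultimately have "y n = y (n - 1) + (\<Sum>k=1..n-2. y k)" using assms(1) by (simp add: cone_H_def)
  then have "1 - (\<Sum>k=1..n-2. y k / y n) = y (n - 1) / y n"
    using assms(2) by (simp add: field_simps flip: sum_divide_distrib)
  moreover have "y i = 0" if "i \<notin> {1..n}" using assms(1) that by (auto simp: cone_H_def vectors_def)
  moreover have "(\<Sum>k=1..n-2. ray_coords n y k) = (\<Sum>k=1..n-2. y k / y n)"
    by (intro sum.cong) (auto simp: ray_coords_def)
  ultimately show "simplex_lift n (ray_coords n y) i = (1 / y n) * y i"
    using n assms(2) unfolding simplex_lift_def by (auto simp: ray_coords_def)
qed

lemma ray_scale: "c \<noteq> 0 \<Longrightarrow> ray_coords n (\<lambda>i. c * y i) = ray_coords n y"
  by (auto simp: ray_coords_def)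

lemma cone_H_scale: "y \<in> cone_H n \<Longrightarrow> 0 \<le> c \<Longrightarrow> (\<lambda>i. c * y i) \<in> cone_H n"
  by (auto simp: cone_H_def vectors_def mult_left_mono simp flip: sum_distrib_left)

lemma Delta_eq: "Delta n = {w \<in> vectors (n - 2). simplex_lift n w \<in> cone_H n}"
proof (intro equalityI subsetI)
  fix w assume "w \<in> Delta n"
  then obtain y where y: "y \<in> cone_H n" "y \<noteq> (\<lambda>_. 0)" "w = ray_coords n y" by (auto simp: Delta_def)
  have "0 < y n" by (rule cone_H_last_pos[OF y(1,2)])
  then show "w \<in> {w \<in> vectors (n - 2). simplex_lift n w \<in> cone_H n}"
    unfolding y(3) using simplex_lift_ray[OF y(1)] cone_H_scale[OF y(1), of "1 / y n"]
    by (simp add: vectors_def ray_coords_def)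
next
  fix w assume w: "w \<in> {w \<in> vectors (n - 2). simplex_lift n w \<in> cone_H n}"
  have "ray_coords n (simplex_lift n w) = w"
    using w by (auto simp: ray_coords_def simplex_lift_def vectors_def fun_eq_iff)
  moreover have "simplex_lift n w \<noteq> (\<lambda>_. 0)" by (metis simplex_lift_n zero_neq_one)
  ultimately show "w \<in> Delta n"
    using w unfolding Delta_def by (intro image_eqI[where x = "simplex_lift n w"]) simp_all
qed

lemma Delta_lift: "w \<in> Delta n \<Longrightarrow> simplex_lift n w \<in> cone_H n"
  and ray_lift: "w \<in> Delta n \<Longrightarrow> ray_coords n (simplex_lift n w) = w"
  by (auto simp: Delta_eq ray_coords_def simplex_lift_def vectors_def fun_eq_iff)

lemma Delta_ray: "y \<in> cone_H n \<Longrightarrow> 0 < y n \<Longrightarrow> ray_coords n y \<in> Delta n"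
  unfolding Delta_def by (intro imageI) auto

text \<open>\<open>w i\<close> and coordinate \<open>n - 1\<close> of the lift, which is at least
  \<open>w i\<close>, are among nonnegative terms of sum 1. The bound 1/2 is what makes every
  \<open>factor\<close> at least 3/2.\<close>

lemma Delta_bounds:
  assumes "w \<in> Delta n"
  shows "0 \<le> w i" "w i \<le> 1 / 2"
proof -
  note H = Delta_lift[OF assms]
  have "0 \<le> w i \<and> w i \<le> 1 / 2"
  proof (cases "i \<in> {1..n-2}")
    case True
    have 0: "0 \<le> simplex_lift n w k" if "k \<in> {1..n}" for k using H that by (auto simp: cone_H_def)
    have "{1..n-1} = insert (n - 1) {1..n-2}" "n - 1 \<notin> {1..n-2}" using n by auto
    then have "simplex_lift n w (n - 1) + (\<Sum>k=1..n-2. simplex_lift n w k) = 1"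
      using H by (simp add: cone_H_def)
    moreover have "simplex_lift n w i \<le> (\<Sum>k=1..n-2. simplex_lift n w k)"
      using True 0 by (intro member_le_sum) auto
    moreover have "simplex_lift n w i \<le> simplex_lift n w (n - 1)"
      using True H by (auto simp: cone_H_def)
    moreover have "0 \<le> simplex_lift n w i" using True by (intro 0) auto
    ultimately have "0 \<le> simplex_lift n w i \<and> simplex_lift n w i \<le> 1 / 2" by linarith
    then show ?thesis using True by (simp add: simplex_lift_def)
  next
    case False
    then show ?thesis using assms by (auto simp: Delta_eq vectors_def)
  qed
  then show "0 \<le> w i" "w i \<le> 1 / 2" by auto
qed

lemma continuous_lift: "continuous_on S (\<lambda>w. simplex_lift n w i)"
proof -
  have coord: "continuous_on S (\<lambda>w :: nat \<Rightarrow> real. w k)" for k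
    by (rule continuous_on_subset[OF continuous_on_product_coordinates subset_UNIV])
  consider "i \<in> {1..n-2}" | "i \<notin> {1..n-2}" "i = n - 1" | "i \<notin> {1..n-2}" "i \<noteq> n - 1"
    by blast
  then show ?thesis
    by cases (simp_all only: simplex_lift_def if_True if_False not_False_eq_True simp_thms,
        auto intro!: continuous_intros coord)
qed

text \<open>The ambient space is an infinite product, so Tychonoff supplies a compact cube, from
  which \<open>Delta n\<close> is cut out by closed conditions.\<close>

lemma compact_Delta: "compact (Delta n)"
proof -
  have "compactin (product_topology (\<lambda>_::nat. euclideanreal) UNIV) (PiE UNIV (\<lambda>_. {0..1}))"
    by (subst compactin_PiE) auto
  then have 1: "compact (PiE UNIV (\<lambda>_::nat. {0..1::real}))"
    by (simp add: euclidean_product_topology)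
  note [continuous_intros] = continuous_lift
  have "Delta n = (\<Inter>i. {w. i \<in> {1..n-2} \<or> w i = 0}) \<inter>
     ((\<Inter>i. {w. i \<in> {1..n} \<or> simplex_lift n w i = 0}) \<inter>
     (\<Inter>i. {w. i \<notin> {1..n} \<or> 0 \<le> simplex_lift n w i}) \<inter>
     (\<Inter>i. \<Inter>j. {w. (i \<notin> {1..n} \<or> j \<notin> {1..n} \<or> \<not> i \<le> j) \<or> simplex_lift n w i \<le> simplex_lift n w j}) \<inter>
     {w. (\<Sum>j=1..n-1. simplex_lift n w j) = simplex_lift n w n})"
    by (auto simp: Delta_eq cone_H_def vectors_def)
  also have "closed \<dots>"
    by (intro closed_Int closed_INT ballI closed_Collect_disj closed_Collect_const
        closed_Collect_eq closed_Collect_le continuous_intros continuous_on_product_coordinates)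
  finally have "closed (Delta n)" .
  moreover have "Delta n \<subseteq> PiE UNIV (\<lambda>_::nat. {0..1::real})"
  proof (intro subsetI PiE_I)
    fix w i assume "w \<in> Delta n"
    from Delta_bounds[OF this, of i] show "w i \<in> {0..1}" by simp
  qed auto
  ultimately show ?thesis using compact_Int_closed[OF 1, of "Delta n"] by (simp add: Int_absorb1)
qed

definition "phi p = induced_map n (tau n p)"
definition "factor p w = tau n p (simplex_lift n w) n"

lemma sum_lift: "(\<Sum>k=1..n-1. simplex_lift n w k) = 1"
proof -
  have "{1..n-1} = insert (n - 1) {1..n-2}" "n - 1 \<notin> {1..n-2}" using n by auto
  then have "(\<Sum>k=1..n-1. simplex_lift n w k) = simplex_lift n w (n - 1) + (\<Sum>k=1..n-2. simplex_lift n w k)"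
    by simp
  also have "(\<Sum>k=1..n-2. simplex_lift n w k) = (\<Sum>k=1..n-2. w k)"
    by (intro sum.cong) (auto simp: simplex_lift_def)
  finally show ?thesis using n by (simp add: simplex_lift_def)
qed

lemma factor_formula:
  assumes "j \<in> {1..n-2}"
  shows "factor (A, j) w = 1 + (real A + 1) * (1 - w j)"
proof -
  have "(\<Sum>k=1..n-1. simplex_lift n w k) = simplex_lift n w j + (\<Sum>k\<in>{1..n-1} - {j}. simplex_lift n w k)"
    using assms by (intro sum.remove) auto
  then have "(\<Sum>k\<in>{1..n-1} - {j}. simplex_lift n w k) = 1 - w j"
    using sum_lift assms by (simp add: simplex_lift_def)
  then show ?thesis
    unfolding factor_def tau_formula[OF assms] by (simp add: Let_def)
qed

lemma phi_formula:
  assumes "j \<in> {1..n-2}"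
  shows "phi (A, j) w i = (if i \<in> {1..n-2} then simplex_lift n w (skip j i) / factor (A, j) w else 0)"
  using n assms unfolding phi_def induced_map_def ray_coords_def factor_def tau_formula[OF assms]
  by (auto simp: Let_def)

lemma factor_ge:
  assumes "j \<in> {1..n-2}" "w \<in> Delta n"
  shows "(real A + 3) / 2 \<le> factor (A, j) w" "factor (A, j) w \<le> real A + 2"
proof -
  have w: "0 \<le> w j" "w j \<le> 1/2" using Delta_bounds[OF assms(2)] by auto
  have "(real A + 1) * (1 / 2) \<le> (real A + 1) * (1 - w j)" using w by (intro mult_left_mono) auto
  then show "(real A + 3) / 2 \<le> factor (A, j) w" unfolding factor_formula[OF assms(1)] by argo
  have "(real A + 1) * (1 - w j) \<le> (real A + 1) * 1" using w by (intro mult_left_mono) auto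
  then show "factor (A, j) w \<le> real A + 2" unfolding factor_formula[OF assms(1)] by argo
qed

text \<open>By homogeneity each factor is the ratio of consecutive last coordinates along the linear
  orbit, and the product telescopes.\<close>

lemma cocycle_ray:
  assumes "\<sigma> \<in> lists (tau_index n)" "y \<in> cone_H n" "0 < y n"
  shows "cocycle phi factor \<sigma> (ray_coords n y) = orbit (tau n) \<sigma> y n / y n"
  using assms
proof (induction \<sigma> arbitrary: y rule: list.induct)
  case (Cons p \<sigma>)
  have "p \<in> tau_index n" using Cons.prems by simp
  then obtain A j where p: "p = (A, j)" "j \<in> {1..n-2}" by (rule tau_indexE)
  have scale: "tau n p (\<lambda>i. c * y i) = (\<lambda>i. c * tau n p y i)" for c
    using tau_linear[of p c y 0 y] by simp
  have lift: "simplex_lift n (ray_coords n y) = (\<lambda>i. (1 / y n) * y i)"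
    by (rule simplex_lift_ray) (use Cons.prems in auto)
  have f: "factor p (ray_coords n y) = tau n p y n / y n"
    unfolding factor_def lift scale by simp
  have "0 < factor p (ray_coords n y)"
    using factor_ge(1)[OF p(2) Delta_ray[OF Cons.prems(2,3)], of A] p by simp
  then have pos: "0 < tau n p y n" using f Cons.prems(3) by (simp add: zero_less_divide_iff)
  have "phi p (ray_coords n y) = ray_coords n (tau n p y)"
    unfolding phi_def induced_map_def lift scale using Cons.prems(3) by (intro ray_scale) simp
  then have "cocycle phi factor (p # \<sigma>) (ray_coords n y) =
      tau n p y n / y n * (orbit (tau n) \<sigma> (tau n p y) n / tau n p y n)"
    using Cons.IH[of "tau n p y"] Cons.prems pos tau_cone_H f by simp
  then show ?case using pos by simp
qed auto

lemma cocycle_lift: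
  assumes "\<sigma> \<in> lists (tau_index n)" "w \<in> Delta n"
  shows "cocycle phi factor \<sigma> w = orbit (tau n) \<sigma> (simplex_lift n w) n"
  using cocycle_ray[OF assms(1) Delta_lift[OF assms(2)]] ray_lift[OF assms(2)] by simp

text \<open>The parabolic point serves as base point because the cocycle there is
  \<open>csize\<close>, the quantity that the word estimates control.\<close>

lemma zero_in_Delta: "(\<lambda>_. 0) \<in> Delta n"
  and lift_zero: "simplex_lift n (\<lambda>_. 0) = bvec n"
proof -
  show l: "simplex_lift n (\<lambda>_. 0) = bvec n"
    using n by (auto simp: simplex_lift_def bvec_def fun_eq_iff)
  have "bvec n \<in> cone_H n"
    using n sum_lift[of "\<lambda>_. 0"] unfolding cone_H_def l by (auto simp: vectors_def bvec_def)
  then show "(\<lambda>_. 0) \<in> Delta n" by (auto simp: Delta_eq l vectors_def)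
qed

lemma csize_eq_cocycle: "\<sigma> \<in> lists (tau_index n) \<Longrightarrow> csize \<sigma> = cocycle phi factor \<sigma> (\<lambda>_. 0)"
  using cocycle_lift[OF _ zero_in_Delta] by (simp add: csize_def lift_zero)

lemma cocycle_bounds:
  assumes "\<sigma> \<in> lists (tau_index n)" "w \<in> Delta n"
  shows "cocycle phi factor \<sigma> w \<le> 3 * (real n - 1) * csize \<sigma>"
    and "csize \<sigma> \<le> (real n - 1) * cocycle phi factor \<sigma> w"
proof -
  note H = Delta_lift[OF assms(2)]
  have mono: "simplex_lift n w i \<le> simplex_lift n w k" if "1 \<le> i" "i \<le> k" "k \<le> n" for i k
    using H that by (auto simp: cone_H_def)
  have "orbit (tau n) \<sigma> (simplex_lift n w) n \<le> hsize \<sigma>"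
    unfolding hsize_def using mono[of _ n] n
    by (intro orbit_tau_mono[OF assms(1)]) (auto simp: hvec_def)
  then show "cocycle phi factor \<sigma> w \<le> 3 * (real n - 1) * csize \<sigma>"
    using hsize_le[OF assms(1)] cocycle_lift[OF assms] by simp
  \<comment> \<open>Coordinate \<open>n - 1\<close> is the largest of \<open>n - 1\<close> numbers
    of sum 1.\<close>
  have "1 \<le> (\<Sum>k=1..n-1. simplex_lift n w (n - 1))"
    unfolding sum_lift[of w, symmetric] by (intro sum_mono mono) auto
  then have last: "1 \<le> (real n - 1) * simplex_lift n w (n - 1)" using n by (simp add: of_nat_diff)
  have "bvec n i \<le> (real n - 1) * simplex_lift n w i" if "i \<in> {1..n}" for i
    using that H n last by (auto simp: bvec_def cone_H_def)
  then have "csize \<sigma> \<le> orbit (tau n) \<sigma> (\<lambda>i. (real n - 1) * simplex_lift n w i) n"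
    unfolding csize_def using n by (intro orbit_tau_mono[OF assms(1)]) auto
  then show "csize \<sigma> \<le> (real n - 1) * cocycle phi factor \<sigma> w"
    unfolding orbit_tau_scale cocycle_lift[OF assms] .
qed

text \<open>For each of the \<open>n - 2\<close> values of \<open>j\<close> this is the tail of a
  p-series in \<open>A\<close>; hence the threshold 1 for the exponent.\<close>

lemma u_summable:
  assumes "1 < s"
  shows "(\<lambda>p. ((real (fst p) + 3) / 2) powr -s) summable_on tau_index n"
proof -
  have "summable (\<lambda>A. real (A + 3) powr -s)"
    using assms by (intro summable_ignore_initial_segment) (simp add: summable_real_powr_iff)
  then have sm: "summable (\<lambda>A. ((real A + 3) / 2) powr -s)"
    using summable_mult[of "\<lambda>A. real (A + 3) powr -s" "2 powr s"]
    by (simp add: powr_divide powr_minus_divide)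
  define T where "T = (\<Sum>A. ((real A + 3) / 2) powr -s)"
  show ?thesis
  proof (rule nonneg_bdd_above_summable_on)
    show "bdd_above (sum (\<lambda>p. ((real (fst p) + 3) / 2) powr -s) ` {F. F \<subseteq> tau_index n \<and> finite F})"
    proof (rule bdd_aboveI2)
      fix F assume "F \<in> {F. F \<subseteq> tau_index n \<and> finite F}"
      then have F: "F \<subseteq> tau_index n" "finite F" by auto
      have "(\<Sum>p\<in>F. ((real (fst p) + 3) / 2) powr -s) \<le> (\<Sum>p\<in>(fst ` F) \<times> {1..n-2}. ((real (fst p) + 3) / 2) powr -s)"
        using F by (intro sum_mono2) (force simp: tau_index_def)+
      also have "\<dots> = (\<Sum>A\<in>fst ` F. \<Sum>j\<in>{1..n-2}. ((real A + 3) / 2) powr -s)"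
        by (subst sum.cartesian_product) (auto intro!: sum.cong)
      also have "\<dots> = real (n - 2) * (\<Sum>A\<in>fst ` F. ((real A + 3) / 2) powr -s)"
        by (simp add: sum_distrib_left numeral_2_eq_2)
      also have "\<dots> \<le> real (n - 2) * T"
        unfolding T_def using F sm by (intro mult_left_mono sum_le_suminf) auto
      finally show "(\<Sum>p\<in>F. ((real (fst p) + 3) / 2) powr -s) \<le> real (n - 2) * T" .
    qed
  qed auto
qed

text \<open>The distortion constant is the product of the two constants in
  \<open>cocycle_bounds\<close>, which compare an arbitrary point with the base point.\<close>

lemma conformal_ifs_Delta:
  "conformal_ifs (Delta n) (tau_index n) phi factor (\<lambda>p. (real (fst p) + 3) / 2) (3/2)
     (3 * (real n - 1) * (real n - 1)) (\<lambda>_. 0)"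
proof
  show "compact (Delta n)" by (rule compact_Delta)
  show "(\<lambda>_. 0) \<in> Delta n" by (rule zero_in_Delta)
  fix p assume "p \<in> tau_index n"
  then obtain A j where p: "p = (A, j)" "j \<in> {1..n-2}" by (auto simp: tau_index_def)
  show fc: "continuous_on (Delta n) (factor p)"
    unfolding p factor_formula[OF p(2), abs_def]
    by (intro continuous_intros continuous_on_subset[OF continuous_on_product_coordinates subset_UNIV])
  show "(real (fst p) + 3) / 2 \<le> factor p w" if "w \<in> Delta n" for w
    using factor_ge[OF p(2) that, of A] p by simp
  have pos: "factor p w \<noteq> 0" if "w \<in> Delta n" for w
    using factor_ge[OF p(2) that, of A] p by simp
  show "continuous_on (Delta n) (phi p)"
  proof (rule continuous_on_coordinatewise_then_product)
    fix i show "continuous_on (Delta n) (\<lambda>w. phi p w i)"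
      unfolding p phi_formula[OF p(2)] using pos p fc
      by (cases "i \<in> {1..n-2}") (auto intro!: continuous_intros continuous_lift)
  qed
  show "phi p w \<in> Delta n" if "w \<in> Delta n" for w
  proof -
    have "tau n p (simplex_lift n w) \<in> cone_H n"
      using \<open>p \<in> tau_index n\<close> by (intro tau_cone_H Delta_lift that)
    then show ?thesis
      unfolding phi_def induced_map_def
      using factor_ge[OF p(2) that, of A] p by (intro Delta_ray) (auto simp: factor_def)
  qed
  show "3 / 2 \<le> (real (fst p) + 3) / 2" by simp
next
  fix \<sigma> x y assume \<sigma>: "\<sigma> \<in> lists (tau_index n)" and xy: "x \<in> Delta n" "y \<in> Delta n"
  have "cocycle phi factor \<sigma> x \<le> 3 * (real n - 1) * csize \<sigma>" by (rule cocycle_bounds[OF \<sigma> xy(1)])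
  also have "\<dots> \<le> 3 * (real n - 1) * ((real n - 1) * cocycle phi factor \<sigma> y)"
    using n by (intro mult_left_mono cocycle_bounds[OF \<sigma> xy(2)]) auto
  finally show "cocycle phi factor \<sigma> x \<le> 3 * (real n - 1) * (real n - 1) * cocycle phi factor \<sigma> y" by simp
next
  show "(1::real) < 3 / 2" by simp
  show "(\<lambda>p. ((real (fst p) + 3) / 2) powr -s) summable_on tau_index n" if "1 < s" for s
    by (rule u_summable[OF that])
qed

text \<open>The letters with \<open>j = 1\<close> and \<open>A = 0, 1, 2\<close> suffice:
  \<open>factor\<close> is at most \<open>A + 2\<close>, and \<open>1/2 + 1/3 + 1/4 = 13/12\<close>
  exceeds 1. The exponent 21/20 loses at most a factor \<open>4 powr (1/20)\<close>, which is at
  most 13/12 since \<open>4 \<le> (13/12) ^ 20\<close>.\<close>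

lemma L_lower:
  assumes w: "w \<in> Delta n"
  shows "1 \<le> conformal_ifs.L (tau_index n) phi factor (21/20) (\<lambda>_. 1) w"
proof -
  interpret conformal_ifs "Delta n" "tau_index n" phi factor "\<lambda>p. (real (fst p) + 3) / 2" "3/2"
     "3 * (real n - 1) * (real n - 1)" "\<lambda>_. 0" by (rule conformal_ifs_Delta)
  have one: "1 \<in> {1..n-2}" using n by simp
  have "(4::real) powr (1/20) \<le> ((13/12) ^ 20) powr (1/20)"
    by (intro powr_mono2) (auto simp: eval_nat_numeral)
  also have "(13/12 :: real) ^ 20 = (13/12) powr real 20" by (rule powr_realpow[symmetric]) simp
  also have "\<dots> powr (1/20) = 13/12" unfolding powr_powr by simp
  finally have four: "(4::real) powr (1/20) \<le> 13/12" .
  have t_le: "4 powr -(1/20) * (1 / (real A + 2)) \<le> factor (A, 1) w powr -(21/20) * 1" if "A \<le> 2" for A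
  proof -
    have "4 powr -(1/20) * (1 / (real A + 2)) \<le> (real A + 2) powr -(1/20) * (1 / (real A + 2))"
      using that by (intro mult_right_mono powr_mono2') auto
    also have "1 / (real A + 2) = (real A + 2) powr -1" by (simp add: powr_minus_divide)
    also have "(real A + 2) powr -(1/20) * (real A + 2) powr -1 = (real A + 2) powr -(21/20)"
      unfolding powr_add[symmetric] by simp
    also have "\<dots> \<le> factor (A, 1) w powr -(21/20)"
      using factor_ge[OF one w, of A] by (intro powr_mono2') auto
    finally show ?thesis by simp
  qed
  have "1 = 4 powr -(1/20) * (4 powr (1/20) :: real)" by (simp flip: powr_add)
  also have "\<dots> \<le> 4 powr -(1/20) * (13/12)" by (intro mult_left_mono four) simp
  also have "\<dots> = (\<Sum>A\<in>{0,1,2::nat}. 4 powr -(1/20) * (1 / (real A + 2)))" by (simp add: algebra_simps)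
  also have "\<dots> \<le> (\<Sum>A\<in>{0,1,2}. factor (A, 1) w powr -(21/20) * 1)" by (intro sum_mono t_le) auto
  also have "\<dots> = (\<Sum>p\<in>{(0,1),(1,1),(2,1)}. factor p w powr -(21/20) * 1)" by simp
  also have "\<dots> \<le> L (21/20) (\<lambda>_. 1) w"
    unfolding L_def using one w
    by (intro finite_sum_le_infsum L_summable[of _ _ "\<lambda>_. 1" 1]) (auto simp: tau_index_def)
  finally show ?thesis .
qed

end

section \<open>The Jacobian\<close>

context
  fixes n :: nat
  assumes n: "n \<ge> 3"
begin

lemma lift_has_derivative:
  assumes "k \<in> {1..n-2}" "l \<in> {1..n-1}"
  shows "((\<lambda>t. simplex_lift n (w(k := t)) l) has_field_derivative
    (if l = n - 1 then -1 else if l = k then 1 else 0)) (at x)"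
proof (cases "l = n - 1")
  case True
  have "(\<Sum>i=1..n-2. (w(k := t)) i) = t + (\<Sum>i\<in>{1..n-2} - {k}. w i)" for t
  proof -
    have "(\<Sum>i=1..n-2. (w(k := t)) i) = (w(k := t)) k + (\<Sum>i\<in>{1..n-2} - {k}. (w(k := t)) i)"
      using assms by (intro sum.remove) auto
    then show ?thesis by simp
  qed
  then have "simplex_lift n (w(k := t)) l = 1 - (t + (\<Sum>i\<in>{1..n-2} - {k}. w i))" for t
    using True n unfolding simplex_lift_def by simp
  then show ?thesis using True by (auto intro!: derivative_eq_intros)
next
  case False
  then have "l \<in> {1..n-2}" using assms by auto
  then have "simplex_lift n (w(k := t)) l = (if l = k then t else w l)" for t
    unfolding simplex_lift_def by simp
  then show ?thesis using False by (auto intro!: derivative_eq_intros)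
qed

text \<open>The numerator involves \<open>t\<close> directly or through coordinate
  \<open>n - 1\<close>, which is 1 minus the others; the denominator involves only
  \<open>w j\<close>, so the second term appears in column \<open>j\<close> alone.\<close>

lemma phi_has_derivative:
  assumes j: "j \<in> {1..n-2}" and k: "k \<in> {1..n-2}" and i: "i \<in> {1..n-2}" and D: "factor n (A, j) w \<noteq> 0"
  shows "((\<lambda>t. phi n (A, j) (w(k := t)) i) has_field_derivative
    (if skip j i = n - 1 then -1 else if skip j i = k then 1 else 0) / factor n (A, j) w +
    (if k = j then (real A + 1) * simplex_lift n w (skip j i) / (factor n (A, j) w)\<^sup>2 else 0)) (at (w k))"
proof -
  let ?l = "skip j i" and ?D = "factor n (A, j) w"
  have l: "?l \<in> {1..n-1}" using i by (auto simp: skip_def)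
  let ?a = "if ?l = n - 1 then -1 else if ?l = k then 1 else 0 :: real"
  let ?d = "if k = j then - (real A + 1) else 0"
  have num: "((\<lambda>t. simplex_lift n (w(k := t)) ?l) has_field_derivative ?a) (at (w k))"
    by (rule lift_has_derivative[OF k l])
  have den: "((\<lambda>t. factor n (A, j) (w(k := t))) has_field_derivative ?d) (at (w k))"
    unfolding factor_formula[OF n j] by (auto intro!: derivative_eq_intros)
  have "((\<lambda>t. simplex_lift n (w(k := t)) ?l / factor n (A, j) (w(k := t))) has_field_derivative
      (?a * ?D - simplex_lift n w ?l * ?d) / (?D * ?D)) (at (w k))"
    using DERIV_divide[OF num den] D by simp
  moreover have "(?a * ?D - simplex_lift n w ?l * ?d) / (?D * ?D) =
      ?a / ?D + (if k = j then (real A + 1) * simplex_lift n w ?l / ?D\<^sup>2 else 0)"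
  proof -
    have "(a * d - x * (if k = j then - c else 0)) / (d * d) = a / d + (if k = j then c * x / d\<^sup>2 else 0)"
      if "d \<noteq> 0" for a d x c :: real
      using that by (simp add: field_simps power2_eq_square)
    from this[OF D] show ?thesis .
  qed
  ultimately show ?thesis using i by (simp add: phi_formula[OF n j])
qed

text \<open>
  Adding all rows to the last one leaves a single nonzero entry there, and the complementary minor
  is a multiple of the identity.
\<close>

lemma abs_det_skip_matrix:
  fixes M :: "real Matrix.mat"
  assumes M: "M \<in> carrier_mat (Suc m) (Suc m)" and j: "j \<le> m"
    and entries: "\<And>i k. i < m \<Longrightarrow> k \<le> m \<Longrightarrow> k \<noteq> j \<Longrightarrow>
      M $$ (i, k) = (if k = (if i < j then i else Suc i) then d else 0)"
    and col: "\<And>k. k \<le> m \<Longrightarrow> (\<Sum>i\<le>m. M $$ (i, k)) = (if k = j then c else 0)"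
  shows "\<bar>Determinant.det M\<bar> = \<bar>c\<bar> * \<bar>d\<bar> ^ m"
proof -
  define L where "L = Matrix.mat (Suc m) (Suc m) (\<lambda>(i, k). if i = m \<or> i = k then 1 else 0 :: real)"
  have L: "L \<in> carrier_mat (Suc m) (Suc m)" by (simp add: L_def)
  have "Determinant.det L = prod_list (diag_mat L)"
    by (rule det_lower_triangular[OF _ L]) (auto simp: L_def)
  also have "diag_mat L = replicate (Suc m) 1"
    by (simp add: diag_mat_def L_def list_eq_iff_nth_eq del: upt_Suc replicate_Suc)
  finally have detL: "Determinant.det L = 1" by simp
  define P where "P = L * M"
  have P: "P \<in> carrier_mat (Suc m) (Suc m)" using L M by (simp add: P_def)
  have entry: "P $$ (i, k) = (\<Sum>l\<le>m. (if i = m \<or> i = l then 1 else 0) * M $$ (l, k))" if "i \<le> m" "k \<le> m" for i k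
    using that M L unfolding P_def
    by (simp add: scalar_prod_def L_def atLeast0LessThan lessThan_Suc_atMost)
  have last: "P $$ (m, k) = (if k = j then c else 0)" if "k \<le> m" for k
    using entry[of m k] col[OF that] that by simp
  have other: "P $$ (i, k) = M $$ (i, k)" if "i < m" "k \<le> m" for i k
    using entry[of i k] that by (simp add: if_distrib[of "\<lambda>x. x * _"] cong: if_cong)
  have "Determinant.det M = Determinant.det P"
    unfolding P_def by (subst det_mult[OF L M]) (simp add: detL)
  also have "\<dots> = (\<Sum>k<Suc m. P $$ (m, k) * cofactor P m k)"
    by (rule laplace_expansion_row[OF P]) simp
  also have "\<dots> = (\<Sum>k<Suc m. if k = j then c * cofactor P m j else 0)"
    by (intro sum.cong refl) (auto simp: last)
  also have "\<dots> = c * cofactor P m j" using j by simp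
  finally have det: "Determinant.det M = c * ((-1) ^ (m + j) * Determinant.det (mat_delete P m j))"
    by (simp add: cofactor_def)
  have "mat_delete P m j = d \<cdot>\<^sub>m 1\<^sub>m m"
  proof (rule eq_matI)
    fix i k assume "i < dim_row (d \<cdot>\<^sub>m 1\<^sub>m m)" "k < dim_col (d \<cdot>\<^sub>m 1\<^sub>m m)"
    then have ik: "i < m" "k < m" by auto
    have "mat_delete P m j $$ (i, k) = P $$ (i, if k < j then k else Suc k)"
      using ik P by (simp add: mat_delete_def)
    also have "\<dots> = M $$ (i, if k < j then k else Suc k)" using ik by (intro other) auto
    also have "\<dots> = (if (if k < j then k else Suc k) = (if i < j then i else Suc i) then d else 0)"
      using ik by (intro entries) auto
    also have "\<dots> = (d \<cdot>\<^sub>m 1\<^sub>m m) $$ (i, k)" using ik by auto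
    finally show "mat_delete P m j $$ (i, k) = (d \<cdot>\<^sub>m 1\<^sub>m m) $$ (i, k)" .
  qed (use P in \<open>auto simp: mat_delete_def\<close>)
  then have "Determinant.det (mat_delete P m j) = d ^ m" by simp
  then show ?thesis unfolding det by (simp add: abs_mult power_abs)
qed

text \<open>Write \<open>D\<close> for the factor. In a column, the matching coordinate contributes
  \<open>1 / D\<close> and coordinate \<open>n - 1\<close> contributes \<open>-1 / D\<close>, so the
  column sums vanish except in column \<open>j\<close>, where the sum is
  \<open>-1 / D + (D - 1) / D\<^sup>2 = -1 / D\<^sup>2\<close>. With \<open>n - 3\<close> further
  entries \<open>1 / D\<close> this gives the exponent \<open>n - 1\<close>. Matrix indices start at
  0, hence \<open>j - 1\<close>.\<close>

lemma abs_jacobian_det: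
  assumes p: "p \<in> tau_index n" and w: "w \<in> Delta n"
  shows "\<bar>jacobian_det n (tau n p) w\<bar> = factor n p w powr -(real n - 1)"
proof -
  obtain A j where pj: "p = (A, j)" "j \<in> {1..n-2}" using p by (rule tau_indexE)
  let ?D = "factor n (A, j) w"
  have D: "0 < ?D" using factor_ge(1)[OF n pj(2) w, of A] by simp
  define m where "m = n - 3"
  have m: "n - 2 = Suc m" "n - 1 = Suc (Suc m)" using n by (auto simp: m_def)
  define M where "M = Matrix.mat (n - 2) (n - 2)
    (\<lambda>(i, k). deriv (\<lambda>t. phi n p (w(Suc k := t)) (Suc i)) (w (Suc k)))"
  have jac: "jacobian_det n (tau n p) w = Determinant.det M"
    by (simp add: jacobian_det_def M_def phi_def[OF n])
  have entry: "M $$ (i, k) =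
      (if skip j (Suc i) = n - 1 then -1 else if skip j (Suc i) = Suc k then 1 else 0) / ?D +
      (if Suc k = j then (real A + 1) * simplex_lift n w (skip j (Suc i)) / ?D\<^sup>2 else 0)"
    if "i \<le> m" "k \<le> m" for i k
  proof -
    have ik: "i < n - 2" "k < n - 2" using that m by auto
    then have "M $$ (i, k) = deriv (\<lambda>t. phi n (A, j) (w(Suc k := t)) (Suc i)) (w (Suc k))"
      unfolding M_def pj(1) by (subst index_mat) simp_all
    also have "\<dots> = (if skip j (Suc i) = n - 1 then -1 else if skip j (Suc i) = Suc k then 1 else 0) / ?D +
      (if Suc k = j then (real A + 1) * simplex_lift n w (skip j (Suc i)) / ?D\<^sup>2 else 0)"
      using ik D by (intro DERIV_imp_deriv phi_has_derivative pj(2)) auto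
    finally show ?thesis .
  qed
  have S: "(\<Sum>i\<le>m. f (skip j (Suc i))) = sum f ({1..n-1} - {j})" for f :: "nat \<Rightarrow> real"
  proof -
    have "(\<Sum>i\<le>m. f (skip j (Suc i))) = (\<Sum>i=1..Suc m. f (skip j i))"
      using sum.shift_bounds_cl_Suc_ivl[of "\<lambda>i. f (skip j i)" 0 m] by (simp add: atMost_atLeast0)
    also have "\<dots> = sum f ({1..Suc (Suc m)} - {j})"
      using pj(2) m by (intro sum_skip) auto
    finally show ?thesis using m by simp
  qed
  have "\<bar>Determinant.det M\<bar> = \<bar>- (1 / ?D\<^sup>2)\<bar> * \<bar>1 / ?D\<bar> ^ m"
  proof (rule abs_det_skip_matrix[where j = "j - 1"])
    show "M \<in> carrier_mat (Suc m) (Suc m)" by (simp add: M_def m)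
    show "j - 1 \<le> m" using pj(2) m by auto
    fix k assume k: "k \<le> m"
    show "M $$ (i, k) = (if k = (if i < j - 1 then i else Suc i) then 1 / ?D else 0)"
      if "i < m" "k \<noteq> j - 1" for i
      using that k pj(2) m by (subst entry) (auto simp: skip_def)
    have in_split: "{1..n-1} - {j} = insert (n - 1) ({1..n-2} - {j})" "n - 1 \<notin> {1..n-2} - {j}"
      using pj(2) m by auto
    have "(\<Sum>l\<in>{1..n-1} - {j}. if l = n - 1 then -1 else if l = Suc k then 1 else 0 :: real) =
        -1 + (\<Sum>l\<in>{1..n-2} - {j}. if l = Suc k then 1 else 0)"
    proof -
      have "(\<Sum>l\<in>{1..n-2} - {j}. if l = n - 1 then -1 else if l = Suc k then 1 else 0 :: real) =
          (\<Sum>l\<in>{1..n-2} - {j}. if l = Suc k then 1 else 0)"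
        by (intro sum.cong) (use m in auto)
      then show ?thesis
        unfolding in_split(1) by (subst sum.insert[OF _ in_split(2)]) (simp, simp only: if_True simp_thms)
    qed
    also have "\<dots> = (if Suc k = j then -1 else 0)" using k m by (simp add: sum.delta')
    finally have 1: "(\<Sum>l\<in>{1..n-1} - {j}. if l = n - 1 then -1 else if l = Suc k then 1 else 0 :: real) =
        (if Suc k = j then -1 else 0)" .
    have "(\<Sum>l=1..n-1. simplex_lift n w l) = simplex_lift n w j + (\<Sum>l\<in>{1..n-1} - {j}. simplex_lift n w l)"
      using pj(2) by (intro sum.remove) auto
    then have 2: "(\<Sum>l\<in>{1..n-1} - {j}. simplex_lift n w l) = 1 - w j"
      using sum_lift[OF n] pj(2) by (simp add: simplex_lift_def)
    have "(\<Sum>i\<le>m. M $$ (i, k)) = (\<Sum>l\<in>{1..n-1} - {j}.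
      (if l = n - 1 then -1 else if l = Suc k then 1 else 0) / ?D +
      (if Suc k = j then (real A + 1) * simplex_lift n w l / ?D\<^sup>2 else 0))"
      unfolding S[symmetric] using k by (intro sum.cong refl entry) auto
    also have "\<dots> = (if Suc k = j then -1 else 0) / ?D +
      (if Suc k = j then (real A + 1) * (1 - w j) / ?D\<^sup>2 else 0)"
    proof -
      have "(\<Sum>l\<in>{1..n-1} - {j}. if Suc k = j then (real A + 1) * simplex_lift n w l / ?D\<^sup>2 else 0) =
          (if Suc k = j then (real A + 1) * (1 - w j) / ?D\<^sup>2 else 0)"
      proof (cases "Suc k = j")
        case True
        show ?thesis unfolding if_P[OF True] by (simp only: 2[symmetric] sum_divide_distrib sum_distrib_left)
      next
        case False
        show ?thesis unfolding if_not_P[OF False] by (rule sum.neutral_const)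
      qed
      then show ?thesis by (simp only: sum.distrib sum_divide_distrib[symmetric] 1)
    qed
    also have "\<dots> = (if k = j - 1 then - (1 / ?D\<^sup>2) else 0)"
    proof (cases "Suc k = j")
      case True
      have "(real A + 1) * (1 - w j) = ?D - 1" by (simp add: factor_formula[OF n pj(2)])
      then show ?thesis using True D by (simp add: divide_simps power2_eq_square)
    next
      case False
      then show ?thesis using pj(2) by auto
    qed
    finally show "(\<Sum>i\<le>m. M $$ (i, k)) = (if k = j - 1 then - (1 / ?D\<^sup>2) else 0)" .
  qed
  also have "\<dots> = 1 / ?D ^ Suc (Suc m)"
    using D by (simp add: power_divide power2_eq_square)
  also have "\<dots> = ?D powr - real (Suc (Suc m))"
    using D by (simp add: powr_minus_divide powr_realpow del: of_nat_Suc power_Suc)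
  also have "real (Suc (Suc m)) = real n - 1" using n m by (simp add: m_def of_nat_diff)
  finally show ?thesis unfolding jac unfolding pj(1) .
qed

abbreviation "conformal_Delta \<equiv> conformal_ifs.conformal (Delta n) (tau_index n) (phi n) (factor n)"

text \<open>\<open>T_Gamma\<close> is a set of maps, so summing over indices instead relies on
  \<open>inj_on_tau\<close>; the exponent \<open>n - 1\<close> of the Jacobian cancels the
  denominator of \<open>b / (n - 1)\<close>.\<close>

lemma conformal_measure_iff: "conformal_measure n b \<nu> \<longleftrightarrow> conformal_Delta b \<nu>"
proof -
  interpret conformal_ifs "Delta n" "tau_index n" "phi n" "factor n" "\<lambda>p. (real (fst p) + 3) / 2" "3/2"
     "3 * (real n - 1) * (real n - 1)" "\<lambda>_. 0" by (rule conformal_ifs_Delta[OF n])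
  have "((\<lambda>g. \<integral>w. f (induced_map n g w) * \<bar>jacobian_det n g w\<bar> powr (b / (real n - 1)) \<partial>\<nu>)
          has_sum x) (T_Gamma n) \<longleftrightarrow>
      ((\<lambda>p. \<integral>w. factor n p w powr -b * f (phi n p w) \<partial>\<nu>) has_sum x) (tau_index n)"
    if sets: "sets \<nu> = sets (restrict_space borel (Delta n))" for f :: "(nat \<Rightarrow> real) \<Rightarrow> real" and x
  proof -
    have sp: "space \<nu> = Delta n" using sets_eq_imp_space_eq[OF sets] by (simp add: space_restrict_space)
    have "(\<integral>w. f (induced_map n (tau n p) w) * \<bar>jacobian_det n (tau n p) w\<bar> powr (b / (real n - 1)) \<partial>\<nu>) =
        (\<integral>w. factor n p w powr -b * f (phi n p w) \<partial>\<nu>)" if p: "p \<in> tau_index n" for p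
    proof (intro Bochner_Integration.integral_cong refl)
      fix w assume "w \<in> space \<nu>"
      then have w: "w \<in> Delta n" by (simp add: sp)
      have "\<bar>jacobian_det n (tau n p) w\<bar> powr (b / (real n - 1)) = factor n p w powr -b"
      proof -
        have "- x * (b / x) = - b" if "x \<noteq> 0" for x :: real using that by simp
        moreover have "real n - 1 \<noteq> 0" using n by simp
        ultimately have "- (real n - 1) * (b / (real n - 1)) = - b" by blast
        then show ?thesis unfolding abs_jacobian_det[OF p w] powr_powr by (simp only:)
      qed
      then show "f (induced_map n (tau n p) w) * \<bar>jacobian_det n (tau n p) w\<bar> powr (b / (real n - 1)) =
          factor n p w powr -b * f (phi n p w)" by (simp add: phi_def[OF n])
    qed
    then show ?thesis
      unfolding T_Gamma_eq has_sum_reindex[OF inj_on_tau[OF n]] comp_def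
      by (intro has_sum_cong) auto
  qed
  then show ?thesis unfolding conformal_measure_def conformal_def by blast
qed

end

section \<open>The tree of Hurwitz solutions\<close>

text \<open>The other root for \<open>a = n\<close> of the quadratic in \<open>x j\<close>, placed
  last because for sorted \<open>x\<close> and \<open>j < n\<close> it is the new maximum; positions
  thus move exactly as in \<open>gamma_map\<close>.\<close>

definition vieta :: "nat \<Rightarrow> nat \<Rightarrow> (nat \<Rightarrow> int) \<Rightarrow> (nat \<Rightarrow> int)" where
  "vieta n j x = (\<lambda>i.
     if 1 \<le> i \<and> i < n then x (skip j i)
     else if i = n then int n * (\<Prod>k\<in>{1..n} - {j}. x k) - x j
     else 0)"

definition sorted_solutions :: "nat \<Rightarrow> (nat \<Rightarrow> int) set" where
  "sorted_solutions n = {x \<in> hurwitz_solutions n (int n).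
     (\<forall>i\<in>{1..n}. 1 \<le> x i) \<and> (\<forall>i\<in>{1..n}. \<forall>j\<in>{1..n}. i \<le> j \<longrightarrow> x i \<le> x j)}"

definition hurwitz_root :: "nat \<Rightarrow> nat \<Rightarrow> int" where
  "hurwitz_root n i = (if i \<in> {1..n} then 1 else 0)"

lemma orbit_append: "orbit \<phi> (\<sigma> @ \<rho>) x = orbit \<phi> \<rho> (orbit \<phi> \<sigma> x)"
  by (induction \<sigma> arbitrary: x) auto

lemma orbit_replicate: "orbit \<phi> (replicate A p) x = (\<phi> p ^^ A) x"
  by (induction A arbitrary: x) (simp_all add: funpow_swap1)

context
  fixes n :: nat
  assumes n: "n \<ge> 3"
begin

lemma sorted_solutionsD:
  assumes "x \<in> sorted_solutions n"
  shows "i \<in> {1..n} \<Longrightarrow> 1 \<le> x i" "1 \<le> i \<Longrightarrow> i \<le> j \<Longrightarrow> j \<le> n \<Longrightarrow> x i \<le> x j"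
    and "i \<notin> {1..n} \<Longrightarrow> x i = 0" "(\<Sum>i=1..n. (x i)\<^sup>2) = int n * (\<Prod>i=1..n. x i)"
  using assms by (auto simp: sorted_solutions_def hurwitz_solutions_def vectors_def)

lemma hurwitz_root_sorted: "hurwitz_root n \<in> sorted_solutions n"
  by (simp add: sorted_solutions_def hurwitz_solutions_def vectors_def hurwitz_root_def)

lemma prod_ge_member:
  fixes x :: "nat \<Rightarrow> int"
  assumes "finite A" "\<And>k. k \<in> A \<Longrightarrow> 1 \<le> x k" "i \<in> A"
  shows "x i \<le> prod x A"
proof -
  have "1 \<le> prod x (A - {i})" using assms by (intro prod_ge_1) auto
  then have "x i * 1 \<le> x i * prod x (A - {i})"
    using assms(2)[OF assms(3)] by (intro mult_left_mono) auto
  then show ?thesis using prod.remove[OF assms(1,3), of x] by simp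
qed

lemma skip_range: "i \<in> {1..n-1} \<Longrightarrow> skip j i \<in> {1..n}"
  by (auto simp: skip_def)

lemma prod_skip_n:
  assumes "j \<in> {1..n}"
  shows "(\<Prod>i=1..n-1. f (skip j i)) = prod f ({1..n} - {j})"
  using prod_skip[of j "n - 1" f] assms n by simp

lemma sum_skip_n:
  assumes "j \<in> {1..n}"
  shows "(\<Sum>i=1..n-1. f (skip j i)) = sum f ({1..n} - {j})"
  using sum_skip[of j "n - 1" f] assms n by simp

lemma split_last: "{1..n} = insert n {1..n-1}" "n \<notin> {1..n-1}"
  using n by auto

lemma vieta_lt: "i \<in> {1..n-1} \<Longrightarrow> vieta n j x i = x (skip j i)"
  by (auto simp: vieta_def)

lemma vieta_n: "vieta n j x n = int n * (\<Prod>k\<in>{1..n} - {j}. x k) - x j"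
  by (simp add: vieta_def)

text \<open>As \<open>j < n\<close>, the entry \<open>x n\<close> is a factor of the product
  \<open>P\<close>, so \<open>P \<ge> x n \<ge> x j\<close> and
  \<open>n P - x j \<ge> 3 P - x n \<ge> 2 x n\<close>.\<close>

lemma vieta_sorted:
  assumes x: "x \<in> sorted_solutions n" and j: "j \<in> {1..n-1}"
  shows "vieta n j x \<in> sorted_solutions n" and "x n < vieta n j x n"
proof -
  note D = sorted_solutionsD[OF x]
  define P where "P = (\<Prod>k\<in>{1..n} - {j}. x k)"
  define Q where "Q = (\<Sum>k\<in>{1..n} - {j}. (x k)\<^sup>2)"
  have jn: "j \<in> {1..n}" "n \<in> {1..n} - {j}" using j n by auto
  have Pn: "x n \<le> P" unfolding P_def using jn D(1) by (intro prod_ge_member) auto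
  have xn: "1 \<le> x n" "x j \<le> x n" using D(1)[of n] D(2)[of j n] j n by auto
  have "3 * P \<le> int n * P" using n Pn xn by (intro mult_right_mono) auto
  then show big: "x n < vieta n j x n" unfolding vieta_n P_def[symmetric] using Pn xn by linarith
  have eq: "(x j)\<^sup>2 + Q = int n * (x j * P)"
    using D(4) sum.remove[OF _ jn(1), of "\<lambda>i. (x i)\<^sup>2"] prod.remove[OF _ jn(1), of x] by (simp add: P_def Q_def)
  have "(\<Sum>i=1..n. (vieta n j x i)\<^sup>2) = (vieta n j x n)\<^sup>2 + (\<Sum>i=1..n-1. (x (skip j i))\<^sup>2)"
    unfolding split_last(1) using split_last(2) by (simp add: vieta_lt)
  also have "\<dots> = (int n * P - x j)\<^sup>2 + Q"
    using sum_skip_n[OF jn(1), of "\<lambda>i. (x i)\<^sup>2"] by (simp add: vieta_n P_def Q_def)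
  also have "\<dots> = int n * ((int n * P - x j) * P)"
    using eq by (simp add: power2_eq_square algebra_simps)
  also have "(int n * P - x j) * P = vieta n j x n * (\<Prod>i=1..n-1. x (skip j i))"
    using prod_skip_n[OF jn(1), of x] by (simp add: vieta_n P_def)
  also have "\<dots> = (\<Prod>i=1..n. vieta n j x i)"
    unfolding split_last(1) using split_last(2) by (simp add: vieta_lt)
  finally have sol: "(\<Sum>i=1..n. (vieta n j x i)\<^sup>2) = int n * (\<Prod>i=1..n. vieta n j x i)" .
  have pos: "1 \<le> vieta n j x i" if "i \<in> {1..n}" for i
  proof (cases "i = n")
    case True
    then show ?thesis using big xn by simp
  next
    case False
    then have "i \<in> {1..n-1}" using that by auto
    then show ?thesis using D(1) skip_range by (simp only: vieta_lt)
  qed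
  have mono: "vieta n j x i \<le> vieta n j x k" if "1 \<le> i" "i \<le> k" "k \<le> n" for i k
  proof (cases "i = n")
    case True
    then show ?thesis using that by simp
  next
    case False
    then have i: "i \<in> {1..n-1}" using that by auto
    show ?thesis
    proof (cases "k = n")
      case True
      then show ?thesis
        using D(2)[of "skip j i" n] skip_range[OF i, of j] big by (simp add: vieta_lt[OF i])
    next
      case False
      then have k: "k \<in> {1..n-1}" using that by auto
      have "x (skip j i) \<le> x (skip j k)"
        using skip_range[OF i, of j] skip_range[OF k, of j] that by (intro D(2)) (auto simp: skip_def)
      then show ?thesis by (simp only: vieta_lt i k)
    qed
  qed
  have "vieta n j x \<in> vectors n" using n by (auto simp: vectors_def vieta_def)
  then show "vieta n j x \<in> sorted_solutions n"
    using sol pos mono by (auto simp: sorted_solutions_def hurwitz_solutions_def)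
qed

text \<open>Vieta descent: the other root \<open>y\<close> of the quadratic in the largest coordinate is at most
  \<open>x (n - 1)\<close>, since the quadratic is nonpositive there.\<close>

lemma descent:
  assumes x: "x \<in> sorted_solutions n" and "x \<noteq> hurwitz_root n"
  shows "\<exists>j\<in>{1..n-1}. \<exists>z\<in>sorted_solutions n. vieta n j z = x \<and> z n < x n"
proof -
  note D = sorted_solutionsD[OF x]
  define R where "R = (\<Prod>i=1..n-2. x i)"
  define Q where "Q = (\<Sum>i=1..n-1. (x i)\<^sup>2)"
  define P where "P = (\<Prod>i=1..n-1. x i)"
  have split: "{1..n-1} = insert (n - 1) {1..n-2}" "n - 1 \<notin> {1..n-2}" using n by auto
  have R: "x i \<le> R" if "i \<in> {1..n-2}" for i
    unfolding R_def using that D(1) by (intro prod_ge_member) auto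
  have x1: "1 \<le> x 1" using D(1)[of 1] n by simp
  have "1 \<in> {1..n-2}" using n by auto
  from R[OF this] have R1: "1 \<le> R" using x1 by linarith
  have PR: "P = x (n - 1) * R" unfolding P_def R_def split(1) using split(2) by simp
  have xn: "1 \<le> x n" and xn1: "1 \<le> x (n - 1)" and le: "x (n - 1) \<le> x n"
    using D(1)[of n] D(1)[of "n - 1"] D(2)[of "n - 1" n] n by auto
  have eq: "(x n)\<^sup>2 + Q = int n * (x n * P)"
    using D(4) unfolding split_last(1) using split_last(2) by (simp add: P_def Q_def)
  have sq: "(x i)\<^sup>2 \<le> (x (n - 1))\<^sup>2" if "i \<in> {1..n-1}" for i
  proof -
    have "1 \<le> i" "i \<le> n - 1" "n - 1 \<le> n" "i \<in> {1..n}" using that by auto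
    then show ?thesis using D(1)[of i] by (intro power_mono D(2)) linarith+
  qed
  have "Q \<le> (\<Sum>i=1..n-1. (x (n - 1))\<^sup>2)" unfolding Q_def by (intro sum_mono sq)
  then have Q: "Q \<le> (int n - 1) * (x (n - 1))\<^sup>2" using n by (simp add: of_nat_diff)
  \<comment> \<open>Equality would give \<open>n R (x n)\<^sup>2 \<le> n (x n)\<^sup>2\<close>, so
    \<open>R = 1\<close>; then all entries but the last two are 1 and the equation leaves
    \<open>(x n)\<^sup>2 = 1\<close>, the root.\<close>
  have lt: "x (n - 1) < x n"
  proof (rule ccontr)
    assume "\<not> x (n - 1) < x n"
    then have e: "x (n - 1) = x n" using le by simp
    have "int n * (R * (x n)\<^sup>2) \<le> int n * (1 * (x n)\<^sup>2)"
      using eq Q unfolding PR e by (simp add: power2_eq_square algebra_simps)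
    then have "R * (x n)\<^sup>2 \<le> 1 * (x n)\<^sup>2" using n by (subst (asm) mult_le_cancel_left_pos) auto
    then have R_eq: "R = 1" using R1 xn by (subst (asm) mult_le_cancel_right_pos) auto
    have one: "x i = 1" if "i \<in> {1..n-2}" for i
      using R[OF that] D(1)[of i] that R_eq by auto
    have "Q = (x n)\<^sup>2 + (\<Sum>i=1..n-2. (x i)\<^sup>2)"
      unfolding Q_def split(1) using split(2) e by simp
    also have "(\<Sum>i=1..n-2. (x i)\<^sup>2) = (\<Sum>i=1..n-2. 1)"
      by (intro sum.cong refl) (simp only: one power_one)
    also have "\<dots> = int n - 2" using n by (simp add: of_nat_diff)
    finally have "(int n - 2) * (x n)\<^sup>2 = (int n - 2) * 1"
      using eq unfolding PR e R_eq by (simp add: power2_eq_square algebra_simps)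
    then have "(x n)\<^sup>2 = 1" using n by (subst (asm) mult_left_cancel) auto
    then have xn_eq: "x n = 1" using xn by (simp add: power2_eq_1_iff)
    have "x i = hurwitz_root n i" for i
    proof (cases "i \<in> {1..n}")
      case True
      then have "x i \<le> 1" "1 \<le> x i" using D(1)[of i] D(2)[of i n] xn_eq by auto
      then show ?thesis using True by (simp add: hurwitz_root_def)
    next
      case False
      then show ?thesis using D(3) by (simp add: hurwitz_root_def)
    qed
    then show False using \<open>x \<noteq> hurwitz_root n\<close> by auto
  qed
  define y where "y = int n * P - x n"
  have yx: "y * x n = Q" using eq by (simp add: y_def power2_eq_square algebra_simps)
  have "1 \<le> (x 1)\<^sup>2" using x1 by simp
  also have "\<dots> \<le> Q" unfolding Q_def using n by (intro member_le_sum) auto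
  finally have "0 < y * x n" using yx by simp
  then have y1: "1 \<le> y" using xn by (simp add: zero_less_mult_iff)
  have "(x (n - 1) - x n) * (x (n - 1) - y) = (x (n - 1))\<^sup>2 - int n * P * x (n - 1) + Q"
    using yx by (simp add: y_def power2_eq_square algebra_simps)
  also have "\<dots> \<le> int n * (x (n - 1))\<^sup>2 - int n * (R * (x (n - 1))\<^sup>2)"
    using Q by (simp add: PR power2_eq_square algebra_simps)
  also have "\<dots> \<le> 0"
  proof -
    have "1 * (x (n - 1))\<^sup>2 \<le> R * (x (n - 1))\<^sup>2" using R1 by (intro mult_right_mono) auto
    then have "int n * (1 * (x (n - 1))\<^sup>2) \<le> int n * (R * (x (n - 1))\<^sup>2)" by (intro mult_left_mono) auto
    then show ?thesis by simp
  qed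
  finally have y_le: "y \<le> x (n - 1)" using lt by (simp add: mult_le_0_iff)
  \<comment> \<open>The first place where \<open>y\<close> fits among the sorted coordinates;
    \<open>y \<le> x (n - 1)\<close> ensures \<open>j \<le> n - 1\<close>, so that
    \<open>vieta n j\<close> undoes the insertion.\<close>
  define j where "j = (LEAST j. 1 \<le> j \<and> y \<le> x j)"
  have ex: "1 \<le> n - 1 \<and> y \<le> x (n - 1)" using y_le n by simp
  have j1: "1 \<le> j" "y \<le> x j" using LeastI[of "\<lambda>j. 1 \<le> j \<and> y \<le> x j", OF ex] by (simp_all add: j_def)
  have jn: "j \<le> n - 1" unfolding j_def by (rule Least_le) (rule ex)
  have below: "x i < y" if "1 \<le> i" "i < j" for i
    using not_less_Least[of i "\<lambda>j. 1 \<le> j \<and> y \<le> x j"] that by (auto simp: j_def)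
  have jI: "j \<in> {1..n}" "j \<in> {1..n-1}" using j1 jn by auto
  define z where "z i = (if 1 \<le> i \<and> i < j then x i else if i = j then y
     else if j < i \<and> i \<le> n then x (i - 1) else 0)" for i
  have z_skip: "z (skip j i) = x i" if "i \<in> {1..n-1}" for i
    using that j1 by (auto simp: z_def skip_def)
  have zj: "z j = y" by (simp add: z_def)
  have prodz: "prod z ({1..n} - {j}) = P"
    unfolding P_def prod_skip_n[OF jI(1), of z, symmetric] by (intro prod.cong refl z_skip)
  have sumz: "(\<Sum>i\<in>{1..n} - {j}. (z i)\<^sup>2) = Q"
    unfolding Q_def sum_skip_n[OF jI(1), of "\<lambda>i. (z i)\<^sup>2", symmetric]
    by (intro sum.cong refl) (simp only: z_skip)
  have "(\<Sum>i=1..n. (z i)\<^sup>2) = y\<^sup>2 + Q"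
    using sum.remove[OF _ jI(1), of "\<lambda>i. (z i)\<^sup>2"] sumz zj by simp
  also have "\<dots> = int n * (y * P)"
    using eq by (simp add: y_def power2_eq_square algebra_simps)
  also have "y * P = (\<Prod>i=1..n. z i)"
    using prod.remove[OF _ jI(1), of z] prodz zj by simp
  finally have sol: "(\<Sum>i=1..n. (z i)\<^sup>2) = int n * (\<Prod>i=1..n. z i)" .
  have zpos: "1 \<le> z i" if "i \<in> {1..n}" for i
  proof (cases "i \<le> j")
    case True
    then show ?thesis using that y1 D(1)[of i] by (auto simp: z_def)
  next
    case False
    then have "i - 1 \<in> {1..n}" using that j1 by auto
    from D(1)[OF this] show ?thesis using False that by (simp add: z_def)
  qed
  have zmono: "z i \<le> z k" if "1 \<le> i" "i \<le> k" "k \<le> n" for i k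
  proof -
    consider "k < j" | "i < j" "k = j" | "i < j" "j < k" | "i = j" "k = j" | "i = j" "j < k" | "j < i"
      using \<open>i \<le> k\<close> by (cases i j rule: linorder_cases; cases k j rule: linorder_cases) simp_all
    then show ?thesis
    proof cases
      case 1
      then show ?thesis using that D(2)[of i k] by (simp add: z_def)
    next
      case 2
      then show ?thesis using that below[of i] by (simp add: z_def)
    next
      case 3
      then have "i \<le> k - 1" "k - 1 \<le> n" using that by auto
      with 3 show ?thesis using that D(2)[of i "k - 1"] by (simp add: z_def)
    next
      case 4
      then show ?thesis by simp
    next
      case 5
      then have "j \<le> k - 1" "k - 1 \<le> n" using that by auto
      then have "y \<le> x (k - 1)" using D(2)[of j "k - 1"] j1 by linarith
      with 5 show ?thesis using that by (simp add: z_def)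
    next
      case 6
      then have "1 \<le> i - 1" "i - 1 \<le> k - 1" "k - 1 \<le> n" using that j1 by auto
      from D(2)[OF this] show ?thesis using 6 that by (simp add: z_def)
    qed
  qed
  have "z \<in> vectors n" using jI j1 by (auto simp: vectors_def z_def)
  then have zs: "z \<in> sorted_solutions n"
    using sol zpos zmono by (auto simp: sorted_solutions_def hurwitz_solutions_def)
  have "vieta n j z = x"
  proof
    fix i
    consider "i \<in> {1..n-1}" | "i = n" | "i \<notin> {1..n}" using n by fastforce
    then show "vieta n j z i = x i"
    proof cases
      case 1
      then show ?thesis by (simp only: vieta_lt z_skip)
    next
      case 2
      show ?thesis unfolding 2 vieta_n prodz zj y_def by simp
    next
      case 3
      then have "\<not> (1 \<le> i \<and> i < n)" "i \<noteq> n" using n by auto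
      then show ?thesis unfolding vieta_def by (simp only: if_False D(3)[OF 3])
    qed
  qed
  moreover have "z n < x n"
  proof -
    have "j < n" using jn n by linarith
    then show ?thesis using lt by (simp add: z_def)
  qed
  ultimately show ?thesis using zs jI(2) by blast
qed

lemma orbit_vieta_sorted:
  assumes "js \<in> lists {1..n-1}" "x \<in> sorted_solutions n"
  shows "orbit (vieta n) js x \<in> sorted_solutions n" and "js \<noteq> [] \<Longrightarrow> x n < orbit (vieta n) js x n"
proof -
  have "orbit (vieta n) js x \<in> sorted_solutions n \<and> x n \<le> orbit (vieta n) js x n \<and>
      (js \<noteq> [] \<longrightarrow> x n < orbit (vieta n) js x n)"
    using assms
  proof (induction js arbitrary: x rule: list.induct)
    case (Cons j js)
    then have j: "j \<in> {1..n-1}" "js \<in> lists {1..n-1}" by auto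
    show ?case using Cons.IH[OF j(2) vieta_sorted(1)[OF Cons.prems(2) j(1)]]
        vieta_sorted(2)[OF Cons.prems(2) j(1)] by auto
  qed auto
  then show "orbit (vieta n) js x \<in> sorted_solutions n" "js \<noteq> [] \<Longrightarrow> x n < orbit (vieta n) js x n" by auto
qed

lemma sorted_solutions_orbit:
  assumes "x \<in> sorted_solutions n"
  shows "\<exists>js\<in>lists {1..n-1}. x = orbit (vieta n) js (hurwitz_root n)"
  using assms
proof (induction "nat (x n)" arbitrary: x rule: less_induct)
  case less
  show ?case
  proof (cases "x = hurwitz_root n")
    case True
    then show ?thesis by (intro bexI[of _ "[]"]) auto
  next
    case False
    then obtain j z where z: "j \<in> {1..n-1}" "z \<in> sorted_solutions n" "vieta n j z = x" "z n < x n"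
      using descent[OF less.prems] by blast
    have "1 \<le> z n" using sorted_solutionsD(1)[OF z(2), of n] n by simp
    then obtain js where "js \<in> lists {1..n-1}" "z = orbit (vieta n) js (hurwitz_root n)"
      using less.hyps[of z] z by auto
    then show ?thesis using z by (intro bexI[of _ "js @ [j]"]) (auto simp: orbit_snoc)
  qed
qed

section \<open>Strictly increasing solutions and injectivity\<close>

text \<open>Two equal coordinates let different moves yield the same solution; strictness removes
  this ambiguity.\<close>

definition "strict_solutions = {x \<in> sorted_solutions n. \<forall>i\<in>{1..n}. \<forall>k\<in>{1..n}. i < k \<longrightarrow> x i < x k}"

lemma strict_solutionsD:
  assumes "x \<in> strict_solutions"
  shows "x \<in> sorted_solutions n" "1 \<le> i \<Longrightarrow> i < k \<Longrightarrow> k \<le> n \<Longrightarrow> x i < x k"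
  using assms by (auto simp: strict_solutions_def)

lemma vieta_strict:
  assumes x: "x \<in> strict_solutions" and j: "j \<in> {1..n-1}"
  shows "vieta n j x \<in> strict_solutions"
proof -
  note S = strict_solutionsD[OF x]
  note V = vieta_sorted[OF S(1) j]
  have "vieta n j x i < vieta n j x k" if "1 \<le> i" "i < k" "k \<le> n" for i k
  proof -
    have i: "i \<in> {1..n-1}" using that by auto
    show ?thesis
    proof (cases "k = n")
      case True
      then show ?thesis
        using sorted_solutionsD(2)[OF S(1), of "skip j i" n] skip_range[OF i, of j] V(2)
        by (simp add: vieta_lt[OF i])
    next
      case False
      then have k: "k \<in> {1..n-1}" using that by auto
      have "x (skip j i) < x (skip j k)"
        using skip_range[OF i, of j] skip_range[OF k, of j] that by (intro S(2)) (auto simp: skip_def)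
      then show ?thesis by (simp only: vieta_lt i k)
    qed
  qed
  then show ?thesis using V(1) by (auto simp: strict_solutions_def)
qed

text \<open>The last entry and the product of the others reveal the omitted value; in a strictly
  increasing sequence its position is then forced.\<close>

lemma vieta_inj:
  assumes x: "x \<in> strict_solutions" and x': "x' \<in> strict_solutions"
    and j: "j \<in> {1..n-1}" and j': "j' \<in> {1..n-1}" and eq: "vieta n j x = vieta n j' x'"
  shows "j = j' \<and> x = x'"
proof -
  note S = strict_solutionsD[OF x] and S' = strict_solutionsD[OF x']
  have skip_eq: "x (skip j i) = x' (skip j' i)" if "i \<in> {1..n-1}" for i
    using fun_cong[OF eq, of i] that by (simp only: vieta_lt)
  have jn: "j \<in> {1..n}" "j' \<in> {1..n}" using j j' by auto
  have "prod x ({1..n} - {j}) = prod x' ({1..n} - {j'})"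
    unfolding prod_skip_n[OF jn(1), symmetric] prod_skip_n[OF jn(2), symmetric]
    by (intro prod.cong refl skip_eq)
  then have v: "x j = x' j'" using fun_cong[OF eq, of n] by (simp add: vieta_n)
  \<comment> \<open>Entry \<open>k\<close> of the common image is \<open>y (Suc k)\<close> on one
    side and \<open>y' k\<close> on the other, giving the absurd chain
    \<open>y k < y (Suc k) = y' k < y' k' = y k\<close>.\<close>
  have no: False if "y \<in> strict_solutions" "y' \<in> strict_solutions" "k \<in> {1..n-1}" "k' \<in> {1..n-1}"
    "y (skip k k) = y' (skip k' k)" "y k = y' k'" "k < k'" for y y' k k'
  proof -
    have k: "1 \<le> k" "Suc k \<le> n" "k' \<le> n" using that(3,4) n by auto
    have "y k < y (Suc k)" using k by (intro strict_solutionsD(2)[OF that(1)]) auto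
    moreover have "y' k < y' k'" using k that(7) by (intro strict_solutionsD(2)[OF that(2)]) auto
    moreover have "y (Suc k) = y' k" using that(5,7) by (simp add: skip_def)
    ultimately show False using that(6) by linarith
  qed
  have "\<not> j < j'" using no[OF x x' j j' skip_eq[OF j] v] by blast
  moreover have "\<not> j' < j" using no[OF x' x j' j skip_eq[OF j', symmetric] v[symmetric]] by blast
  ultimately have jj: "j = j'" by simp
  have "x i = x' i" for i
  proof -
    consider "i = j" | "i \<in> {1..n}" "i < j" | "i \<in> {1..n}" "j < i" | "i \<notin> {1..n}"
      by fastforce
    then show ?thesis
    proof cases
      case 1
      then show ?thesis using v jj by simp
    next
      case 2
      then show ?thesis using skip_eq[of i] j jj by (simp add: skip_def)
    next
      case 3
      then have "i - 1 \<in> {1..n-1}" "skip j (i - 1) = i" "skip j' (i - 1) = i"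
        using j jj by (auto simp: skip_def)
      then show ?thesis using skip_eq[of "i - 1"] by metis
    next
      case 4
      then show ?thesis using sorted_solutionsD(3)[OF S(1) 4] sorted_solutionsD(3)[OF S'(1) 4] by simp
    qed
  qed
  then show ?thesis using jj by auto
qed

lemma orbit_vieta_strict:
  "js \<in> lists {1..n-1} \<Longrightarrow> x \<in> strict_solutions \<Longrightarrow> orbit (vieta n) js x \<in> strict_solutions"
proof (induction js arbitrary: x rule: list.induct)
  case (Cons j js)
  then have "j \<in> {1..n-1}" "js \<in> lists {1..n-1}" by auto
  then show ?case using Cons.IH vieta_strict[OF Cons.prems(2)] by (simp del: lists_eq_set)
qed simp

text \<open>Words are read from the right: \<open>vieta_inj\<close> recovers the last move, and
  growth of the last coordinate separates empty from nonempty words.\<close>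

lemma inj_on_orbit_vieta:
  assumes x: "x \<in> strict_solutions"
  shows "inj_on (\<lambda>js. orbit (vieta n) js x) (lists {1..n-1})"
proof (rule inj_onI)
  fix u v assume "u \<in> lists {1..n-1}" "v \<in> lists {1..n-1}" "orbit (vieta n) u x = orbit (vieta n) v x"
  then show "u = v"
  proof (induction u arbitrary: v rule: rev_induct)
    case Nil
    then show ?case using orbit_vieta_sorted(2)[OF Nil(2) strict_solutionsD(1)[OF x]] by fastforce
  next
    case (snoc j u)
    show ?case
    proof (cases v rule: rev_cases)
      case Nil
      then show ?thesis
        using snoc.prems orbit_vieta_sorted(2)[OF snoc.prems(1) strict_solutionsD(1)[OF x]] by simp
    next
      case (snoc v' j')
      have uv: "u \<in> lists {1..n-1}" "v' \<in> lists {1..n-1}" "j \<in> {1..n-1}" "j' \<in> {1..n-1}"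
        using snoc.prems(1,2) \<open>v = v' @ [j']\<close> by auto
      have "vieta n j (orbit (vieta n) u x) = vieta n j' (orbit (vieta n) v' x)"
        using snoc.prems(3) \<open>v = v' @ [j']\<close> by (simp add: orbit_snoc)
      then have "j = j' \<and> orbit (vieta n) u x = orbit (vieta n) v' x"
        using uv x by (intro vieta_inj orbit_vieta_strict) auto
      then show ?thesis using snoc.IH[OF uv(1,2)] \<open>v = v' @ [j']\<close> by simp
    qed
  qed
qed

text \<open>Iterating the first Vieta map replaces the ones of the root by a strictly increasing sequence.\<close>

lemma strict_solutions_nonempty: "strict_solutions \<noteq> {}"
proof -
  have one: "1 \<in> {1..n-1}" using n by auto
  have "(vieta n 1 ^^ k) (hurwitz_root n) \<in> sorted_solutions n \<and>
      (\<forall>i l. 1 \<le> i \<longrightarrow> n - k \<le> i \<longrightarrow> i < l \<longrightarrow> l \<le> n \<longrightarrow> (vieta n 1 ^^ k) (hurwitz_root n) i < (vieta n 1 ^^ k) (hurwitz_root n) l)" for k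
  proof (induction k)
    case 0
    then show ?case using hurwitz_root_sorted by simp
  next
    case (Suc k)
    define x where "x = (vieta n 1 ^^ k) (hurwitz_root n)"
    have x: "x \<in> sorted_solutions n"
      and strict: "\<And>i l. 1 \<le> i \<Longrightarrow> n - k \<le> i \<Longrightarrow> i < l \<Longrightarrow> l \<le> n \<Longrightarrow> x i < x l"
      using Suc by (auto simp: x_def)
    note V = vieta_sorted[OF x one]
    have "vieta n 1 x i < vieta n 1 x l" if "1 \<le> i" "n - Suc k \<le> i" "i < l" "l \<le> n" for i l
    proof -
      have i: "i \<in> {1..n-1}" using that by auto
      have si: "vieta n 1 x i = x (Suc i)" using vieta_lt[OF i, of 1 x] that by (simp add: skip_def)
      show ?thesis
      proof (cases "l = n")
        case True
        then show ?thesis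
          using sorted_solutionsD(2)[OF x, of "Suc i" n] V(2) that unfolding si True by linarith
      next
        case False
        then have l: "l \<in> {1..n-1}" using that by auto
        have "vieta n 1 x l = x (Suc l)" using vieta_lt[OF l, of 1 x] that by (simp add: skip_def)
        then show ?thesis using strict[of "Suc i" "Suc l"] that l unfolding si by simp
      qed
    qed
    then show ?case using V(1) by (simp add: x_def)
  qed
  from this[of n] have "(vieta n 1 ^^ n) (hurwitz_root n) \<in> strict_solutions"
    by (simp add: strict_solutions_def)
  then show ?thesis by blast
qed

text \<open>A nonzero solution has positive sum of squares, hence positive product: no coordinate
  vanishes, and the absolute values again form a solution. The map \<open>p\<close> records where
  each of them stands after sorting, which bounds the number of solutions over one
  \<open>z\<close>.\<close>

lemma sorted_representative:
  assumes x: "x \<in> hurwitz_solutions n (int n)" and nz: "x \<noteq> (\<lambda>_. 0)"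
  shows "\<exists>z\<in>sorted_solutions n. (\<exists>k\<in>{1..n}. z n = \<bar>x k\<bar>) \<and>
    (\<exists>p\<in>{1..n} \<rightarrow>\<^sub>E {1..n}. \<forall>i\<in>{1..n}. \<bar>x i\<bar> = z (p i))"
proof -
  have eq: "(\<Sum>i=1..n. (x i)\<^sup>2) = int n * (\<Prod>i=1..n. x i)" and x0: "\<And>i. i \<notin> {1..n} \<Longrightarrow> x i = 0"
    using x by (auto simp: hurwitz_solutions_def vectors_def)
  have "\<exists>i\<in>{1..n}. x i \<noteq> 0" using nz x0 by (metis ext)
  then have "0 < (\<Sum>i=1..n. (x i)\<^sup>2)" by (auto intro!: sum_pos2)
  then have P: "0 < (\<Prod>i=1..n. x i)" using eq n by (simp add: zero_less_mult_iff)
  then have ne: "x i \<noteq> 0" if "i \<in> {1..n}" for i using that by (metis finite_atLeastAtMost less_irrefl prod_zero)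
  have absP: "(\<Prod>i=1..n. \<bar>x i\<bar>) = (\<Prod>i=1..n. x i)" using P by (simp flip: abs_prod)
  define l where "l = map (\<lambda>i. \<bar>x i\<bar>) [1..<Suc n]"
  define zs where "zs = sort l"
  have len: "length zs = n" by (simp add: zs_def l_def)
  have set: "set zs = (\<lambda>i. \<bar>x i\<bar>) ` {1..n}" by (auto simp: zs_def l_def)
  define z where "z i = (if i \<in> {1..n} then zs ! (i - 1) else 0)" for i
  have z_in: "z i \<in> set zs" if "i \<in> {1..n}" for i
    using that len by (auto simp: z_def intro!: nth_mem)
  have map_z: "map z [1..<Suc n] = zs"
    by (rule nth_equalityI) (simp_all add: len z_def del: upt_Suc)
  have mset: "mset (map z [1..<Suc n]) = mset l" unfolding map_z zs_def by simp
  have sum_l: "(\<Sum>i=1..n. f (z i)) = (\<Sum>i=1..n. f \<bar>x i\<bar>)" for f :: "int \<Rightarrow> int"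
  proof -
    have "(\<Sum>i=1..n. f (y i)) = sum_mset (image_mset f (mset (map y [1..<Suc n])))" for y :: "nat \<Rightarrow> int"
      by (simp add: sum_mset_sum_list interv_sum_list_conv_sum_set_nat atLeastLessThanSuc_atLeastAtMost comp_def flip: mset_map del: upt_Suc)
    then show ?thesis using mset unfolding l_def by simp
  qed
  have prod_l: "(\<Prod>i=1..n. z i) = (\<Prod>i=1..n. \<bar>x i\<bar>)"
  proof -
    have "(\<Prod>i=1..n. y i) = prod_mset (mset (map y [1..<Suc n]))" for y :: "nat \<Rightarrow> int"
      by (simp add: prod_mset_prod_list prod.distinct_set_conv_list[symmetric] atLeastLessThanSuc_atLeastAtMost del: upt_Suc mset_map)
    then show ?thesis using mset unfolding l_def by simp
  qed
  have "z \<in> vectors n" by (auto simp: vectors_def z_def)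
  moreover have "(\<Sum>i=1..n. (z i)\<^sup>2) = int n * (\<Prod>i=1..n. z i)"
    using eq unfolding sum_l[of "\<lambda>t. t\<^sup>2"] prod_l absP by simp
  moreover have "1 \<le> z i" if "i \<in> {1..n}" for i
    using z_in[OF that] ne unfolding set by force
  moreover have "z i \<le> z k" if "i \<in> {1..n}" "k \<in> {1..n}" "i \<le> k" for i k
    using that len sorted_nth_mono[of zs "i - 1" "k - 1"] by (simp add: z_def zs_def)
  ultimately have zS: "z \<in> sorted_solutions n" by (auto simp: sorted_solutions_def hurwitz_solutions_def)
  have "\<exists>k\<in>{1..n}. \<bar>x i\<bar> = z k" if "i \<in> {1..n}" for i
  proof -
    have "\<bar>x i\<bar> \<in> set zs" using that set by auto
    then obtain m where "m < n" "zs ! m = \<bar>x i\<bar>" using len by (auto simp: in_set_conv_nth)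
    then show ?thesis by (intro bexI[of _ "Suc m"]) (auto simp: z_def)
  qed
  then obtain p where p: "\<And>i. i \<in> {1..n} \<Longrightarrow> p i \<in> {1..n} \<and> \<bar>x i\<bar> = z (p i)" by metis
  then have "restrict p {1..n} \<in> {1..n} \<rightarrow>\<^sub>E {1..n}" by auto
  then show "\<exists>z\<in>sorted_solutions n. (\<exists>k\<in>{1..n}. z n = \<bar>x k\<bar>) \<and>
    (\<exists>p\<in>{1..n} \<rightarrow>\<^sub>E {1..n}. \<forall>i\<in>{1..n}. \<bar>x i\<bar> = z (p i))"
  proof (intro bexI[of _ z] conjI bexI[of _ "restrict p {1..n}"] zS)
    have "z n \<in> set zs" using n by (intro z_in) auto
    then show "\<exists>k\<in>{1..n}. z n = \<bar>x k\<bar>" unfolding set by blast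
  qed (use p in auto)
qed

end

section \<open>Comparison of the tree with the linear maps\<close>

text \<open>
  With \<open>c\<^sup>n\<^sup>-\<^sup>2 = d\<close> the substitution \<open>y\<^sub>i = ln (c x\<^sub>i)\<close> turns \<open>x\<^sub>j \<mapsto> d \<Prod>\<^sub>k\<^sub>\<noteq>\<^sub>j x\<^sub>k\<close> into
  \<open>y\<^sub>j \<mapsto> \<Sum>\<^sub>k\<^sub>\<noteq>\<^sub>j y\<^sub>k\<close>.  The Vieta move lies between the cases \<open>d = n / 2\<close> and \<open>d = n\<close>.
\<close>

definition loglift :: "nat \<Rightarrow> real \<Rightarrow> (nat \<Rightarrow> int) \<Rightarrow> nat \<Rightarrow> real" where
  "loglift n c x i = (if i \<in> {1..n} then ln (c * real_of_int (x i)) else 0)"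

definition block :: "nat \<Rightarrow> nat \<times> nat \<Rightarrow> nat list" where
  "block n p = snd p # replicate (fst p) (n - 1)"

text \<open>The initial run of \<open>n - 1\<close> is the part that \<open>T_Gamma\<close> does not
  see: a block begins with a letter at most \<open>n - 2\<close>.\<close>

definition word :: "nat \<Rightarrow> nat \<times> (nat \<times> nat) list \<Rightarrow> nat list" where
  "word n q = replicate (fst q) (n - 1) @ concat (map (block n) (snd q))"

lemma powr_inverse_power:
  assumes "0 < a" "0 < m"
  shows "(a powr (1 / real m)) ^ m = a"
proof -
  have "(a powr (1 / real m)) ^ m = (a powr (1 / real m)) powr real m"
    using assms by (intro powr_realpow[symmetric]) simp
  also have "\<dots> = a" using assms by (simp add: powr_powr)
  finally show ?thesis .
qed

lemma orbit_blocks: "orbit (gamma_map n) (concat (map (block n) \<sigma>)) y = orbit (tau n) \<sigma> y"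
  by (induction \<sigma> arbitrary: y) (simp_all add: block_def orbit_append orbit_replicate tau_def)

lemma replicate_append_inj:
  assumes "replicate A a @ r = replicate A' a @ r'" "r = [] \<or> hd r \<noteq> a" "r' = [] \<or> hd r' \<noteq> a"
  shows "A = A' \<and> r = r'"
  using assms
proof (induction A arbitrary: A')
  case 0
  then show ?case by (cases A') auto
next
  case (Suc A)
  then show ?case by (cases A') auto
qed

lemma finite_int_box: "finite {x \<in> vectors n. \<forall>i\<in>{1..n}. \<bar>real_of_int (x i)\<bar> \<le> R}"
proof (rule finite_subset)
  show "finite ((\<lambda>f i. if i \<in> {1..n} then f i else 0) ` ({1..n} \<rightarrow>\<^sub>E {-\<lfloor>R\<rfloor>..\<lfloor>R\<rfloor>}))"
    by (intro finite_imageI finite_PiE) auto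
  show "{x \<in> vectors n. \<forall>i\<in>{1..n}. \<bar>real_of_int (x i)\<bar> \<le> R} \<subseteq>
      (\<lambda>f i. if i \<in> {1..n} then f i else 0) ` ({1..n} \<rightarrow>\<^sub>E {-\<lfloor>R\<rfloor>..\<lfloor>R\<rfloor>})"
  proof
    fix x :: "nat \<Rightarrow> int" assume x: "x \<in> {x \<in> vectors n. \<forall>i\<in>{1..n}. \<bar>real_of_int (x i)\<bar> \<le> R}"
    have "x i \<in> {-\<lfloor>R\<rfloor>..\<lfloor>R\<rfloor>}" if "i \<in> {1..n}" for i
    proof -
      have "real_of_int \<bar>x i\<bar> \<le> R" using x that by simp
      then have "\<bar>x i\<bar> \<le> \<lfloor>R\<rfloor>" by (simp only: le_floor_iff)
      then show ?thesis by auto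
    qed
    then have 1: "restrict x {1..n} \<in> {1..n} \<rightarrow>\<^sub>E {-\<lfloor>R\<rfloor>..\<lfloor>R\<rfloor>}" by auto
    have 2: "x = (\<lambda>i. if i \<in> {1..n} then restrict x {1..n} i else 0)"
      using x by (auto simp: vectors_def)
    show "x \<in> (\<lambda>f i. if i \<in> {1..n} then f i else 0) ` ({1..n} \<rightarrow>\<^sub>E {-\<lfloor>R\<rfloor>..\<lfloor>R\<rfloor>})"
      by (rule image_eqI[where x = "restrict x {1..n}"], rule 2, rule 1)
  qed
qed

text \<open>Rankin's trick: for \<open>c x \<le> X\<close> the quantity
  \<open>X powr s * c x powr -s\<close> is at least 1.\<close>

lemma markov_card:
  fixes c :: "'a \<Rightarrow> real"
  assumes pos: "\<And>x. x \<in> A \<Longrightarrow> 0 < c x" and s: "0 \<le> s"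
    and bound: "\<And>F. finite F \<Longrightarrow> F \<subseteq> A \<Longrightarrow> (\<Sum>x\<in>F. c x powr -s) \<le> S" and X: "0 \<le> X"
  shows "finite {x \<in> A. c x \<le> X}" "real (card {x \<in> A. c x \<le> X}) \<le> X powr s * S"
proof -
  have 1: "real (card F) \<le> X powr s * S" if F: "finite F" "F \<subseteq> {x \<in> A. c x \<le> X}" for F
  proof -
    have "real (card F) = (\<Sum>x\<in>F. 1)" by simp
    also have "\<dots> \<le> (\<Sum>x\<in>F. X powr s * c x powr -s)"
    proof (rule sum_mono)
      fix x assume "x \<in> F"
      then have x: "0 < c x" "c x \<le> X" using F pos by auto
      have "1 = c x powr s * c x powr -s" using x by (simp flip: powr_add)
      also have "\<dots> \<le> X powr s * c x powr -s" using x s by (intro mult_right_mono powr_mono2) auto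
      finally show "1 \<le> X powr s * c x powr -s" .
    qed
    also have "\<dots> \<le> X powr s * S"
      unfolding sum_distrib_left[symmetric] using F by (intro mult_left_mono bound) auto
    finally show ?thesis .
  qed
  have S0: "0 \<le> S" using bound[of "{}"] by simp
  have "card F \<le> nat \<lfloor>X powr s * S\<rfloor>" if "F \<subseteq> {x \<in> A. c x \<le> X}" "finite F" for F
    using 1[OF that(2,1)] by (simp add: le_nat_floor)
  then show "finite {x \<in> A. c x \<le> X}" by (rule finite_if_finite_subsets_card_bdd[THEN conjunct1]) 
  then show "real (card {x \<in> A. c x \<le> X}) \<le> X powr s * S" by (intro 1) auto
qed

text \<open>On the dyadic level \<open>m\<close> there are at most
  \<open>K * (2 * 2 ^ m) powr t\<close> elements, each contributing at most
  \<open>(2 ^ m) powr -b\<close>; as \<open>t < b\<close>, the levels form a geometric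
  series.\<close>

lemma sum_powr_le_of_counting:
  fixes c :: "'a \<Rightarrow> real"
  assumes c: "\<And>x. x \<in> A \<Longrightarrow> 1 \<le> c x" and t: "0 < t" "t < b" and K: "0 \<le> K"
    and count: "\<And>X. 1 \<le> X \<Longrightarrow> finite {x \<in> A. c x \<le> X} \<and> real (card {x \<in> A. c x \<le> X}) \<le> K * X powr t"
    and F: "finite F" "F \<subseteq> A"
  shows "(\<Sum>x\<in>F. c x powr -b) \<le> (\<Sum>m. K * 2 powr t * (2 powr (t - b)) ^ m)"
proof -
  define lev where "lev x = nat \<lfloor>log 2 (c x)\<rfloor>" for x
  have lev: "2 ^ lev x \<le> c x" "c x \<le> 2 * 2 ^ lev x" if "x \<in> A" for x
  proof -
    have "0 \<le> log 2 (c x)" using c[OF that] by simp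
    then have "real (lev x) \<le> log 2 (c x)" "log 2 (c x) \<le> real (lev x) + 1"
      unfolding lev_def by linarith+
    then have "2 powr real (lev x) \<le> c x" "c x \<le> 2 powr (real (lev x) + 1)"
      using c[OF that] by (auto simp: le_log_iff log_le_iff)
    then show "2 ^ lev x \<le> c x" "c x \<le> 2 * 2 ^ lev x"
      by (simp_all add: powr_realpow powr_add)
  qed
  define r where "r = (2::real) powr (t - b)"
  have r: "0 < r" "r < 1" using t by (auto simp: r_def powr_less_one)
  have level: "(\<Sum>x | x \<in> F \<and> lev x = m. c x powr -b) \<le> K * 2 powr t * r ^ m" for m
  proof -
    have "(\<Sum>x | x \<in> F \<and> lev x = m. c x powr -b) \<le> (\<Sum>x | x \<in> F \<and> lev x = m. (2 ^ m) powr -b)"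
      using F lev t by (intro sum_mono powr_mono2') auto
    also have "\<dots> = real (card {x \<in> F. lev x = m}) * (2 ^ m) powr -b" by simp
    also have "\<dots> \<le> (K * (2 * 2 ^ m) powr t) * (2 ^ m) powr -b"
    proof (rule mult_right_mono)
      have "1 \<le> 2 * (2::real) ^ m" using one_le_power[of "2::real" m] by linarith
      from count[OF this] have fin: "finite {x \<in> A. c x \<le> 2 * 2 ^ m}"
        and cd: "real (card {x \<in> A. c x \<le> 2 * 2 ^ m}) \<le> K * (2 * 2 ^ m) powr t" by auto
      have "card {x \<in> F. lev x = m} \<le> card {x \<in> A. c x \<le> 2 * 2 ^ m}"
        using F lev by (intro card_mono fin) auto
      then show "real (card {x \<in> F. lev x = m}) \<le> K * (2 * 2 ^ m) powr t" using cd by linarith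
    qed simp
    also have "\<dots> = K * 2 powr t * r ^ m"
    proof -
      have "(2 ^ m) powr t * (2 ^ m) powr -b = (2 ^ m :: real) powr (t - b)"
        by (simp flip: powr_add)
      also have "\<dots> = r ^ m"
        unfolding r_def by (simp add: powr_powr powr_realpow[symmetric] mult.commute)
      finally show ?thesis by (simp add: powr_mult)
    qed
    finally show ?thesis .
  qed
  have "(\<Sum>x\<in>F. c x powr -b) = (\<Sum>m\<in>lev ` F. \<Sum>x | x \<in> F \<and> lev x = m. c x powr -b)"
    using F(1) by (intro sum.group[symmetric]) auto
  also have "\<dots> \<le> (\<Sum>m\<in>lev ` F. K * 2 powr t * r ^ m)" by (intro sum_mono level)
  also have "\<dots> \<le> (\<Sum>m. K * 2 powr t * r ^ m)"
    using F(1) r K by (intro sum_le_suminf summable_mult summable_geometric) auto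
  finally show ?thesis unfolding r_def .
qed

context
  fixes n :: nat
  assumes n: "n \<ge> 3"
begin

section \<open>Coding by words and logarithmic comparison\<close>

text \<open>Unique decoding: a block consists of a letter at most \<open>n - 2\<close> and a run of
  \<open>n - 1\<close>, so the next smaller letter marks its end.\<close>

lemma inj_on_blocks: "inj_on (\<lambda>\<sigma>. concat (map (block n) \<sigma>)) (lists (tau_index n))"
proof (rule inj_onI)
  have hd: "concat (map (block n) \<sigma>) = [] \<or> hd (concat (map (block n) \<sigma>)) \<noteq> n - 1"
    if "\<sigma> \<in> lists (tau_index n)" for \<sigma>
    using that n by (cases \<sigma>) (auto simp: block_def tau_index_def)
  fix \<sigma> \<rho> assume "\<sigma> \<in> lists (tau_index n)" "\<rho> \<in> lists (tau_index n)"
    "concat (map (block n) \<sigma>) = concat (map (block n) \<rho>)"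
  then show "\<sigma> = \<rho>"
  proof (induction \<sigma> arbitrary: \<rho> rule: list.induct)
    case Nil
    then show ?case by (cases \<rho>) (auto simp: block_def)
  next
    case (Cons p \<sigma>)
    show ?case
    proof (cases \<rho>)
      case Nil
      then show ?thesis using Cons.prems by (simp add: block_def)
    next
      case (Cons p' \<rho>')
      have mem: "\<sigma> \<in> lists (tau_index n)" "\<rho>' \<in> lists (tau_index n)"
        using Cons.prems(1,2) \<open>\<rho> = p' # \<rho>'\<close> by auto
      have "snd p = snd p'" and
        "replicate (fst p) (n - 1) @ concat (map (block n) \<sigma>) = replicate (fst p') (n - 1) @ concat (map (block n) \<rho>')"
        using Cons.prems(3) \<open>\<rho> = p' # \<rho>'\<close> by (simp_all add: block_def[of n p] block_def[of n p'])
      with replicate_append_inj[OF this(2) hd[OF mem(1)] hd[OF mem(2)]]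
      show ?thesis using Cons.IH[OF mem] \<open>\<rho> = p' # \<rho>'\<close> by (simp add: prod_eq_iff)
    qed
  qed
qed

lemma blocks_in_lists:
  assumes "\<sigma> \<in> lists (tau_index n)"
  shows "concat (map (block n) \<sigma>) \<in> lists {1..n-1}"
  using assms n by (fastforce simp: block_def tau_index_def)

lemma ex_word:
  assumes "js \<in> lists {1..n-1}"
  shows "\<exists>A \<sigma>. \<sigma> \<in> lists (tau_index n) \<and> js = word n (A, \<sigma>)"
  using assms
proof (induction js rule: list.induct)
  case Nil
  then show ?case by (intro exI[of _ 0] exI[of _ "[]"]) (simp add: word_def)
next
  case (Cons j js)
  then obtain A \<sigma> where *: "\<sigma> \<in> lists (tau_index n)" "js = word n (A, \<sigma>)" by auto
  show ?case
  proof (cases "j = n - 1")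
    case True
    then show ?thesis using * by (intro exI[of _ "Suc A"] exI[of _ \<sigma>]) (simp add: word_def)
  next
    case False
    then have "(A, j) \<in> tau_index n" using Cons.prems by (auto simp: tau_index_def)
    then show ?thesis using *
      by (intro exI[of _ 0] exI[of _ "(A, j) # \<sigma>"]) (simp add: word_def block_def)
  qed
qed

lemma orbit_gamma_mono:
  assumes "js \<in> lists {1..n-1}" "\<And>i. i \<in> {1..n} \<Longrightarrow> x i \<le> y i" "i \<in> {1..n}"
  shows "orbit (gamma_map n) js x i \<le> orbit (gamma_map n) js y i"
  using assms(1,2)
proof (induction js arbitrary: x y rule: list.induct)
  case Nil
  then show ?case using assms(3) by simp
next
  case (Cons j js)
  have "gamma_map n j x k \<le> gamma_map n j y k" if "k \<in> {1..n}" for k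
    using Cons.prems that by (intro gamma_map_mono) auto
  then show ?case using Cons.IH[of "gamma_map n j x" "gamma_map n j y"] Cons.prems(1) by simp
qed

lemma orbit_gamma_scale: "orbit (gamma_map n) js (\<lambda>i. a * x i) = (\<lambda>i. a * orbit (gamma_map n) js x i)"
proof (induction js arbitrary: x)
  case (Cons j js)
  have "gamma_map n j (\<lambda>i. a * x i) = (\<lambda>i. a * gamma_map n j x i)"
    using gamma_map_linear[of n j a x 0 x] by simp
  then show ?case using Cons by simp
qed simp

lemma gamma_loglift_n:
  assumes x: "x \<in> sorted_solutions n" and j: "j \<in> {1..n-1}" and c: "0 < c"
  shows "gamma_map n j (loglift n c x) n = ln (c * (c ^ (n - 2) * real_of_int (\<Prod>k\<in>{1..n} - {j}. x k)))"
proof -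
  have x1: "0 < real_of_int (x k)" if "k \<in> {1..n}" for k
    using sorted_solutionsD(1)[OF n x that] by simp
  have "\<not> (1 \<le> n \<and> n < j)" "\<not> (j \<le> n \<and> n < n)" using j by auto
  then have "gamma_map n j (loglift n c x) n = (\<Sum>k\<in>{1..n} - {j}. loglift n c x k)"
    unfolding gamma_map_def by (simp only: if_False if_True simp_thms)
  also have "\<dots> = (\<Sum>k\<in>{1..n} - {j}. ln (c * real_of_int (x k)))"
    by (intro sum.cong) (auto simp: loglift_def)
  also have "\<dots> = ln (\<Prod>k\<in>{1..n} - {j}. c * real_of_int (x k))"
  proof (rule ln_prod[symmetric])
    fix k assume "k \<in> {1..n} - {j}"
    then have "0 < c * real_of_int (x k)" using c x1[of k] by (intro mult_pos_pos) auto
    then show "c * real_of_int (x k) \<noteq> 0" by (rule less_imp_neq[symmetric])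
  qed simp
  also have "(\<Prod>k\<in>{1..n} - {j}. c * real_of_int (x k)) = c ^ (n - 1) * real_of_int (\<Prod>k\<in>{1..n} - {j}. x k)"
  proof -
    have "card ({1..n} - {j}) = n - 1" using j by (subst card_Diff_singleton) auto
    then show ?thesis by (simp add: prod.distrib)
  qed
  also have "c ^ (n - 1) = c * c ^ (n - 2)"
  proof -
    have "n - 1 = Suc (n - 2)" using n by auto
    then show ?thesis by simp
  qed
  finally show ?thesis by (simp only: mult.assoc)
qed

lemma gamma_loglift_lt:
  assumes "i \<in> {1..n-1}" "j \<in> {1..n-1}"
  shows "gamma_map n j (loglift n c x) i = loglift n c (vieta n j x) i"
proof -
  have "gamma_map n j (loglift n c x) i = loglift n c x (skip j i)"
    using assms unfolding gamma_map_def skip_def by auto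
  also have "\<dots> = loglift n c (vieta n j x) i"
    using assms skip_range[OF n assms(1), of j] unfolding loglift_def vieta_lt[OF n assms(1)] by auto
  finally show ?thesis .
qed

text \<open>\<open>x n\<close> is a factor of \<open>P\<close>, so
  \<open>x j \<le> x n \<le> P\<close>, and subtracting \<open>x j\<close> costs at most half of
  \<open>n P\<close>.\<close>

lemma vieta_n_bounds:
  assumes x: "x \<in> sorted_solutions n" and j: "j \<in> {1..n-1}"
  defines "P \<equiv> real_of_int (\<Prod>k\<in>{1..n} - {j}. x k)"
  shows "real n / 2 * P \<le> real_of_int (vieta n j x n)" "real_of_int (vieta n j x n) \<le> real n * P" "1 \<le> P"
proof -
  note D = sorted_solutionsD[OF n x]
  let ?P = "\<Prod>k\<in>{1..n} - {j}. x k"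
  have "x n \<le> ?P" using D(1) j n by (intro prod_ge_member[OF n]) auto
  moreover have "1 \<le> x j" "x j \<le> x n" using D(1)[of j] D(2)[of j n] j by auto
  ultimately have "1 \<le> x j" "x j \<le> ?P" by linarith+
  then have xj: "1 \<le> real_of_int (x j)" "real_of_int (x j) \<le> P" unfolding P_def by linarith+
  then show "1 \<le> P" by simp
  have v: "real_of_int (vieta n j x n) = real n * P - real_of_int (x j)"
    unfolding vieta_n[OF n] P_def by simp
  then show "real_of_int (vieta n j x n) \<le> real n * P" using xj by simp
  have "3 / 2 * P \<le> real n / 2 * P" using n xj by (intro mult_right_mono) auto
  then show "real n / 2 * P \<le> real_of_int (vieta n j x n)" unfolding v using xj by argo
qed

lemma loglift_step_lower:
  assumes x: "x \<in> sorted_solutions n" and j: "j \<in> {1..n-1}" and c: "0 < c" "c ^ (n - 2) = real n / 2"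
    and i: "i \<in> {1..n}"
  shows "gamma_map n j (loglift n c x) i \<le> loglift n c (vieta n j x) i"
proof (cases "i = n")
  case True
  define P where "P = real_of_int (\<Prod>k\<in>{1..n} - {j}. x k)"
  note B = vieta_n_bounds[OF x j, folded P_def]
  have "ln (c * (real n / 2 * P)) \<le> ln (c * real_of_int (vieta n j x n))"
    using c B n by (subst ln_le_cancel_iff) (auto intro!: mult_pos_pos mult_left_mono B intro: less_le_trans[OF _ B(1)])
  then show ?thesis
    unfolding True gamma_loglift_n[OF x j c(1)] c(2) P_def[symmetric] using n by (simp add: loglift_def)
next
  case False
  then have "i \<in> {1..n-1}" using i by auto
  then show ?thesis using gamma_loglift_lt[OF _ j] by simp
qed

lemma loglift_step_upper:
  assumes x: "x \<in> sorted_solutions n" and j: "j \<in> {1..n-1}" and c: "0 < c" "c ^ (n - 2) = real n"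
    and i: "i \<in> {1..n}"
  shows "loglift n c (vieta n j x) i \<le> gamma_map n j (loglift n c x) i"
proof (cases "i = n")
  case True
  define P where "P = real_of_int (\<Prod>k\<in>{1..n} - {j}. x k)"
  note B = vieta_n_bounds[OF x j, folded P_def]
  have "0 < real n / 2 * P" using n B(3) by (intro mult_pos_pos) auto
  then have "0 < real_of_int (vieta n j x n)" using B(1) by linarith
  then have "ln (c * real_of_int (vieta n j x n)) \<le> ln (c * (real n * P))"
    using c B n by (intro ln_mono mult_left_mono) auto
  then show ?thesis
    unfolding True gamma_loglift_n[OF x j c(1)] c(2) P_def[symmetric] using n by (simp add: loglift_def)
next
  case False
  then have "i \<in> {1..n-1}" using i by auto
  then show ?thesis using gamma_loglift_lt[OF _ j] by simp
qed

text \<open>Monotonicity of the linear maps propagates the one-step comparison along the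
  word.\<close>

lemma loglift_orbit_lower:
  assumes c: "0 < c" "c ^ (n - 2) = real n / 2"
    and js: "js \<in> lists {1..n-1}" and x: "x \<in> sorted_solutions n" and i: "i \<in> {1..n}"
  shows "orbit (gamma_map n) js (loglift n c x) i \<le> loglift n c (orbit (vieta n) js x) i"
  using js x
proof (induction js arbitrary: x rule: list.induct)
  case (Cons j js)
  then have j: "j \<in> {1..n-1}" "js \<in> lists {1..n-1}" by auto
  have "orbit (gamma_map n) js (gamma_map n j (loglift n c x)) i \<le> orbit (gamma_map n) js (loglift n c (vieta n j x)) i"
    by (rule orbit_gamma_mono[OF j(2) loglift_step_lower[OF Cons.prems(2) j(1) c] i])
  also have "\<dots> \<le> loglift n c (orbit (vieta n) js (vieta n j x)) i"
    by (rule Cons.IH[OF j(2) vieta_sorted(1)[OF n Cons.prems(2) j(1)]])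
  finally show ?case by simp
qed simp

lemma loglift_orbit_upper:
  assumes c: "0 < c" "c ^ (n - 2) = real n"
    and js: "js \<in> lists {1..n-1}" and x: "x \<in> sorted_solutions n" and i: "i \<in> {1..n}"
  shows "loglift n c (orbit (vieta n) js x) i \<le> orbit (gamma_map n) js (loglift n c x) i"
  using js x
proof (induction js arbitrary: x rule: list.induct)
  case (Cons j js)
  then have j: "j \<in> {1..n-1}" "js \<in> lists {1..n-1}" by auto
  have "loglift n c (orbit (vieta n) js (vieta n j x)) i \<le> orbit (gamma_map n) js (loglift n c (vieta n j x)) i"
    by (rule Cons.IH[OF j(2) vieta_sorted(1)[OF n Cons.prems(2) j(1)]])
  also have "\<dots> \<le> orbit (gamma_map n) js (gamma_map n j (loglift n c x)) i"
    by (rule orbit_gamma_mono[OF j(2) loglift_step_upper[OF Cons.prems(2) j(1) c] i])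
  finally show ?case by simp
qed simp

lemma funpow_gamma_hvec:
  "(gamma_map n (n - 1) ^^ A) (hvec n) = (\<lambda>i. hvec n i + real A * (real n - 2) * bvec n i)"
proof -
  have v: "hvec n \<in> vectors n" using n by (auto simp: vectors_def hvec_def)
  have "(\<Sum>k=1..n-2. hvec n k) = (\<Sum>k=1..n-2. 1)" by (intro sum.cong) (auto simp: hvec_def)
  then have S: "(\<Sum>k=1..n-2. hvec n k) = real n - 2" using n by (simp add: of_nat_diff)
  have h: "hvec n n = real n - 1" "hvec n (n - 1) = 1" "bvec n n = 1" "bvec n (n - 1) = 1"
    using n by (auto simp: hvec_def bvec_def)
  show ?thesis
  proof
    fix i
    consider "i = n" | "i = n - 1" "i \<noteq> n" | "i \<noteq> n" "i \<noteq> n - 1" by blast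
    then show "(gamma_map n (n - 1) ^^ A) (hvec n) i = hvec n i + real A * (real n - 2) * bvec n i"
    proof cases
      case 1
      then show ?thesis unfolding funpow_gamma_map[OF n v] S by (simp add: h)
    next
      case 2
      show ?thesis unfolding funpow_gamma_map[OF n v] S if_not_P[OF 2(2)] unfolding 2 h
        by (cases "A = 0") (simp_all add: h algebra_simps)
    next
      case 3
      then have "bvec n i = 0" by (simp add: bvec_def)
      then show ?thesis unfolding funpow_gamma_map[OF n v] S using 3 by simp
    qed
  qed
qed

text \<open>At the root all logarithmic coordinates equal \<open>ln c > 0\<close>, which is at least
  the multiple \<open>ln c / (n - 1)\<close> of \<open>hvec\<close>, whose entries do not exceed
  \<open>n - 1\<close>.\<close>

lemma hurwitz_root_orbit_lower:
  assumes c: "1 < c" "c ^ (n - 2) = real n / 2" and \<sigma>: "\<sigma> \<in> lists (tau_index n)"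
  shows "ln c / (real n - 1) * ((real A + 1) * csize n \<sigma>) \<le>
    ln (c * real_of_int (orbit (vieta n) (word n (A, \<sigma>)) (hurwitz_root n) n))"
proof -
  have w: "word n (A, \<sigma>) \<in> lists {1..n-1}"
    using blocks_in_lists[OF \<sigma>] n by (auto simp: word_def)
  have ni: "n \<in> {1..n}" using n by auto
  \<comment> \<open>The initial run of \<open>A\<close> letters turns \<open>hvec\<close> into at
    least \<open>A + 1\<close> times \<open>bvec\<close>; this linear gain makes the sum over
    \<open>A\<close> converge later.\<close>
  have "(real A + 1) * bvec n i \<le> hvec n i + real A * (real n - 2) * bvec n i" if "i \<in> {1..n}" for i
  proof -
    have "bvec n i \<le> hvec n i" "0 \<le> bvec n i" using that n by (auto simp: bvec_def hvec_def)
    moreover have "real A * 1 * bvec n i \<le> real A * (real n - 2) * bvec n i"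
      using n \<open>0 \<le> bvec n i\<close> by (intro mult_right_mono mult_left_mono) auto
    ultimately show ?thesis by (simp add: algebra_simps)
  qed
  then have "orbit (tau n) \<sigma> (\<lambda>i. (real A + 1) * bvec n i) n \<le>
      orbit (tau n) \<sigma> (\<lambda>i. hvec n i + real A * (real n - 2) * bvec n i) n"
    by (intro orbit_tau_mono[OF n \<sigma>] ni)
  also have "\<dots> = orbit (gamma_map n) (word n (A, \<sigma>)) (hvec n) n"
    unfolding word_def fst_conv snd_conv orbit_append orbit_replicate orbit_blocks funpow_gamma_hvec ..
  finally have 1: "(real A + 1) * csize n \<sigma> \<le> orbit (gamma_map n) (word n (A, \<sigma>)) (hvec n) n"
    unfolding orbit_tau_scale[OF n] by (simp add: csize_def[OF n])
  have lc: "0 < ln c" using c by simp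
  have "ln c / (real n - 1) * hvec n i \<le> loglift n c (hurwitz_root n) i" if "i \<in> {1..n}" for i
  proof -
    have "hvec n i \<le> real n - 1" using that n by (auto simp: hvec_def)
    then have "ln c / (real n - 1) * hvec n i \<le> ln c / (real n - 1) * (real n - 1)"
      using lc n by (intro mult_left_mono) auto
    then show ?thesis using that n by (simp add: loglift_def hurwitz_root_def)
  qed
  then have "orbit (gamma_map n) (word n (A, \<sigma>)) (\<lambda>i. ln c / (real n - 1) * hvec n i) n \<le>
      orbit (gamma_map n) (word n (A, \<sigma>)) (loglift n c (hurwitz_root n)) n"
    by (intro orbit_gamma_mono[OF w] ni)
  also have "\<dots> \<le> loglift n c (orbit (vieta n) (word n (A, \<sigma>)) (hurwitz_root n)) n"
    using c by (intro loglift_orbit_lower w hurwitz_root_sorted[OF n] ni) auto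
  finally have "ln c / (real n - 1) * orbit (gamma_map n) (word n (A, \<sigma>)) (hvec n) n \<le>
      ln (c * real_of_int (orbit (vieta n) (word n (A, \<sigma>)) (hurwitz_root n) n))"
    unfolding orbit_gamma_scale using ni by (simp add: loglift_def)
  moreover have "ln c / (real n - 1) * ((real A + 1) * csize n \<sigma>) \<le>
      ln c / (real n - 1) * orbit (gamma_map n) (word n (A, \<sigma>)) (hvec n) n"
    using 1 lc n by (intro mult_left_mono) auto
  ultimately show ?thesis by linarith
qed

text \<open>The largest starting logarithm times \<open>hvec\<close> dominates
  \<open>loglift\<close>, and the orbit of \<open>hvec\<close> is \<open>hsize\<close>, which
  \<open>hsize_le\<close> compares with \<open>csize\<close>.\<close>

lemma strict_orbit_upper:
  assumes x: "x \<in> sorted_solutions n"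
  shows "\<exists>K>0. \<forall>\<sigma>\<in>lists (tau_index n).
    ln (real_of_int (orbit (vieta n) (concat (map (block n) \<sigma>)) x n)) \<le> K * csize n \<sigma>"
proof -
  define c where "c = real n powr (1 / real (n - 2))"
  have cpow: "c ^ (n - 2) = real n" unfolding c_def using n by (intro powr_inverse_power) auto
  have c1: "1 < c" unfolding c_def using n by (intro gr_one_powr) auto
  have ni: "n \<in> {1..n}" using n by auto
  note D = sorted_solutionsD[OF n x]
  define K where "K = ln (c * real_of_int (x n))"
  have xn: "1 \<le> x n" by (rule D(1)[OF ni])
  have K: "0 < K"
  proof -
    have "1 * 1 < c * real_of_int (x n)" using c1 xn by (intro mult_less_le_imp_less) auto
    then show ?thesis by (simp add: K_def)
  qed
  have start: "loglift n c x i \<le> K * hvec n i" if i: "i \<in> {1..n}" for i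
  proof -
    have "1 \<le> x i" "x i \<le> x n" using D(1)[OF i] D(2)[of i n] i by auto
    then have "ln (c * real_of_int (x i)) \<le> K"
      unfolding K_def using c1 by (intro ln_mono mult_left_mono) auto
    also have "K * 1 \<le> K * hvec n i" using K i n by (intro mult_left_mono) (auto simp: hvec_def)
    finally show ?thesis using i by (simp add: loglift_def)
  qed
  have "ln (real_of_int (orbit (vieta n) (concat (map (block n) \<sigma>)) x n)) \<le> K * (3 * (real n - 1)) * csize n \<sigma>"
    if \<sigma>: "\<sigma> \<in> lists (tau_index n)" for \<sigma>
  proof -
    let ?js = "concat (map (block n) \<sigma>)"
    have js: "?js \<in> lists {1..n-1}" by (rule blocks_in_lists[OF \<sigma>])
    let ?y = "real_of_int (orbit (vieta n) ?js x n)"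
    have "1 \<le> orbit (vieta n) ?js x n"
      by (rule sorted_solutionsD(1)[OF n orbit_vieta_sorted(1)[OF n js x] ni])
    then have y1: "1 \<le> ?y" by linarith
    have "1 * ?y \<le> c * ?y" using c1 y1 by (intro mult_right_mono) auto
    then have "ln ?y \<le> ln (c * ?y)" using y1 by (intro ln_mono) auto
    also have "\<dots> = loglift n c (orbit (vieta n) ?js x) n" using ni by (simp add: loglift_def)
    also have "\<dots> \<le> orbit (gamma_map n) ?js (loglift n c x) n"
      using c1 by (intro loglift_orbit_upper cpow js x ni) auto
    also have "\<dots> \<le> orbit (gamma_map n) ?js (\<lambda>i. K * hvec n i) n"
      by (rule orbit_gamma_mono[OF js start ni])
    also have "\<dots> = K * hsize n \<sigma>"
      unfolding orbit_blocks orbit_tau_scale[OF n] by (simp add: hsize_def[OF n])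
    also have "\<dots> \<le> K * (3 * (real n - 1) * csize n \<sigma>)"
      using K by (intro mult_left_mono hsize_le[OF n \<sigma>]) auto
    finally show ?thesis by (simp only: mult.assoc)
  qed
  moreover have "0 < K * (3 * (real n - 1))" using K n by simp
  ultimately show ?thesis by blast
qed

section \<open>Counting solutions by words\<close>

lemma hurwitz_solutions_finite:
  "finite {x \<in> hurwitz_solutions n a. \<forall>i\<in>{1..n}. \<bar>real_of_int (x i)\<bar> \<le> R}"
  by (rule finite_subset[OF _ finite_int_box[of n R]]) (auto simp: hurwitz_solutions_def)

text \<open>Words embed into the solutions: blocks decode uniquely, and the Vieta tree is free above
  a strictly increasing solution. A word with \<open>csize\<close> at most \<open>X\<close> reaches
  coordinates of size at most \<open>exp (K * X)\<close>.\<close>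

lemma card_words_le_hurwitz_count:
  "\<exists>K>0. \<forall>X. finite {\<sigma> \<in> lists (tau_index n). csize n \<sigma> \<le> X} \<and>
    card {\<sigma> \<in> lists (tau_index n). csize n \<sigma> \<le> X} \<le> hurwitz_count n (int n) (exp (K * X))"
proof -
  obtain x where x: "x \<in> strict_solutions n" using strict_solutions_nonempty[OF n] by blast
  have xs: "x \<in> sorted_solutions n" by (rule strict_solutionsD(1)[OF n x])
  obtain K where K: "0 < K" "\<And>\<sigma>. \<sigma> \<in> lists (tau_index n) \<Longrightarrow>
      ln (real_of_int (orbit (vieta n) (concat (map (block n) \<sigma>)) x n)) \<le> K * csize n \<sigma>"
    using strict_orbit_upper[OF xs] by blast
  have "finite {\<sigma> \<in> lists (tau_index n). csize n \<sigma> \<le> X} \<and>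
    card {\<sigma> \<in> lists (tau_index n). csize n \<sigma> \<le> X} \<le> hurwitz_count n (int n) (exp (K * X))" for X
  proof -
    let ?f = "\<lambda>\<sigma>. orbit (vieta n) (concat (map (block n) \<sigma>)) x"
    let ?S = "{\<sigma> \<in> lists (tau_index n). csize n \<sigma> \<le> X}"
    let ?H = "{x \<in> hurwitz_solutions n (int n). \<forall>i\<in>{1..n}. \<bar>real_of_int (x i)\<bar> \<le> exp (K * X)}"
    have "inj_on ((\<lambda>js. orbit (vieta n) js x) \<circ> (\<lambda>\<sigma>. concat (map (block n) \<sigma>))) (lists (tau_index n))"
      by (rule comp_inj_on[OF inj_on_blocks inj_on_subset[OF inj_on_orbit_vieta[OF n x]]])
        (use blocks_in_lists in blast)
    then have inj: "inj_on ?f ?S" unfolding comp_def by (rule inj_on_subset) auto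
    have sub: "?f ` ?S \<subseteq> ?H"
    proof
      fix y assume "y \<in> ?f ` ?S"
      then obtain \<sigma> where \<sigma>: "\<sigma> \<in> lists (tau_index n)" "csize n \<sigma> \<le> X" "y = ?f \<sigma>" by auto
      have y: "y \<in> sorted_solutions n"
        unfolding \<sigma>(3) by (rule orbit_vieta_sorted(1)[OF n blocks_in_lists[OF \<sigma>(1)] xs])
      note D = sorted_solutionsD[OF n y]
      have "1 \<le> y n" using n by (intro D(1)) auto
      then have yn: "0 < real_of_int (y n)" by simp
      have "ln (real_of_int (y n)) \<le> K * csize n \<sigma>" unfolding \<sigma>(3) by (rule K(2)[OF \<sigma>(1)])
      also have "\<dots> \<le> K * X" using K(1) \<sigma>(2) by (intro mult_left_mono) auto
      finally have "real_of_int (y n) \<le> exp (K * X)" using yn by (simp add: ln_le_cancel_iff[symmetric] del: ln_le_cancel_iff)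
      moreover have "\<bar>real_of_int (y i)\<bar> \<le> real_of_int (y n)" if "i \<in> {1..n}" for i
        using D(1)[OF that] D(2)[of i n] that by auto
      ultimately show "y \<in> ?H" using y by (force simp: sorted_solutions_def)
    qed
    have fin: "finite ?S" by (rule finite_imageD[OF finite_subset[OF sub hurwitz_solutions_finite] inj])
    have "card ?S = card (?f ` ?S)" by (rule card_image[OF inj, symmetric])
    also have "\<dots> \<le> card ?H" by (rule card_mono[OF hurwitz_solutions_finite sub])
    finally show ?thesis using fin by (simp add: hurwitz_count_def)
  qed
  then show ?thesis using K(1) by blast
qed

text \<open>A nonzero solution is recovered from its sorted absolute values, a map of positions and
  its signs; \<open>M\<close> counts the latter two, and 1 accounts for the zero solution.\<close>

lemma hurwitz_count_le_card_sorted: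
  "\<exists>M. \<forall>R. finite {z \<in> sorted_solutions n. real_of_int (z n) \<le> R} \<and>
    hurwitz_count n (int n) R \<le> 1 + M * card {z \<in> sorted_solutions n. real_of_int (z n) \<le> R}"
proof -
  define PE where "PE = ({1..n} \<rightarrow>\<^sub>E {1..n})"
  define SE where "SE = ({1..n} \<rightarrow>\<^sub>E {-1, 1::int})"
  have finPS: "finite PE" "finite SE" unfolding PE_def SE_def by (intro finite_PiE; simp)+
  have "finite {z \<in> sorted_solutions n. real_of_int (z n) \<le> R} \<and>
    hurwitz_count n (int n) R \<le> 1 + (card PE * card SE) * card {z \<in> sorted_solutions n. real_of_int (z n) \<le> R}" for R
  proof -
    let ?Z = "{z \<in> sorted_solutions n. real_of_int (z n) \<le> R}"
    let ?H = "{x \<in> hurwitz_solutions n (int n). \<forall>i\<in>{1..n}. \<bar>real_of_int (x i)\<bar> \<le> R}"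
    let ?f = "\<lambda>(z, p, s) i. if i \<in> {1..n} then s i * z (p i) else 0 :: int"
    have "?Z \<subseteq> ?H"
    proof
      fix z assume z: "z \<in> ?Z"
      then have zs: "z \<in> sorted_solutions n" by simp
      note D = sorted_solutionsD[OF n zs]
      have "\<bar>real_of_int (z i)\<bar> \<le> R" if "i \<in> {1..n}" for i
        using D(1)[OF that] D(2)[of i n] that z by auto
      then show "z \<in> ?H" using zs by (auto simp: sorted_solutions_def)
    qed
    then have finZ: "finite ?Z" by (rule finite_subset[OF _ hurwitz_solutions_finite])
    have sub: "?H \<subseteq> insert (\<lambda>_. 0) (?f ` (?Z \<times> PE \<times> SE))"
    proof
      fix x assume x: "x \<in> ?H"
      show "x \<in> insert (\<lambda>_. 0) (?f ` (?Z \<times> PE \<times> SE))"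
      proof (cases "x = (\<lambda>_. 0)")
        case False
        have xh: "x \<in> hurwitz_solutions n (int n)" using x by simp
        obtain z p k where z: "z \<in> sorted_solutions n" "p \<in> {1..n} \<rightarrow>\<^sub>E {1..n}" "\<forall>i\<in>{1..n}. \<bar>x i\<bar> = z (p i)"
          and k: "k \<in> {1..n}" "z n = \<bar>x k\<bar>"
          using sorted_representative[OF n xh False] by blast
        have "\<bar>real_of_int (x k)\<bar> \<le> R" using x k by simp
        then have "real_of_int (z n) \<le> R" using k by simp
        moreover define s where "s = (\<lambda>i\<in>{1..n}. if 0 \<le> x i then 1 else -1 :: int)"
        have "s \<in> SE" by (auto simp: s_def SE_def)
        moreover have "x = ?f (z, p, s)"
        proof
          fix i
          show "x i = ?f (z, p, s) i"
          proof (cases "i \<in> {1..n}")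
            case True
            then have "z (p i) = \<bar>x i\<bar>" using z(3) by simp
            then show ?thesis using True by (simp add: s_def)
          next
            case False
            then show ?thesis using xh by (auto simp: hurwitz_solutions_def vectors_def)
          qed
        qed
        ultimately have "x \<in> ?f ` (?Z \<times> PE \<times> SE)"
          using z(1,2) by (intro image_eqI[of _ _ "(z, p, s)"]) (auto simp: PE_def)
        then show ?thesis by simp
      qed simp
    qed
    have fin: "finite (?f ` (?Z \<times> PE \<times> SE))" using finZ finPS by (intro finite_imageI finite_cartesian_product)
    have "card ?H \<le> card (insert (\<lambda>_. 0) (?f ` (?Z \<times> PE \<times> SE)))"
      using sub fin by (intro card_mono) auto
    also have "\<dots> \<le> Suc (card (?f ` (?Z \<times> PE \<times> SE)))" by (rule card_insert_le_m1) simp_all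
    also have "card (?f ` (?Z \<times> PE \<times> SE)) \<le> card (?Z \<times> PE \<times> SE)"
      using finZ finPS by (intro card_image_le finite_cartesian_product)
    also have "\<dots> = (card PE * card SE) * card ?Z" by (simp add: card_cartesian_product)
    finally show ?thesis using finZ by (simp add: hurwitz_count_def)
  qed
  then show ?thesis by blast
qed

text \<open>Every sorted solution comes from a pair \<open>(A, \<sigma>)\<close> whose
  \<open>size\<close> is at most a multiple of \<open>1 + ln R\<close>. The sum of
  \<open>size powr -s\<close> over pairs factors into \<open>\<Sum> (A + 1) powr -s\<close> and the
  sum over words, so \<open>markov_card\<close> applies.\<close>

lemma hurwitz_count_upper:
  assumes s: "1 < s"
    and conv: "\<And>F. finite F \<Longrightarrow> F \<subseteq> lists (tau_index n) \<Longrightarrow> (\<Sum>\<sigma>\<in>F. csize n \<sigma> powr -s) \<le> B"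
  shows "\<exists>M L. 0 \<le> M \<and> 0 \<le> L \<and> (\<forall>R\<ge>1. real (hurwitz_count n (int n) R) \<le> 1 + M * (L + L * ln R) powr s)"
proof -
  define c where "c = (real n / 2) powr (1 / real (n - 2))"
  have cpow: "c ^ (n - 2) = real n / 2" unfolding c_def using n by (intro powr_inverse_power) auto
  have c1: "1 < c" unfolding c_def using n by (intro gr_one_powr) auto
  define \<kappa> where "\<kappa> = ln c / (real n - 1)"
  have \<kappa>: "0 < \<kappa>" using c1 n by (simp add: \<kappa>_def)
  have B0: "0 \<le> B" using conv[of "{}"] by simp
  have "summable (\<lambda>A. real (A + 1) powr -s)"
    using s by (intro summable_ignore_initial_segment) (simp add: summable_real_powr_iff)
  then have sm: "summable (\<lambda>A. (real A + 1) powr -s)" by (simp add: add.commute)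
  define Z where "Z = (\<Sum>A. (real A + 1) powr -s)"
  have Z0: "0 \<le> Z" unfolding Z_def by (intro suminf_nonneg sm) simp
  define size where "size q = (real (fst q) + 1) * csize n (snd q)" for q
  let ?A = "(UNIV :: nat set) \<times> lists (tau_index n)"
  have pos: "0 < size q" if "q \<in> ?A" for q
  proof -
    have "snd q \<in> lists (tau_index n)" using that by auto
    from csize_ge1[OF n this] show ?thesis unfolding size_def by (intro mult_pos_pos) linarith+
  qed
  have bound: "(\<Sum>q\<in>F. size q powr -s) \<le> Z * B" if F: "finite F" "F \<subseteq> ?A" for F
  proof -
    have sub: "snd ` F \<subseteq> lists (tau_index n)" using F by auto
    have "(\<Sum>q\<in>F. size q powr -s) \<le> (\<Sum>q\<in>fst ` F \<times> snd ` F. size q powr -s)"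
      using F by (intro sum_mono2) force+
    also have "\<dots> = (\<Sum>A\<in>fst ` F. \<Sum>\<sigma>\<in>snd ` F. (real A + 1) powr -s * csize n \<sigma> powr -s)"
    proof -
      have "size (A, \<sigma>) powr -s = (real A + 1) powr -s * csize n \<sigma> powr -s" if "\<sigma> \<in> snd ` F" for A \<sigma>
        using csize_ge1[OF n, of \<sigma>] that sub by (auto simp: size_def powr_mult)
      then show ?thesis by (subst sum.cartesian_product) (auto intro!: sum.cong)
    qed
    also have "\<dots> = (\<Sum>A\<in>fst ` F. (real A + 1) powr -s) * (\<Sum>\<sigma>\<in>snd ` F. csize n \<sigma> powr -s)"
      by (rule sum_product[symmetric])
    also have "\<dots> \<le> Z * B"
      unfolding Z_def using F sub sm Z0
      by (intro mult_mono sum_le_suminf conv suminf_nonneg sum_nonneg) auto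
    finally show ?thesis .
  qed
  obtain M where M: "\<And>R. finite {z \<in> sorted_solutions n. real_of_int (z n) \<le> R}"
    "\<And>R. hurwitz_count n (int n) R \<le> 1 + M * card {z \<in> sorted_solutions n. real_of_int (z n) \<le> R}"
    using hurwitz_count_le_card_sorted by blast
  \<comment> \<open>Chosen so that \<open>(ln c + ln R) / \<kappa> \<le> L + L * ln R\<close> for
    all \<open>R \<ge> 1\<close>.\<close>
  define L where "L = (ln c + 1) / \<kappa>"
  have L: "0 \<le> L" using \<kappa> c1 by (simp add: L_def)
  have "real (hurwitz_count n (int n) R) \<le> 1 + (real M * (Z * B)) * (L + L * ln R) powr s" if R: "1 \<le> R" for R
  proof -
    define X where "X = (ln c + ln R) / \<kappa>"
    have X0: "0 \<le> X" using \<kappa> c1 R by (simp add: X_def)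
    note mk = markov_card[of ?A size s "Z * B" X, OF pos _ bound X0]
    have fin: "finite {q \<in> ?A. size q \<le> X}" using s by (intro mk(1)) auto
    have "{z \<in> sorted_solutions n. real_of_int (z n) \<le> R} \<subseteq> (\<lambda>q. orbit (vieta n) (word n q) (hurwitz_root n)) ` {q \<in> ?A. size q \<le> X}"
    proof
      fix z assume z: "z \<in> {z \<in> sorted_solutions n. real_of_int (z n) \<le> R}"
      then obtain js where js: "js \<in> lists {1..n-1}" "z = orbit (vieta n) js (hurwitz_root n)"
        using sorted_solutions_orbit[OF n] by blast
      obtain A \<sigma> where \<sigma>: "\<sigma> \<in> lists (tau_index n)" "js = word n (A, \<sigma>)"
        using ex_word[OF js(1)] by blast
      have "1 \<le> z n" using z n by (intro sorted_solutionsD(1)[OF n]) auto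
      then have z1: "1 \<le> real_of_int (z n)" by simp
      have "\<kappa> * size (A, \<sigma>) \<le> ln (c * real_of_int (z n))"
        using hurwitz_root_orbit_lower[OF c1 cpow \<sigma>(1), of A] js \<sigma> by (simp add: \<kappa>_def size_def)
      also have "\<dots> \<le> ln (c * R)" using z z1 c1 by (intro ln_mono mult_left_mono) auto
      also have "\<dots> = ln c + ln R" using c1 R by (simp add: ln_mult)
      finally have "size (A, \<sigma>) \<le> X" using \<kappa> by (simp add: X_def field_simps)
      then show "z \<in> (\<lambda>q. orbit (vieta n) (word n q) (hurwitz_root n)) ` {q \<in> ?A. size q \<le> X}"
        using js \<sigma> by (intro image_eqI[of _ _ "(A, \<sigma>)"]) auto
    qed
    then have "card {z \<in> sorted_solutions n. real_of_int (z n) \<le> R} \<le>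
        card ((\<lambda>q. orbit (vieta n) (word n q) (hurwitz_root n)) ` {q \<in> ?A. size q \<le> X})"
      using fin by (intro card_mono) auto
    also have "\<dots> \<le> card {q \<in> ?A. size q \<le> X}" by (rule card_image_le[OF fin])
    finally have "real (card {z \<in> sorted_solutions n. real_of_int (z n) \<le> R}) \<le> X powr s * (Z * B)"
      using mk(2) s by fastforce
    also have "\<dots> \<le> (L + L * ln R) powr s * (Z * B)"
    proof (intro mult_right_mono powr_mono2)
      have "0 \<le> ln c * ln R" using c1 R by simp
      then have "ln c + ln R \<le> (ln c + 1) * (1 + ln R)" by (simp add: algebra_simps)
      then have "X \<le> (ln c + 1) * (1 + ln R) / \<kappa>" unfolding X_def using \<kappa> by (intro divide_right_mono) auto
      then show "X \<le> L + L * ln R" by (simp add: L_def algebra_simps add_divide_distrib)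
    qed (use X0 s Z0 B0 in auto)
    finally have "real M * real (card {z \<in> sorted_solutions n. real_of_int (z n) \<le> R}) \<le> real M * ((L + L * ln R) powr s * (Z * B))"
      by (intro mult_left_mono) auto
    moreover have "real (hurwitz_count n (int n) R) \<le> 1 + real M * real (card {z \<in> sorted_solutions n. real_of_int (z n) \<le> R})"
    proof -
      have "real (hurwitz_count n (int n) R) \<le> real (1 + M * card {z \<in> sorted_solutions n. real_of_int (z n) \<le> R})"
        using M(2)[of R] by (simp only: of_nat_le_iff)
      then show ?thesis by (simp only: of_nat_add of_nat_mult of_nat_1)
    qed
    ultimately show ?thesis by (simp add: mult_ac)
  qed
  moreover have "0 \<le> real M * (Z * B)" using Z0 B0 by simp
  ultimately show ?thesis using L by blast
qed

end

section \<open>The exponent\<close>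

text \<open>Convergence of the series at some \<open>s\<close> between \<open>b\<close> and
  \<open>\<beta>\<close> would bound the count by order \<open>ln R powr s\<close>, too small for
  \<open>\<beta>\<close>. Conversely, if \<open>\<beta> < b\<close>, the count is of order at most
  \<open>ln R powr t\<close> for some \<open>t < b\<close>, and the series would converge at
  \<open>b\<close>.\<close>

lemma conformal_exponent_unique:
  assumes n: "n \<ge> 3" and bar: "baragar_exponent n \<beta>" and b: "1 < b" and \<nu>: "conformal_measure n b \<nu>"
  shows "b = \<beta>"
proof -
  interpret conformal_ifs "Delta n" "tau_index n" "phi n" "factor n" "\<lambda>p. (real (fst p) + 3) / 2" "3/2"
     "3 * (real n - 1) * (real n - 1)" "\<lambda>_. 0" by (rule conformal_ifs_Delta[OF n])
  have conf: "conformal b \<nu>" using \<nu> conformal_measure_iff[OF n] by simp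
  have weight: "weight s \<sigma> (\<lambda>_. 0) = csize n \<sigma> powr -s" if "\<sigma> \<in> lists (tau_index n)" for s \<sigma>
    using csize_eq_cocycle[OF n that] by (simp add: weight_def)
  have "hurwitz_root n \<in> hurwitz_solutions n (int n)" using hurwitz_root_sorted[OF n] by (simp add: sorted_solutions_def)
  moreover have "hurwitz_root n \<noteq> (\<lambda>_. 0)"
  proof
    assume "hurwitz_root n = (\<lambda>_. 0)"
    from fun_cong[OF this, of 1] show False using n by (simp add: hurwitz_root_def)
  qed
  ultimately have O: "(\<lambda>R. ln R powr (\<beta> - \<epsilon>)) \<in> O[at_top](\<lambda>R. real (hurwitz_count n (int n) R))"
    "(\<lambda>R. real (hurwitz_count n (int n) R)) \<in> O[at_top](\<lambda>R. ln R powr (\<beta> + \<epsilon>))" if "0 < \<epsilon>" for \<epsilon>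
    using bar that n unfolding baragar_exponent_def by (auto dest!: spec[of _ "int n"])
  have "\<not> b < \<beta>"
  proof
    assume less: "b < \<beta>"
    define s where "s = (b + \<beta>) / 2"
    \<comment> \<open>Since \<open>\<beta> - \<epsilon> = s + \<epsilon>\<close>, at
      \<open>R = exp y\<close> the lower bound exceeds the upper one by
      \<open>y powr \<epsilon>\<close>, up to constants.\<close>
    define \<epsilon> where "\<epsilon> = (\<beta> - s) / 2"
    have s: "b < s" "1 < s" "0 < \<epsilon>" "\<beta> - \<epsilon> = s + \<epsilon>" using less b by (auto simp: s_def \<epsilon>_def field_simps)
    have "poincare_converges s" by (rule conformal_converges[OF b conf s(1)])
    then have sm: "(\<lambda>\<sigma>. weight s \<sigma> (\<lambda>_. 0)) summable_on lists (tau_index n)" by (simp add: poincare_converges_def)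
    have "(\<Sum>\<sigma>\<in>F. csize n \<sigma> powr -s) \<le> (\<Sum>\<^sub>\<infinity>\<sigma>\<in>lists (tau_index n). weight s \<sigma> (\<lambda>_. 0))"
      if F: "finite F" "F \<subseteq> lists (tau_index n)" for F
    proof -
      have "(\<Sum>\<sigma>\<in>F. csize n \<sigma> powr -s) = (\<Sum>\<sigma>\<in>F. weight s \<sigma> (\<lambda>_. 0))"
        using F by (intro sum.cong refl weight[symmetric]) auto
      also have "\<dots> \<le> (\<Sum>\<^sub>\<infinity>\<sigma>\<in>lists (tau_index n). weight s \<sigma> (\<lambda>_. 0))"
        using F by (intro finite_sum_le_infsum sm) auto
      finally show ?thesis .
    qed
    from hurwitz_count_upper[OF n s(2) this] obtain M L where bnd: "0 \<le> M" "0 \<le> L"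
      "\<And>R. 1 \<le> R \<Longrightarrow> real (hurwitz_count n (int n) R) \<le> 1 + M * (L + L * ln R) powr s" by blast
    obtain C where C: "0 < C" "\<forall>\<^sub>F R in at_top. norm (ln R powr (\<beta> - \<epsilon>)) \<le> C * norm (real (hurwitz_count n (int n) R))"
      using O(1)[OF s(3)] by (elim landau_o.bigE)
    then obtain R0 where R0: "\<And>R. R0 \<le> R \<Longrightarrow> ln R powr (\<beta> - \<epsilon>) \<le> C * real (hurwitz_count n (int n) R)"
      by (auto simp: eventually_at_top_linorder)
    define C' where "C' = C * (1 + M * (2 * L) powr s)"
    have C': "0 \<le> C'" using C bnd by (simp add: C'_def)
    \<comment> \<open>Large enough for \<open>y powr \<epsilon>\<close> to be at least
      \<open>C' + 1\<close>, whereas the two bounds together give at most \<open>C'\<close>.\<close>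
    define y where "y = max (max 1 R0) ((C' + 1) powr (1 / \<epsilon>))"
    have y: "1 \<le> y" "R0 \<le> y" "(C' + 1) powr (1 / \<epsilon>) \<le> y" by (auto simp: y_def)
    have "y \<le> exp y" using exp_ge_add_one_self[of y] by linarith
    then have ey: "R0 \<le> exp y" "1 \<le> exp y" using y by linarith+
    have "y powr (s + \<epsilon>) \<le> C * real (hurwitz_count n (int n) (exp y))"
      using R0[OF ey(1)] s(4) by simp
    also have "\<dots> \<le> C * (1 + M * (L + L * y) powr s)"
      using bnd(3)[OF ey(2)] C(1) by (intro mult_left_mono) auto
    also have "\<dots> \<le> C * (y powr s + M * ((2 * L) powr s * y powr s))"
    proof (intro mult_left_mono add_mono)
      show "1 \<le> y powr s" using y s by (intro ge_one_powr_ge_zero) auto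
      have "L * 1 \<le> L * y" using y bnd by (intro mult_left_mono) auto
      then have "(L + L * y) powr s \<le> (2 * L * y) powr s"
        using bnd y s by (intro powr_mono2) auto
      then show "(L + L * y) powr s \<le> (2 * L) powr s * y powr s" using bnd y by (simp add: powr_mult)
    qed (use bnd C in auto)
    also have "\<dots> = C' * y powr s" by (simp add: C'_def algebra_simps)
    finally have "y powr s * y powr \<epsilon> \<le> y powr s * C'" by (simp add: powr_add mult.commute)
    moreover have "0 < y powr s" using y by simp
    ultimately have "y powr \<epsilon> \<le> C'" by (simp only: mult_le_cancel_left_pos)
    moreover have "((C' + 1) powr (1 / \<epsilon>)) powr \<epsilon> \<le> y powr \<epsilon>" using y s by (intro powr_mono2) auto
    moreover have "((C' + 1) powr (1 / \<epsilon>)) powr \<epsilon> = C' + 1" using C' s by (simp add: powr_powr)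
    ultimately show False by linarith
  qed
  moreover have "\<not> \<beta> < b"
  proof
    assume less: "\<beta> < b"
    \<comment> \<open>\<open>max \<beta> 1\<close> because the sign of \<open>\<beta>\<close> is not
      yet known, while \<open>t\<close> must be positive.\<close>
    define t where "t = (max \<beta> 1 + b) / 2"
    have t: "0 < t" "t < b" "\<beta> < t" using less b by (auto simp: t_def max_def)
    obtain C where C: "0 < C" "\<forall>\<^sub>F R in at_top. norm (real (hurwitz_count n (int n) R)) \<le> C * norm (ln R powr (\<beta> + (t - \<beta>)))"
      using O(2)[of "t - \<beta>"] t by (auto elim: landau_o.bigE)
    then obtain R0 where R0: "\<And>R. R0 \<le> R \<Longrightarrow> real (hurwitz_count n (int n) R) \<le> C * ln R powr t"
      by (auto simp: eventually_at_top_linorder)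
    obtain K where K: "0 < K" and fin: "\<And>X. finite {\<sigma> \<in> lists (tau_index n). csize n \<sigma> \<le> X}"
      and cnt: "\<And>X. card {\<sigma> \<in> lists (tau_index n). csize n \<sigma> \<le> X} \<le> hurwitz_count n (int n) (exp (K * X))"
      using card_words_le_hurwitz_count[OF n] by blast
    define N where "N X = real (card {\<sigma> \<in> lists (tau_index n). csize n \<sigma> \<le> X})" for X
    \<comment> \<open>The asymptotic bound holds from here on; below, the count is at most
      \<open>N X0\<close>, a constant that \<open>K2\<close> includes.\<close>
    define X0 where "X0 = max 1 (R0 / K)"
    define K2 where "K2 = C * K powr t + N X0"
    have K2: "0 \<le> K2" using C by (simp add: K2_def N_def)
    have count: "N X \<le> K2 * X powr t" if X: "1 \<le> X" for X
    proof (cases "X0 \<le> X")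
      case True
      then have "R0 / K \<le> X" by (simp add: X0_def)
      then have "R0 \<le> K * X" using K by (simp add: field_simps)
      also have "\<dots> \<le> exp (K * X)" using exp_ge_add_one_self[of "K * X"] by linarith
      finally have "real (hurwitz_count n (int n) (exp (K * X))) \<le> C * (K * X) powr t" using R0 by fastforce
      then have "N X \<le> C * (K * X) powr t" using cnt[of X] unfolding N_def by linarith
      also have "\<dots> = C * K powr t * X powr t" using K X by (simp add: powr_mult)
      also have "\<dots> \<le> K2 * X powr t" by (intro mult_right_mono) (auto simp: K2_def N_def)
      finally show ?thesis .
    next
      case False
      then have "N X \<le> N X0" unfolding N_def using fin by (intro of_nat_mono card_mono) auto
      also have "\<dots> \<le> K2" using C by (simp add: K2_def)
      also have "K2 * 1 \<le> K2 * X powr t" using X t K2 by (intro mult_left_mono ge_one_powr_ge_zero) auto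
      finally show ?thesis by simp
    qed
    have "poincare_converges b"
    proof (rule converges_if_bounded)
      fix F assume F: "finite F" "F \<subseteq> lists (tau_index n)"
      have "(\<Sum>\<sigma>\<in>F. weight b \<sigma> (\<lambda>_. 0)) = (\<Sum>\<sigma>\<in>F. csize n \<sigma> powr -b)"
        using F by (intro sum.cong refl weight) auto
      also have "\<dots> \<le> (\<Sum>m. K2 * 2 powr t * (2 powr (t - b)) ^ m)"
        using csize_ge1[OF n] t K2 fin count F unfolding N_def
        by (intro sum_powr_le_of_counting[where A = "lists (tau_index n)"]) auto
      finally show "(\<Sum>\<sigma>\<in>F. weight b \<sigma> (\<lambda>_. 0)) \<le> (\<Sum>m. K2 * 2 powr t * (2 powr (t - b)) ^ m)" .
    qed
    then show False using conformal_diverges[OF b conf] by simp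
  qed
  ultimately show ?thesis by simp
qed

theorem theorem1p9:
  fixes n :: nat and \<beta> :: real
  assumes "n \<ge> 3"
    and "baragar_exponent n \<beta>"
  shows "1 < \<beta> \<and> (\<exists>\<nu>. conformal_measure n \<beta> \<nu>) \<and>
    (\<forall>b>1. (\<exists>\<nu>. conformal_measure n b \<nu>) \<longrightarrow> b = \<beta>)"
proof -
  interpret conformal_ifs "Delta n" "tau_index n" "phi n" "factor n" "\<lambda>p. (real (fst p) + 3) / 2" "3/2"
     "3 * (real n - 1) * (real n - 1)" "\<lambda>_. 0" by (rule conformal_ifs_Delta[OF assms(1)])
  have "0 \<le> w i \<and> w i \<le> 1" if "w \<in> Delta n" for w i
    using Delta_bounds[OF assms(1) that, of i] by simp
  then obtain b \<nu> where b: "1 < b" "conformal b \<nu>"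
    using exists_conformal[of "21/20"] L_lower[OF assms(1)] by auto
  then have \<nu>: "conformal_measure n b \<nu>" using conformal_measure_iff[OF assms(1)] by simp
  have uniq: "b' = \<beta>" if "1 < b'" "conformal_measure n b' \<nu>'" for b' \<nu>'
    using conformal_exponent_unique[OF assms that] .
  \<comment> \<open>Only now is \<open>1 < \<beta>\<close> available: it is inherited from the
    conformal exponent \<open>b\<close> found above.\<close>
  then have "b = \<beta>" using b(1) \<nu> by blast
  then show ?thesis using b(1) \<nu> uniq by blast
qed

end
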